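(* Let $\mathsf L(x)=\mathfrak L(L(x),M(x))$ be a composite with values in \[ \mathbb M_{21}=\{\mathfrak L(L,M):\ L>0,\ L^{-1}<-2MR_\perp\}, \] with effective tensor $\mathsf L^*=\mathfrak L(L^*,M^* )\in\mathbb M_{21}$. Then $M^*$ does not depend on $L(x)$, but only on $M(x)$, and is determined as follows. Put \[ \Lambda(M)=\begin{pmatrix}1&\frac12\mathrm{Tr}M\\ \frac12\mathrm{Tr}M&\det M\end{pmatrix},\qquad P(M)=-R_\perp\frac{M-\frac12(\mathrm{Tr}M)I_2}{\det\Lambda(M)} . \] Then $\Lambda(M(x))\otimes P(M(x))$ takes values in the exact relation \[ \mathbb M_9=\{\Lambda\otimes P>0:\ \Lambda=\Lambda^T,\ P=P^T,\ \Lambda>0,\ P>0,\ \det\Lambda\det P=1\} \] (whose elements are uniquely represented as $\Lambda\otimes P$ with $\Lambda_{11}=1$), its effective tensor is \[ \big(\Lambda(M(\cdot))\otimes P(M(\cdot))\big)^*=\Lambda(M^* )\otimes P(M^* ), \] and hence, writing this effective tensor as $\Lambda^*\otimes P^*$ with $\Lambda^*_{11}=1$ and $\det\Lambda^*\det P^*=1$, \[ M^*=\Lambda^*_{12}I_2+(\det\Lambda^* )R_\perp P^* . \]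
   Context: Let $R_\perp=\begin{pmatrix}0&-1\\1&0\end{pmatrix}$ and let $I_2$ be the $2\times2$ identity. Let $\mathcal T=\mathbb R^2\oplus\mathbb R^2$. Operators on $\mathcal T$ are written as $2\times2$ block matrices with real $2\times 2$ blocks, and $A\otimes B$ is the block matrix with blocks $A_{ij}B$. Put $\mathsf T=R_\perp\otimes R_\perp$. $\mathrm{Sym}^+(\mathcal T)$ is the set of symmetric positive definite operators on $\mathcal T$. For real $2\times2$ matrices $L=L^T$ and $M$, \[ \mathfrak L(L,M)=\begin{pmatrix} L & LM \\ {M^T}L & {M^T}LM \end{pmatrix}+\mathsf T . \] In $\mathbb M_{21}$, $L$ ranges over real symmetric and $M$ over real $2\times2$ matrices. Inequalities between (not necessarily symmetric) matrices are in the sense of quadratic forms. A composite is a $[0,1]^2$-periodic measurable map $\mathsf L:\mathbb R^2\to\mathrm{Sym}^+(\mathcal T)$ with values in a compact subset of $\mathrm{Sym}^+(\mathcal T)$. Its effective tensor $\mathsf L^*\in\mathrm{Sym}^+(\mathcal T)$, also written $(\mathsf L(\cdot))^*$, is defined by $\mathsf L^*E_0=\int_{[0,1]^2}\mathsf L(x)E(x)\,dx$ for $E_0\in\mathcal T$, where $E=E_0+(\nabla\varphi_1,\nabla\varphi_2)$ with $\varphi_1,\varphi_2\in H^1_{\rm per}$ is the unique such field for which both $\mathbb R^2$-components of $\mathsf L E$ are divergence-free. A set $\mathbb M\subset\mathrm{Sym}^+(\mathcal T)$ is an exact relation if $\mathsf L^*\in\mathbb M$ for every composite with $\mathsf L(x)\in\mathbb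 M$ for a.e. $x$. *)

theory Defs
  imports "HOL-Analysis.Analysis"
begin

text \<open>
  An element of the sum of two copies of the plane is a vector indexed by pairs \<open>(i, a)\<close>, where
  \<open>i\<close> selects the summand and \<open>a\<close> the coordinate in it. An operator is a matrix indexed by such
  pairs; the block in position \<open>(i, j)\<close> collects the entries with row \<open>(i, a)\<close> and column \<open>(j, b)\<close>.
\<close>

type_synonym mat2 = "real^2^2"
type_synonym tvec = "real^(2 \<times> 2)"
type_synonym tens = "real^(2 \<times> 2)^(2 \<times> 2)"

definition comp :: "2 \<Rightarrow> tvec \<Rightarrow> real^2" where
  "comp i v = (\<chi> a. v $ (i, a))"

definition kron :: "mat2 \<Rightarrow> mat2 \<Rightarrow> tens" where
  "kron A B = (\<chi> r c. A $ fst r $ fst c * B $ snd r $ snd c)"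

definition block :: "mat2 \<Rightarrow> mat2 \<Rightarrow> mat2 \<Rightarrow> mat2 \<Rightarrow> tens" where
  "block A B C D = (\<chi> r c.
     (if fst r = 1 then (if fst c = 1 then A else B)
                   else (if fst c = 1 then C else D)) $ snd r $ snd c)"

definition qf_less :: "real^'n^'n \<Rightarrow> real^'n^'n \<Rightarrow> bool" where
  "qf_less A B \<longleftrightarrow> (\<forall>x. x \<noteq> 0 \<longrightarrow> x \<bullet> (A *v x) < x \<bullet> (B *v x))"

definition Sym_pos :: "tens set" where
  "Sym_pos = {A. transpose A = A \<and> qf_less 0 A}"

definition R_perp :: mat2 where
  "R_perp = vector [vector [0, -1], vector [1, 0]]"

definition T_op :: tens where
  "T_op = kron R_perp R_perp"

definition frakL :: "mat2 \<Rightarrow> mat2 \<Rightarrow> tens" where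
  "frakL L M = block L (L ** M) (transpose M ** L) (transpose M ** L ** M) + T_op"

definition M21 :: "tens set" where
  "M21 = {frakL L M | L M. transpose L = L \<and> qf_less 0 L \<and>
            qf_less (matrix_inv L) ((-2) *\<^sub>R (M ** R_perp))}"

definition M9_pair :: "mat2 \<Rightarrow> mat2 \<Rightarrow> bool" where
  "M9_pair \<Lambda> P \<longleftrightarrow> transpose \<Lambda> = \<Lambda> \<and> transpose P = P \<and> qf_less 0 \<Lambda> \<and> qf_less 0 P \<and>
     det \<Lambda> * det P = 1"

definition M9 :: "tens set" where
  "M9 = {kron \<Lambda> P | \<Lambda> P. qf_less 0 (kron \<Lambda> P) \<and> M9_pair \<Lambda> P}"

definition Lam :: "mat2 \<Rightarrow> mat2" where
  "Lam M = vector [vector [1, trace M / 2], vector [trace M / 2, det M]]"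

definition Pmat :: "mat2 \<Rightarrow> mat2" where
  "Pmat M = - (R_perp ** ((1 / det (Lam M)) *\<^sub>R (M - (trace M / 2) *\<^sub>R mat 1)))"

definition Q :: "(real^2) set" where
  "Q = cbox 0 One"

definition periodic :: "(real^2 \<Rightarrow> 'b) \<Rightarrow> bool" where
  "periodic f \<longleftrightarrow> (\<forall>x i. f (x + axis i 1) = f x)"

definition L2per :: "(real^2 \<Rightarrow> 'b::real_normed_vector) \<Rightarrow> bool" where
  "L2per f \<longleftrightarrow> periodic f \<and> f \<in> borel_measurable lebesgue \<and>
     set_integrable lebesgue Q (\<lambda>x. (norm (f x))\<^sup>2)"

definition partial :: "2 \<Rightarrow> (real^2 \<Rightarrow> real) \<Rightarrow> real^2 \<Rightarrow> real" where
  "partial a \<psi> x = frechet_derivative \<psi> (at x) (axis a 1)"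

text \<open>
  Test functions are the smooth periodic functions. Smoothness is expressed by differentiability
  of all iterated partial derivatives.
\<close>

definition test_fun :: "(real^2 \<Rightarrow> real) \<Rightarrow> bool" where
  "test_fun \<psi> \<longleftrightarrow> periodic \<psi> \<and> (\<forall>as x. foldr partial as \<psi> differentiable (at x))"

definition weak_gradient :: "(real^2 \<Rightarrow> real) \<Rightarrow> (real^2 \<Rightarrow> real^2) \<Rightarrow> bool" where
  "weak_gradient \<phi> g \<longleftrightarrow> (\<forall>\<psi> a. test_fun \<psi> \<longrightarrow>
     (LINT x:Q|lebesgue. \<phi> x * partial a \<psi> x) = - (LINT x:Q|lebesgue. g x $ a * \<psi> x))"

definition H1per_with_gradient :: "(real^2 \<Rightarrow> real) \<Rightarrow> (real^2 \<Rightarrow> real^2) \<Rightarrow> bool" where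
  "H1per_with_gradient \<phi> g \<longleftrightarrow> L2per \<phi> \<and> L2per g \<and> weak_gradient \<phi> g"

definition div_free :: "(real^2 \<Rightarrow> real^2) \<Rightarrow> bool" where
  "div_free J \<longleftrightarrow> (\<forall>\<psi>. test_fun \<psi> \<longrightarrow>
     (LINT x:Q|lebesgue. J x \<bullet> (\<chi> a. partial a \<psi> x)) = 0)"

definition composite :: "(real^2 \<Rightarrow> tens) \<Rightarrow> bool" where
  "composite L \<longleftrightarrow> periodic L \<and> L \<in> borel_measurable lebesgue \<and>
     (\<exists>K. compact K \<and> K \<subseteq> Sym_pos \<and> range L \<subseteq> K)"

definition cell_field :: "(real^2 \<Rightarrow> tens) \<Rightarrow> tvec \<Rightarrow> (real^2 \<Rightarrow> tvec) \<Rightarrow> bool" where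
  "cell_field L E0 E \<longleftrightarrow>
     (\<exists>\<phi> g. \<forall>i. H1per_with_gradient (\<phi> i) (g i) \<and> (\<forall>x. comp i (E x) = comp i E0 + g i x)) \<and>
     (\<forall>i. div_free (\<lambda>x. comp i (L x *v E x)))"

text \<open>
  The effective tensor is described by its graph; the required uniqueness of the cell field up to
  null sets makes the relation functional.
\<close>

definition is_effective_tensor :: "(real^2 \<Rightarrow> tens) \<Rightarrow> tens \<Rightarrow> bool" where
  "is_effective_tensor L Ls \<longleftrightarrow> (\<forall>E0. \<exists>E. cell_field L E0 E \<and>
     (\<forall>E'. cell_field L E0 E' \<longrightarrow> (AE x\<in>Q in lebesgue. E' x = E x)) \<and>
     Ls *v E0 = (LINT x:Q|lebesgue. L x *v E x))"

definition exact_relation :: "tens set \<Rightarrow> bool" where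
  "exact_relation S \<longleftrightarrow> S \<subseteq> Sym_pos \<and>
     (\<forall>L Ls. composite L \<and> (AE x in lebesgue. L x \<in> S) \<and> is_effective_tensor L Ls \<longrightarrow> Ls \<in> S)"

end

theory Submission
  imports Defs
begin

text \<open>
  Every field \<open>T E\<close> with \<open>E\<close> a pair of gradients is divergence-free, so the cell problem for
  \<open>frakL L M\<close> only sees the degenerate part \<open>S = frakL L M - T\<close>. Its solutions yield two families of
  solutions for \<open>A = \<Lambda>(M) \<otimes> P(M)\<close>. If \<open>E0\<close> is in the kernel of the effective \<open>S\<close>, then the energy
  \<open>\<integral> E \<bullet> S E\<close> vanishes, hence \<open>E1 + M E2 = 0\<close>, and this gives \<open>A E = T E\<close>. On the other hand
  \<open>w = S E\<close> is divergence-free for every solution \<open>E\<close>, so \<open>T w\<close> is again a pair of gradients, and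
  \<open>A (T w) = - w\<close>. The means of the two families are governed by \<open>M\<^sup>*\<close> alone and span the whole
  space, which determines the effective tensor of \<open>A\<close> without any reference to \<open>L\<close>.

  The set \<open>M9\<close> consists of the symmetric positive definite \<open>A\<close> with \<open>A T A = T\<close>. If \<open>E\<close> solves the
  cell problem for such an \<open>A\<close>, so does \<open>T A E\<close>, with flux \<open>T E\<close>; hence the effective tensor
  inherits the equation and \<open>M9\<close> is an exact relation.

  Two facts about square-integrable periodic fields carry the analysis: gradients are orthogonal
  to divergence-free fields, and a rotated divergence-free field of mean zero is a gradient.
\<close>

subsection \<open>Algebra of the tensors\<close>

text \<open>Since \<open>T_op\<close> squares to the identity, the equation \<open>A T A = T\<close>
  says that \<open>T A\<close> is an involution. For \<open>A = kron (Lam M) (Pmat M)\<close> its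
  eigenspace for \<open>1\<close> consists of all \<open>(- M y, y)\<close>, and its eigenspace for
  \<open>-1\<close> is the image under \<open>T\<close> of all \<open>(j, M^T j)\<close>. These are
  two planes fixed by \<open>M\<close> alone, and ellipticity of \<open>M\<close> makes them
  complementary. Passing to effective tensors carries the planes of \<open>M x\<close> to those of
  \<open>Ms\<close>, hence the involution to the involution.

  Solvability of a cell problem is never proved: \<open>is_effective_tensor\<close> comes with cell
  fields for \<open>frakL L M\<close>, and all cell fields needed for \<open>A\<close> are built
  from them.

  The main obstacle is the potential of a curl-free field when derivatives are weak and tested only
  against smooth periodic functions. It is built by integration along lines, and a plain primitive
  of a periodic function is not periodic. The primitives are therefore normalised by line averages
  (\<open>nprim\<close>, \<open>pot_kernel\<close>), so that every function to which the curl
  condition is applied is again a test function.\<close>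

definition tpair :: "real^2 \<Rightarrow> real^2 \<Rightarrow> tvec" where
  "tpair u v = (\<chi> p. if fst p = 1 then u $ snd p else v $ snd p)"

lemma UNIV_22: "(UNIV :: (2 \<times> 2) set) = {(1,1),(1,2),(2,1),(2,2)}"
  by (auto simp: set_eq_iff) (metis exhaust_2)+

lemma sum_22: "sum f (UNIV :: (2 \<times> 2) set) = f (1,1) + f (1,2) + (f (2,1) + f (2,2))"
  by (simp add: UNIV_22 add.assoc)

lemma forall_22: "(\<forall>p :: 2 \<times> 2. F p) \<longleftrightarrow> F (1,1) \<and> F (1,2) \<and> F (2,1) \<and> F (2,2)"
  by (simp add: split_paired_All forall_2)

lemmas vec2_simps = vec_eq_iff forall_2 forall_22 sum_2 sum_22 inner_vec_def comp_def tpair_def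
  matrix_vector_mult_def matrix_matrix_mult_def kron_def block_def R_perp_def T_op_def

lemma comp_tpair [simp]: "comp 1 (tpair u v) = u" "comp 2 (tpair u v) = v"
  by (simp_all add: vec2_simps)

lemma tvec_eq_iff: "v = w \<longleftrightarrow> comp 1 v = comp 1 w \<and> comp 2 v = comp 2 w"
  by (simp add: vec2_simps)

lemma linear_comp: "linear (comp i)"
  by (rule linearI) (simp_all add: comp_def vec_eq_iff)

lemma comp_simps [simp]:
  "comp i 0 = 0" "comp i (v + w) = comp i v + comp i w" "comp i (v - w) = comp i v - comp i w"
  "comp i (- v) = - comp i v" "comp i (r *\<^sub>R v) = r *\<^sub>R comp i v"
  by (simp_all add: comp_def vec_eq_iff)

lemma inner_comp: "v \<bullet> w = comp 1 v \<bullet> comp 1 w + comp 2 v \<bullet> comp 2 w"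
  by (simp add: vec2_simps)

lemma comp_kron: "comp i (kron A B *v v) = B *v (A $ i $ 1 *\<^sub>R comp 1 v + A $ i $ 2 *\<^sub>R comp 2 v)"
  by (simp add: vec2_simps algebra_simps)

lemma comp_T_op [simp]:
  "comp 1 (T_op *v v) = - (R_perp *v comp 2 v)" "comp 2 (T_op *v v) = R_perp *v comp 1 v"
  by (simp_all add: vec2_simps)

lemma R_perp_R_perp [simp]: "R_perp *v (R_perp *v u) = - u"
  by (simp add: vec2_simps)

lemma T_op_T_op [simp]: "T_op *v (T_op *v v) = v"
  by (simp add: vec2_simps)

lemma comp_frakL:
  "comp 1 (frakL L M *v v - T_op *v v) = L *v (comp 1 v + M *v comp 2 v)"
  "comp 2 (frakL L M *v v - T_op *v v) = transpose M *v (L *v (comp 1 v + M *v comp 2 v))"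
  by (simp_all add: frakL_def matrix_vector_mult_add_rdistrib)
    (simp_all add: vec2_simps vector_matrix_mult_def transpose_def algebra_simps)

lemma matrix_vector_mult_uminus:
  fixes A :: "real^'n^'m"
  shows "A *v (- u) = - (A *v u)" "(- A) *v u = - (A *v u)"
  by (simp_all add: matrix_vector_mult_def vec_eq_iff sum_negf)

text \<open>Completing the square in the first variable. The matrix need not be symmetric: the form
  sees the off-diagonal entries only through their sum, so the criterion is the discriminant of a
  binary quadratic form.\<close>

lemma qf_less_0_mat2:
  fixes A :: mat2
  shows "qf_less 0 A \<longleftrightarrow> 0 < A $ 1 $ 1 \<and> (A $ 1 $ 2 + A $ 2 $ 1)\<^sup>2 < 4 * (A $ 1 $ 1 * A $ 2 $ 2)"
proof
  define a b d where "a = A $ 1 $ 1" and "b = A $ 1 $ 2 + A $ 2 $ 1" and "d = A $ 2 $ 2"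
  have form: "x \<bullet> (A *v x) = a * (x $ 1)\<^sup>2 + b * (x $ 1 * x $ 2) + d * (x $ 2)\<^sup>2" for x
    by (simp add: vec2_simps a_def b_def d_def power2_eq_square algebra_simps)
  {
    assume A: "qf_less 0 A"
    have *: "0 < x \<bullet> (A *v x)" if "x \<noteq> 0" for x
      using A that by (simp add: qf_less_def)
    have a: "0 < a"
      using *[of "vector [1, 0]"] by (simp add: form vec_eq_iff forall_2)
    \<comment> \<open>At \<open>(b, -2 a)\<close> the completed square \<open>2 a x1 + b x2\<close>
      vanishes, so the form shows the bare discriminant.\<close>
    have "0 < a * b\<^sup>2 + b * (b * (- (2 * a))) + d * (2 * a)\<^sup>2"
      using *[of "vector [b, - (2 * a)]"] a by (simp add: form vec_eq_iff forall_2)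
    also have "\<dots> = a * (4 * (a * d) - b\<^sup>2)"
      by (simp add: power2_eq_square algebra_simps)
    finally have "b\<^sup>2 < 4 * (a * d)"
      using a by (simp add: zero_less_mult_iff)
    with a show "0 < A $ 1 $ 1 \<and> (A $ 1 $ 2 + A $ 2 $ 1)\<^sup>2 < 4 * (A $ 1 $ 1 * A $ 2 $ 2)"
      by (simp add: a_def b_def d_def)
  next
    assume "0 < A $ 1 $ 1 \<and> (A $ 1 $ 2 + A $ 2 $ 1)\<^sup>2 < 4 * (A $ 1 $ 1 * A $ 2 $ 2)"
    then have a: "0 < a" and disc: "b\<^sup>2 < 4 * (a * d)"
      by (auto simp: a_def b_def d_def)
    show "qf_less 0 A"
      unfolding qf_less_def
    proof (intro allI impI)
      fix x :: "real^2" assume x: "x \<noteq> 0"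
      have eq: "4 * a * (x \<bullet> (A *v x)) = (2 * a * x $ 1 + b * x $ 2)\<^sup>2 + (4 * (a * d) - b\<^sup>2) * (x $ 2)\<^sup>2"
        by (simp add: form power2_eq_square algebra_simps)
      have "0 < (2 * a * x $ 1 + b * x $ 2)\<^sup>2 + (4 * (a * d) - b\<^sup>2) * (x $ 2)\<^sup>2"
      proof (cases "x $ 2 = 0")
        case True
        with x a show ?thesis by (simp add: vec_eq_iff forall_2)
      next
        case False
        with disc show ?thesis by (intro add_nonneg_pos) auto
      qed
      then have "0 < 4 * a * (x \<bullet> (A *v x))" using eq by simp
      with a show "x \<bullet> (0 *v x) < x \<bullet> (A *v x)" by (simp add: zero_less_mult_iff)
    qed
  }
qed

text \<open>
  In terms of the entries, \<open>elliptic M\<close> says that the symmetric part of \<open>- (R_perp ** M)\<close>,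
  which is \<open>det (Lam M)\<close> times \<open>Pmat M\<close>, is positive definite.
\<close>

definition elliptic :: "mat2 \<Rightarrow> bool" where
  "elliptic M \<longleftrightarrow> 0 < M $ 2 $ 1 \<and> (M $ 2 $ 2 - M $ 1 $ 1)\<^sup>2 < 4 * (M $ 2 $ 1 * (- M $ 1 $ 2))"

lemma elliptic_iff: "elliptic M \<longleftrightarrow> qf_less 0 (- (R_perp ** M))"
  unfolding elliptic_def qf_less_0_mat2 by (simp add: vec2_simps power2_commute)

section \<open>Positivity and the parameters of \<open>frakL\<close>\<close>

lemma frakL_diff_form:
  "v \<bullet> (frakL L M *v v - T_op *v v)
     = (comp 1 v + M *v comp 2 v) \<bullet> (L *v (comp 1 v + M *v comp 2 v))"
  unfolding inner_comp[of v] comp_frakL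
  by (simp add: inner_add_left) (metis dot_lmul_matrix inner_commute)

lemma frakL_form:
  "v \<bullet> (frakL L M *v v) = (comp 1 v + M *v comp 2 v) \<bullet> (L *v (comp 1 v + M *v comp 2 v))
     + 2 * (comp 2 v \<bullet> (R_perp *v comp 1 v))"
proof -
  have "v \<bullet> (T_op *v v) = 2 * (comp 2 v \<bullet> (R_perp *v comp 1 v))"
    by (simp add: vec2_simps algebra_simps)
  then show ?thesis using frakL_diff_form[of v L M] by (simp add: inner_diff_right)
qed

lemma transpose_eq_iff: "transpose A = A \<longleftrightarrow> (\<forall>i j. A $ i $ j = A $ j $ i)"
  by (auto simp: transpose_def vec_eq_iff)

text \<open>Vectors \<open>(x, 0)\<close> see only \<open>L\<close>. On the vectors
  \<open>(- M x, x)\<close> the part containing \<open>L\<close> vanishes and only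
  \<open>T_op\<close> contributes, so positivity there is a condition on \<open>M\<close> alone,
  namely ellipticity. This serves the values of a composite, which all lie in
  \<open>Sym_pos\<close>.\<close>

lemma frakL_Sym_posD:
  assumes "frakL L M \<in> Sym_pos"
  shows "transpose L = L" "qf_less 0 L" "elliptic M"
proof -
  have pos: "0 < v \<bullet> (frakL L M *v v)" if "v \<noteq> 0" for v
    using assms that by (auto simp: Sym_pos_def qf_less_def)
  show "qf_less 0 L"
    unfolding qf_less_def
  proof (intro allI impI)
    fix x :: "real^2" assume "x \<noteq> 0"
    then have "0 < tpair x 0 \<bullet> (frakL L M *v tpair x 0)"
      by (intro pos) (simp add: tvec_eq_iff)
    then show "x \<bullet> (0 *v x) < x \<bullet> (L *v x)" by (simp add: frakL_form)
  qed
  show "elliptic M"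
    unfolding elliptic_iff qf_less_def
  proof (intro allI impI)
    fix x :: "real^2" assume "x \<noteq> 0"
    then have "0 < tpair (- (M *v x)) x \<bullet> (frakL L M *v tpair (- (M *v x)) x)"
      by (intro pos) (simp add: tvec_eq_iff)
    then have "x \<bullet> (R_perp *v (M *v x)) < 0" 
      by (simp add: frakL_form matrix_vector_mult_uminus)
    then show "x \<bullet> (0 *v x) < x \<bullet> (- (R_perp ** M) *v x)"
      by (simp add: matrix_vector_mul_assoc matrix_vector_mult_uminus)
  qed
  \<comment> \<open>The diagonal blocks of \<open>T_op\<close> vanish because \<open>R_perp\<close>
    has zero diagonal, so the upper left block is exactly \<open>L\<close>.\<close>
  have "frakL L M $ (1, i) $ (1, j) = frakL L M $ (1, j) $ (1, i)" for i j
    using assms by (simp add: Sym_pos_def transpose_eq_iff)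
  then show "transpose L = L"
    by (simp add: transpose_eq_iff frakL_def block_def T_op_def kron_def R_perp_def)
qed

text \<open>Membership in \<open>M21\<close> only provides some parameters \<open>L'\<close>,
  \<open>M'\<close> representing the same tensor, so the given ones must first be identified with
  them. Then \<open>matrix_inv L\<close> is positive definite, which leaves
  \<open>- (M ** R_perp)\<close> positive definite.\<close>

lemma M21D:
  assumes "frakL L M \<in> M21"
  shows "transpose L = L" "qf_less 0 L" "elliptic M"
proof -
  obtain L' M' where eq: "frakL L M = frakL L' M'" and L': "transpose L' = L'" "qf_less 0 L'"
    and M': "qf_less (matrix_inv L') ((-2) *\<^sub>R (M' ** R_perp))"
    using assms by (auto simp: M21_def)
  \<comment> \<open>Injectivity of \<open>frakL\<close>: the first component at \<open>y = 0\<close>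
    determines \<open>L\<close>, and at \<open>x = 0\<close> it then determines \<open>M\<close>
    because \<open>L\<close> has trivial kernel.\<close>
  have "comp 1 (frakL L M *v tpair x y - T_op *v tpair x y)
      = comp 1 (frakL L' M' *v tpair x y - T_op *v tpair x y)" for x y
    by (simp only: eq)
  then have *: "L *v (x + M *v y) = L' *v (x + M' *v y)" for x y
    by (simp only: comp_frakL comp_tpair)
  from *[of _ 0] have [simp]: "L' = L" by (simp add: matrix_eq)
  have "u = 0" if "L *v u = 0" for u
    using L'(2) that by (force simp: qf_less_def)
  then have inv: "invertible L"
    by (simp add: invertible_left_inverse matrix_left_invertible_ker)
  from *[of 0] have "L *v (M *v y - M' *v y) = 0" for y by (simp add: matrix_vector_mult_diff_distrib)
  then have "M *v y = M' *v y" for y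
    using \<open>\<And>u. L *v u = 0 \<Longrightarrow> u = 0\<close> by force
  then have [simp]: "M' = M" by (simp add: matrix_eq)
  show "transpose L = L" "qf_less 0 L" using L' by simp_all
  have "qf_less 0 (- (M ** R_perp))"
    unfolding qf_less_def
  proof (intro allI impI)
    fix x :: "real^2" assume x: "x \<noteq> 0"
    define y where "y = matrix_inv L *v x"
    have Ly: "L *v y = x"
      using someI_ex[OF inv[unfolded invertible_def], folded matrix_inv_def]
      by (simp add: y_def matrix_vector_mul_assoc)
    with x have "y \<noteq> 0" by auto
    then have "0 < y \<bullet> (L *v y)" using L'(2) by (simp add: qf_less_def)
    then have "0 < x \<bullet> (matrix_inv L *v x)"
      unfolding Ly by (simp add: y_def[symmetric] inner_commute)
    also have "\<dots> < x \<bullet> (((-2) *\<^sub>R (M ** R_perp)) *v x)"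
      using M' x by (simp add: qf_less_def)
    finally show "x \<bullet> (0 *v x) < x \<bullet> (- (M ** R_perp) *v x)"
      by (simp add: scaleR_matrix_vector_assoc[symmetric] matrix_vector_mult_uminus)
  qed
  \<comment> \<open>Compared with \<open>- (R_perp ** M)\<close>, the form of
    \<open>- (M ** R_perp)\<close> has its diagonal entries exchanged and the same discriminant. The
    other diagonal entry is positive as well, since their product is.\<close>
  then have "0 < - M $ 1 $ 2 \<and> (M $ 1 $ 1 - M $ 2 $ 2)\<^sup>2 < 4 * (- M $ 1 $ 2 * M $ 2 $ 1)"
    unfolding qf_less_0_mat2 by (simp add: vec2_simps)
  moreover from this have "0 < - M $ 1 $ 2 * M $ 2 $ 1" using zero_le_power2[of "M $ 1 $ 1 - M $ 2 $ 2"] by linarith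
  ultimately show "elliptic M"
    by (auto simp: elliptic_def power2_commute mult.commute zero_less_mult_iff mult_less_0_iff)
qed

section \<open>The matrices \<open>Lam M\<close>, \<open>Pmat M\<close> and the set
  \<open>M9\<close>\<close>

lemma det_Lam: "det (Lam M) = - (M $ 1 $ 2 * M $ 2 $ 1) - (M $ 1 $ 1 - M $ 2 $ 2)\<^sup>2 / 4"
  by (simp add: Lam_def det_2 trace_def sum_2 power2_eq_square field_simps)

lemma det_Lam_pos: "elliptic M \<Longrightarrow> 0 < det (Lam M)"
  by (simp add: elliptic_def det_Lam power2_commute mult.commute)

lemma Pmat_nth:
  "Pmat M $ 1 $ 1 = M $ 2 $ 1 / det (Lam M)" 
  "Pmat M $ 1 $ 2 = (M $ 2 $ 2 - M $ 1 $ 1) / (2 * det (Lam M))"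
  "Pmat M $ 2 $ 1 = (M $ 2 $ 2 - M $ 1 $ 1) / (2 * det (Lam M))" 
  "Pmat M $ 2 $ 2 = - M $ 1 $ 2 / det (Lam M)"
  by (simp_all add: Pmat_def vec2_simps trace_def mat_def diff_divide_distrib add_divide_distrib)

lemma Lam_nth:
  "Lam M $ 1 $ 1 = 1" "Lam M $ 1 $ 2 = trace M / 2" 
  "Lam M $ 2 $ 1 = trace M / 2" "Lam M $ 2 $ 2 = det M"
  by (simp_all add: Lam_def)

text \<open>Both \<open>det (Lam M)\<close> and the determinant of the trace-free part of
  \<open>M\<close> equal \<open>det M\<close> minus the square of half the trace. Hence
  \<open>Pmat M\<close> is a matrix of determinant \<open>d\<close> divided by \<open>d\<close>, in
  dimension two.\<close>

lemma det_Pmat: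
  assumes "elliptic M"
  shows "det (Lam M) * det (Pmat M) = 1"
proof -
  define d where "d = det (Lam M)"
  have d: "d \<noteq> 0" using det_Lam_pos[OF assms] by (simp add: d_def)
  have "d * det (Pmat M) = (- (M $ 1 $ 2 * M $ 2 $ 1) - (M $ 1 $ 1 - M $ 2 $ 2)\<^sup>2 / 4) / d"
    using d unfolding det_2[of "Pmat M"] Pmat_nth d_def[symmetric]
    by (simp add: power2_eq_square field_simps)
  also have "\<dots> = d / d" by (simp add: d_def det_Lam)
  finally show ?thesis using d by (simp add: d_def)
qed

lemma M9_pair_Lam:
  assumes "elliptic M"
  shows "M9_pair (Lam M) (Pmat M)"
proof -
  have d: "0 < det (Lam M)" "det (Lam M) \<noteq> 0" using det_Lam_pos[OF assms] by simp_all
  have P: "det (Pmat M) = 1 / det (Lam M)" using det_Pmat[OF assms] d by (simp add: field_simps)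
  have "transpose (Lam M) = Lam M" "transpose (Pmat M) = Pmat M"
    by (simp_all add: transpose_eq_iff forall_2 Lam_nth Pmat_nth)
  moreover have "qf_less 0 (Lam M)"
    using d unfolding qf_less_0_mat2 by (simp add: Lam_nth det_2 power2_eq_square)
  moreover have "qf_less 0 (Pmat M)"
  proof -
    have "0 < det (Pmat M)" using P d by simp
    moreover have "Pmat M $ 2 $ 1 = Pmat M $ 1 $ 2" by (simp add: Pmat_nth)
    moreover have "0 < Pmat M $ 1 $ 1" using assms d by (simp add: Pmat_nth elliptic_def)
    ultimately show ?thesis
      unfolding qf_less_0_mat2 det_2[of "Pmat M"] by (simp add: power2_eq_square)
  qed
  ultimately show ?thesis using det_Pmat[OF assms] by (simp add: M9_pair_def)
qed

text \<open>Completing the square in the \<open>\<Lambda>\<close> factor; the weights are the two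
  pivots of \<open>\<Lambda>\<close>, so positivity of the Kronecker product reduces to that of
  \<open>P\<close>.\<close>

lemma kron_form:
  assumes "transpose \<Lambda> = \<Lambda>" "transpose P = P" "\<Lambda> $ 1 $ 1 \<noteq> 0"
  shows "v \<bullet> (kron \<Lambda> P *v v) =
    \<Lambda> $ 1 $ 1 * ((comp 1 v + (\<Lambda> $ 1 $ 2 / \<Lambda> $ 1 $ 1) *\<^sub>R comp 2 v)
       \<bullet> (P *v (comp 1 v + (\<Lambda> $ 1 $ 2 / \<Lambda> $ 1 $ 1) *\<^sub>R comp 2 v)))
    + det \<Lambda> / \<Lambda> $ 1 $ 1 * (comp 2 v \<bullet> (P *v comp 2 v))"
proof -
  have [simp]: "\<Lambda> $ 2 $ 1 = \<Lambda> $ 1 $ 2" "P $ 2 $ 1 = P $ 1 $ 2"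
    using assms by (simp_all add: transpose_eq_iff)
  show ?thesis
    using assms(3) by (simp add: vec2_simps det_2) (simp add: field_simps)
qed

lemma kron_pos:
  assumes "M9_pair \<Lambda> P"
  shows "qf_less 0 (kron \<Lambda> P)"
  unfolding qf_less_def
proof (intro allI impI)
  fix v :: tvec assume v: "v \<noteq> 0"
  have [simp]: "\<Lambda> $ 2 $ 1 = \<Lambda> $ 1 $ 2" using assms by (simp add: M9_pair_def transpose_eq_iff)
  have l: "0 < \<Lambda> $ 1 $ 1" "0 < det \<Lambda>"
    using assms by (simp_all add: M9_pair_def qf_less_0_mat2 det_2 power2_eq_square)
  have P: "0 < u \<bullet> (P *v u)" if "u \<noteq> 0" for u
    using assms that by (simp add: M9_pair_def qf_less_def)
  then have P0: "0 \<le> u \<bullet> (P *v u)" for u by (cases "u = 0") (auto simp: less_imp_le)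
  define u where "u = comp 1 v + (\<Lambda> $ 1 $ 2 / \<Lambda> $ 1 $ 1) *\<^sub>R comp 2 v"
  have "v \<bullet> (kron \<Lambda> P *v v) = \<Lambda> $ 1 $ 1 * (u \<bullet> (P *v u)) + det \<Lambda> / \<Lambda> $ 1 $ 1 * (comp 2 v \<bullet> (P *v comp 2 v))"
    using assms l by (simp add: kron_form M9_pair_def u_def)
  also have "\<dots> > 0"
  proof (cases "comp 2 v = 0")
    case True
    with v have "u \<noteq> 0" by (simp add: u_def tvec_eq_iff)
    with True l P show ?thesis by simp
  next
    case False
    with l P P0 show ?thesis by (intro add_nonneg_pos mult_nonneg_nonneg mult_pos_pos) (auto simp: less_imp_le)
  qed
  finally show "v \<bullet> (0 *v v) < v \<bullet> (kron \<Lambda> P *v v)" by simp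
qed

lemma M9_iff: "A \<in> M9 \<longleftrightarrow> (\<exists>\<Lambda> P. A = kron \<Lambda> P \<and> M9_pair \<Lambda> P)"
  unfolding M9_def using kron_pos by blast

lemma M9_subset: "M9 \<subseteq> Sym_pos"
  by (auto simp: M9_def Sym_pos_def M9_pair_def transpose_eq_iff kron_def)

text \<open>The only freedom in a nonzero Kronecker product is to move a scalar from one factor to
  the other. With upper left entry one in the first factor, the second factor is the upper left
  block.\<close>

lemma kron_eqD:
  assumes "kron \<Lambda> P = kron \<Lambda>' P'" "\<Lambda> $ 1 $ 1 = 1" "\<Lambda>' $ 1 $ 1 = 1" "P \<noteq> 0"
  shows "\<Lambda> = \<Lambda>'" "P = P'"
proof -
  have eq: "\<Lambda> $ i $ j * P $ a $ b = \<Lambda>' $ i $ j * P' $ a $ b" for i j a b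
  proof -
    have "kron \<Lambda> P $ (i, a) $ (j, b) = kron \<Lambda>' P' $ (i, a) $ (j, b)" by (simp only: assms)
    then show ?thesis by (simp add: kron_def)
  qed
  from eq[of 1 1] assms show P: "P = P'" by (simp add: vec_eq_iff)
  obtain a b where "P $ a $ b \<noteq> 0" using assms(4) by (auto simp: vec_eq_iff)
  then show "\<Lambda> = \<Lambda>'" using eq[of _ _ a b] P by (auto simp: vec_eq_iff)
qed

lemma M9_unique_pair:
  assumes "A \<in> M9"
  shows "\<exists>!(\<Lambda>, P). M9_pair \<Lambda> P \<and> A = kron \<Lambda> P \<and> \<Lambda> $ 1 $ 1 = 1"
proof -
  obtain \<Lambda> P where A: "A = kron \<Lambda> P" and pair: "M9_pair \<Lambda> P"
    using assms by (auto simp: M9_iff)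
  define l where "l = \<Lambda> $ 1 $ 1"
  have l: "0 < l" using pair by (simp add: M9_pair_def qf_less_0_mat2 l_def)
  have 1: "M9_pair ((1 / l) *\<^sub>R \<Lambda>) (l *\<^sub>R P)"
  proof -
    \<comment> \<open>In dimension two the determinants scale by inverse squares, so moving the
      scalar \<open>l\<close> preserves the determinant condition.\<close>
    have "det ((1 / l) *\<^sub>R \<Lambda>) * det (l *\<^sub>R P) = det \<Lambda> * det P"
      using l by (simp add: det_2 field_simps)
    moreover have "qf_less 0 ((1 / l) *\<^sub>R \<Lambda>)" "qf_less 0 (l *\<^sub>R P)"
      using pair l by (simp_all add: M9_pair_def qf_less_def scaleR_matrix_vector_assoc[symmetric])
    ultimately show ?thesis
      using pair by (simp add: M9_pair_def transpose_eq_iff)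
  qed
  have 2: "kron \<Lambda> P = kron ((1 / l) *\<^sub>R \<Lambda>) (l *\<^sub>R P)"
    using l by (simp add: kron_def vec_eq_iff)
  have 3: "((1 / l) *\<^sub>R \<Lambda>) $ 1 $ 1 = 1" using l by (simp add: l_def)
  show ?thesis
  proof (intro ex1I[of _ "((1 / l) *\<^sub>R \<Lambda>, l *\<^sub>R P)"], goal_cases)
    case 1
    show ?case using \<open>M9_pair _ (l *\<^sub>R P)\<close> 2 3 A by simp
  next
    case (2 z)
    obtain \<Lambda>' P' where z: "z = (\<Lambda>', P')" by (cases z)
    with 2 have *: "M9_pair \<Lambda>' P'" "kron \<Lambda>' P' = kron ((1 / l) *\<^sub>R \<Lambda>) (l *\<^sub>R P)" "\<Lambda>' $ 1 $ 1 = 1"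
      using A \<open>kron \<Lambda> P = _\<close> by auto
    have "P' \<noteq> 0" using *(1) by (auto simp: M9_pair_def det_2)
    then show ?case using kron_eqD[OF *(2,3) 3] z by simp
  qed
qed

text \<open>For a symmetric matrix of order two, \<open>P R_perp P = det P R_perp\<close>. Used in
  both factors, this makes \<open>A T A\<close> equal to \<open>det \<Lambda> * det P\<close> times
  \<open>T\<close>.\<close>

lemma kron_T_op_kron:
  assumes "M9_pair \<Lambda> P"
  shows "kron \<Lambda> P *v (T_op *v (kron \<Lambda> P *v v)) = T_op *v v"
proof -
  have [simp]: "\<Lambda> $ 2 $ 1 = \<Lambda> $ 1 $ 2" "P $ 2 $ 1 = P $ 1 $ 2"
    using assms by (simp_all add: M9_pair_def transpose_eq_iff)
  have R: "P *v (R_perp *v (P *v u)) = det P *\<^sub>R (R_perp *v u)" for u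
    by (simp add: vec2_simps det_2 algebra_simps)
  have d: "(\<Lambda> $ 1 $ 1 * \<Lambda> $ 2 $ 2 - \<Lambda> $ 1 $ 2 * \<Lambda> $ 1 $ 2) * det P = 1"
    using assms by (simp add: M9_pair_def det_2)
  have "comp 1 (kron \<Lambda> P *v (T_op *v (kron \<Lambda> P *v v)))
      = ((\<Lambda> $ 1 $ 1 * \<Lambda> $ 2 $ 2 - \<Lambda> $ 1 $ 2 * \<Lambda> $ 1 $ 2) * det P) *\<^sub>R (- (R_perp *v comp 2 v))"
    by (simp add: vec2_simps det_2) (simp add: algebra_simps)
  moreover have "comp 2 (kron \<Lambda> P *v (T_op *v (kron \<Lambda> P *v v)))
      = ((\<Lambda> $ 1 $ 1 * \<Lambda> $ 2 $ 2 - \<Lambda> $ 1 $ 2 * \<Lambda> $ 1 $ 2) * det P) *\<^sub>R (R_perp *v comp 1 v)"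
    by (simp add: vec2_simps det_2) (simp add: algebra_simps)
  ultimately show ?thesis
    using d by (simp add: tvec_eq_iff)
qed

text \<open>Let \<open>X\<close>, \<open>Y\<close>, \<open>Z\<close> be the upper left, upper right
  and lower right blocks of \<open>B\<close>. The upper left block of \<open>B T B = T\<close>
  forces \<open>Y = s X\<close>, and the upper right block then forces \<open>Z = t X\<close>, so
  that \<open>B\<close> is a Kronecker product with second factor \<open>X\<close>.\<close>

lemma involutive_imp_M9:
  assumes B: "B \<in> Sym_pos" and BTB: "\<And>v. B *v (T_op *v (B *v v)) = T_op *v v"
  shows "B \<in> M9"
proof -
  define p q r where "p = B $ (1,1) $ (1,1)" and "q = B $ (1,1) $ (1,2)" and "r = B $ (1,2) $ (1,2)"
  define a b c d where "a = B $ (1,1) $ (2,1)" and "b = B $ (1,1) $ (2,2)"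
    and "c = B $ (1,2) $ (2,1)" and "d = B $ (1,2) $ (2,2)"
  define e f g where "e = B $ (2,1) $ (2,1)" and "f = B $ (2,1) $ (2,2)" and "g = B $ (2,2) $ (2,2)"
  have sym: "B $ i $ j = B $ j $ i" for i j
    using B unfolding Sym_pos_def transpose_eq_iff by blast
  note B_nth = p_def[symmetric] q_def[symmetric] r_def[symmetric] a_def[symmetric] b_def[symmetric]
    c_def[symmetric] d_def[symmetric] e_def[symmetric] f_def[symmetric] g_def[symmetric]
    sym[of "(1,2)" "(1,1)"] sym[of "(2,1)" "(1,1)"] sym[of "(2,1)" "(1,2)"]
    sym[of "(2,2)" "(1,1)"] sym[of "(2,2)" "(1,2)"] sym[of "(2,2)" "(2,1)"]
  define X :: mat2 where "X = (\<chi> i j. B $ (1, i) $ (1, j))"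
  have "qf_less 0 X"
    unfolding qf_less_def
  proof (intro allI impI)
    fix x :: "real^2" assume "x \<noteq> 0"
    then have "tpair x 0 \<noteq> 0" by (simp add: tvec_eq_iff)
    then have "0 < tpair x 0 \<bullet> (B *v tpair x 0)"
      using B by (simp add: Sym_pos_def qf_less_def)
    then show "x \<bullet> (0 *v x) < x \<bullet> (X *v x)"
      by (simp add: vec2_simps X_def)
  qed
  then have p: "0 < p" and D: "0 < p * r - q * q"
    by (simp_all add: qf_less_0_mat2 X_def B_nth power2_eq_square)
  have "0 < p * r" using D zero_le_square[of q] by linarith
  with p have r: "0 < r" by (simp add: zero_less_mult_iff)
  have "B ** T_op ** B = T_op"
    using BTB by (simp add: matrix_eq matrix_vector_mul_assoc[symmetric])
  then have entry: "(B ** T_op ** B) $ i $ j = T_op $ i $ j" for i j by simp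
  note entry_simps = matrix_matrix_mult_def sum_22 T_op_def kron_def R_perp_def B_nth
  \<comment> \<open>The upper left block, homogeneous and linear in the entries \<open>a\<close>,
    \<open>b\<close>, \<open>c\<close>, \<open>d\<close> of \<open>Y\<close>; its solutions are the
    multiples of \<open>X\<close>.\<close>
  have 1: "b * p = a * q" "d * q = c * r" "b * q - a * r - c * q + d * p = 0"
    using entry[of "(1,1)" "(1,1)"] entry[of "(1,2)" "(1,2)"] entry[of "(1,1)" "(1,2)"]
    by (simp_all add: entry_simps algebra_simps)
  define s where "s = a / p"
  have a: "a = s * p" using p by (simp add: s_def)
  have b: "b = s * q" using 1(1) p unfolding a by (simp add: field_simps)
  \<comment> \<open>Elimination with determinant \<open>det X = p * r - q * q\<close>, which is
    nonzero; the same device gives \<open>e\<close> and \<open>g\<close> below.\<close>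
  have "(d - s * r) * (p * r - q * q) = r * (b * q - a * r - c * q + d * p) - q * (d * q - c * r)"
    unfolding a b by (simp add: algebra_simps)
  then have d: "d = s * r" using 1 D by simp
  have c: "c = s * q" using 1(2) r unfolding d by simp
  \<comment> \<open>With \<open>Y = s X\<close>, the product \<open>Y R_perp Y\<close> is
    \<open>s * s * det X\<close> times \<open>R_perp\<close>; the upper right block therefore reads
    \<open>X R_perp Z = k R_perp\<close>.\<close>
  define k where "k = 1 + s * s * (p * r - q * q)"
  have 2: "q * e = p * f" "p * g - q * f = k" "r * e - q * f = k" "r * f = q * g"
    using entry[of "(1,1)" "(2,1)"] entry[of "(1,1)" "(2,2)"] entry[of "(1,2)" "(2,1)"] entry[of "(1,2)" "(2,2)"]
    by (simp_all add: entry_simps k_def a b c d algebra_simps)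
  define t where "t = k / (p * r - q * q)"
  have k: "k = t * (p * r - q * q)" using D by (simp add: t_def)
  have "(e - t * p) * (p * r - q * q) = p * (r * e - q * f - k) - q * (q * e - p * f)"
    unfolding k by (simp add: algebra_simps)
  then have e: "e = t * p" using 2 D by simp
  have f: "f = t * q" using 2(1) p unfolding e by (simp add: mult.commute)
  have "(g - t * r) * (p * r - q * q) = r * (p * g - q * f - k) + q * (r * f - q * g)"
    unfolding k by (simp add: algebra_simps)
  then have g: "g = t * r" using 2 D by simp
  define \<Lambda> :: mat2 where "\<Lambda> = vector [vector [1, s], vector [s, t]]"
  have BK: "B = kron \<Lambda> X"
    unfolding vec_eq_iff forall_22
    by (simp add: kron_def \<Lambda>_def X_def B_nth) (simp add: a b c d e f g)
  \<comment> \<open>The definitions of \<open>t\<close> and \<open>k\<close> give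
    \<open>(t - s * s) * det X = 1\<close>, and \<open>t - s * s\<close> is
    \<open>det \<Lambda>\<close>.\<close>
  have det: "det \<Lambda> * det X = 1"
    using D k unfolding k_def by (simp add: \<Lambda>_def det_2 X_def B_nth algebra_simps)
  moreover have "0 < det X" using D by (simp add: det_2 X_def B_nth)
  ultimately have "0 < det \<Lambda>"
    by (metis zero_less_mult_pos2 zero_less_one)
  then have "qf_less 0 \<Lambda>"
    by (simp add: qf_less_0_mat2 \<Lambda>_def det_2 power2_eq_square)
  moreover have "transpose X = X" using sym by (simp add: transpose_eq_iff X_def)
  moreover have "transpose \<Lambda> = \<Lambda>" by (simp add: transpose_eq_iff forall_2 \<Lambda>_def)
  ultimately show ?thesis
    using det \<open>qf_less 0 X\<close> BK by (auto simp: M9_iff M9_pair_def)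
qed

section \<open>The two planes attached to an elliptic matrix\<close>

lemma Pmat_eq:
  "Pmat M = (1 / det (Lam M)) *\<^sub>R vector [vector [M $ 2 $ 1, (M $ 2 $ 2 - M $ 1 $ 1) / 2],
     vector [(M $ 2 $ 2 - M $ 1 $ 1) / 2, - M $ 1 $ 2]]"
  by (simp add: vec_eq_iff forall_2 Pmat_nth)

lemma kron_scaleR: "kron A (r *\<^sub>R B) = r *\<^sub>R kron A B"
  by (simp add: kron_def vec_eq_iff)

text \<open>Such \<open>v\<close> have the form \<open>(- M y, y)\<close>. After multiplication by
  \<open>det (Lam M)\<close>, which clears the denominators of \<open>Pmat M\<close>, the claim is a
  polynomial identity in the entries of \<open>M\<close>.\<close>

lemma kron_Lam_kernel:
  assumes "elliptic M" and v: "comp 1 v + M *v comp 2 v = 0"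
  shows "kron (Lam M) (Pmat M) *v v = T_op *v v"
proof -
  let ?P = "vector [vector [M $ 2 $ 1, (M $ 2 $ 2 - M $ 1 $ 1) / 2],
     vector [(M $ 2 $ 2 - M $ 1 $ 1) / 2, - M $ 1 $ 2]] :: mat2"
  have v1: "comp 1 v = - (M *v comp 2 v)" using v by (simp add: add_eq_0_iff2)
  have "comp i (kron (Lam M) ?P *v v) = comp i (det (Lam M) *\<^sub>R (T_op *v v))" for i
    unfolding comp_kron comp_simps using exhaust_2[of i]
    by (elim disjE; simp only: comp_T_op v1 det_Lam; simp add: vec2_simps Lam_nth det_2 trace_def field_simps power2_eq_square)
  then have "kron (Lam M) ?P *v v = det (Lam M) *\<^sub>R (T_op *v v)"
    by (simp add: tvec_eq_iff)
  with det_Lam_pos[OF assms(1)] show ?thesis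
    by (simp add: Pmat_eq kron_scaleR scaleR_matrix_vector_assoc[symmetric])
qed

text \<open>By \<open>comp_frakL\<close> the values of \<open>frakL L M - T_op\<close> satisfy the
  condition on \<open>w\<close>, whatever \<open>L\<close> is. The identity is again polynomial once
  \<open>det (Lam M)\<close> is cleared.\<close>

lemma kron_Lam_dual:
  assumes "elliptic M" and w: "comp 2 w = transpose M *v comp 1 w"
  shows "kron (Lam M) (Pmat M) *v (T_op *v w) = - w"
proof -
  let ?P = "vector [vector [M $ 2 $ 1, (M $ 2 $ 2 - M $ 1 $ 1) / 2],
     vector [(M $ 2 $ 2 - M $ 1 $ 1) / 2, - M $ 1 $ 2]] :: mat2"
  have "comp i (kron (Lam M) ?P *v (T_op *v w)) = comp i (det (Lam M) *\<^sub>R (- w))" for i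
    unfolding comp_kron comp_simps using exhaust_2[of i]
    by (elim disjE; simp only: comp_T_op w det_Lam;
        simp add: vec2_simps transpose_def Lam_nth det_2 trace_def field_simps power2_eq_square
          del: transpose_matrix_vector)
  then have "kron (Lam M) ?P *v (T_op *v w) = det (Lam M) *\<^sub>R (- w)"
    by (simp add: tvec_eq_iff)
  with det_Lam_pos[OF assms(1)] show ?thesis
    by (simp add: Pmat_eq kron_scaleR scaleR_matrix_vector_assoc[symmetric])
qed

text \<open>Four linear equations for \<open>x\<close> and \<open>j\<close>. The second component
  expresses \<open>j\<close> through \<open>x\<close>; the first becomes an equation for
  \<open>x\<close> whose matrix is \<open>-2\<close> times the trace-free part of \<open>M\<close>,
  invertible by ellipticity.\<close>

lemma elliptic_decomposition:
  assumes "elliptic M"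
  obtains x j where "v = tpair (- (M *v x)) x + T_op *v tpair j (transpose M *v j)"
proof -
  define d where "d = det (Lam M)"
  have d: "d \<noteq> 0" using det_Lam_pos[OF assms] by (simp add: d_def)
  \<comment> \<open>By Cayley-Hamilton the trace-free part \<open>N\<close> squares to
    \<open>- d\<close>. The matrix \<open>B\<close> is the adjugate of \<open>M\<close>, which up to
    sign is the transpose of \<open>M\<close> conjugated by \<open>R_perp\<close>.\<close>
  define N where "N = M - (trace M / 2) *\<^sub>R mat 1"
  define B where "B = trace M *\<^sub>R mat 1 - M"
  have NN: "N *v (N *v u) = - (d *\<^sub>R u)" for u
    by (simp add: N_def d_def det_Lam vec2_simps trace_def mat_def field_simps power2_eq_square)
  have BN: "B *v u - M *v u = - (2 *\<^sub>R (N *v u))" for u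
    by (simp add: N_def B_def vec2_simps trace_def mat_def field_simps)
  have RMR: "R_perp *v (transpose M *v (R_perp *v u)) = - (B *v u)" for u
    by (simp add: B_def vec2_simps trace_def mat_def transpose_def algebra_simps del: transpose_matrix_vector)
  define w where "w = comp 1 v + B *v comp 2 v"
  \<comment> \<open>This solves \<open>B x - M x = w\<close>: the left side is
    \<open>-2 N x\<close>, and \<open>N\<close> is inverted through
    \<open>N N = - d\<close>.\<close>
  define x where "x = (1 / (2 * d)) *\<^sub>R (N *v w)"
  define j where "j = - (R_perp *v (comp 2 v - x))"
  have "2 *\<^sub>R (N *v x) = - w"
    using d by (simp add: x_def linear_scale[OF matrix_vector_mul_linear] NN)
  then have "B *v x - M *v x = w" using BN[of x] by simp
  then have "comp 1 v = - (M *v x) - R_perp *v (transpose M *v j)"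
    by (simp add: j_def matrix_vector_mult_uminus RMR w_def matrix_vector_mult_diff_distrib
        del: transpose_matrix_vector) (simp add: algebra_simps)
  moreover have "comp 2 v = x + R_perp *v j"
    by (simp add: j_def matrix_vector_mult_uminus)
  ultimately have "v = tpair (- (M *v x)) x + T_op *v tpair j (transpose M *v j)"
    by (simp add: tvec_eq_iff del: transpose_matrix_vector)
  then show thesis by (rule that)
qed

text \<open>Since \<open>R_perp\<close> squares to minus the identity, \<open>det (Lam M)\<close>
  times \<open>R_perp ** Pmat M\<close> is the trace-free part of \<open>M\<close>, and
  \<open>Lam M $ 1 $ 2\<close> is half the trace.\<close>

lemma elliptic_eq_Lam_Pmat:
  assumes "elliptic M"
  shows "M = (Lam M $ 1 $ 2) *\<^sub>R mat 1 + det (Lam M) *\<^sub>R (R_perp ** Pmat M)"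
  using det_Lam_pos[OF assms]
  by (simp add: vec2_simps Pmat_nth Lam_nth trace_def mat_def field_simps)

subsection \<open>Smooth functions\<close>

text \<open>Smoothness is kept apart from periodicity because the primitives used below leave the
  periodic functions.\<close>

definition smooth :: "(real^2 \<Rightarrow> real) \<Rightarrow> bool" where
  "smooth \<psi> \<longleftrightarrow> (\<forall>as x. foldr partial as \<psi> differentiable (at x))"

definition gradv :: "(real^2 \<Rightarrow> real) \<Rightarrow> real^2 \<Rightarrow> real^2" where
  "gradv \<psi> x = (\<chi> a. partial a \<psi> x)"

lemma test_fun_iff: "test_fun \<psi> \<longleftrightarrow> periodic \<psi> \<and> smooth \<psi>"
  by (simp add: test_fun_def smooth_def)

text \<open>The smooth functions form the largest set of differentiable functions closed under all
  \<open>partial a\<close>; smoothness is shown by exhibiting one such set.\<close>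

lemma smooth_coinduct:
  assumes "\<psi> \<in> X" "\<And>f x. f \<in> X \<Longrightarrow> f differentiable (at x)" "\<And>f a. f \<in> X \<Longrightarrow> partial a f \<in> X"
  shows "smooth \<psi>"
proof -
  have "foldr partial as \<psi> \<in> X" for as
    by (induction as) (auto simp: assms)
  then show ?thesis by (simp add: smooth_def assms(2))
qed

lemma smooth_partial: "smooth \<psi> \<Longrightarrow> smooth (partial a \<psi>)"
proof -
  assume "smooth \<psi>"
  then have "foldr partial (as @ [a]) \<psi> differentiable (at x)" for as x
    unfolding smooth_def by blast
  then show ?thesis by (simp add: smooth_def)
qed

lemma smooth_differentiable: "smooth \<psi> \<Longrightarrow> \<psi> differentiable (at x)"
  unfolding smooth_def by (metis foldr.simps(1) id_apply)

lemma partial_eqI: "(f has_derivative f') (at x) \<Longrightarrow> partial a f x = f' (axis a 1)"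
  by (simp add: partial_def frechet_derivative_at[symmetric])

lemma partial_eqI_inner: "(f has_derivative (\<lambda>h. v \<bullet> h)) (at x) \<Longrightarrow> partial a f x = v $ a"
  by (simp add: partial_eqI inner_axis)

lemma has_derivative_gradv:
  assumes "\<psi> differentiable (at x)"
  shows "(\<psi> has_derivative (\<lambda>h. gradv \<psi> x \<bullet> h)) (at x)"
proof -
  let ?D = "frechet_derivative \<psi> (at x)"
  have D: "(\<psi> has_derivative ?D) (at x)"
    using assms by (simp add: frechet_derivative_works)
  then have lin: "linear ?D" by (rule has_derivative_linear)
  have "?D h = gradv \<psi> x \<bullet> h" for h
  proof -
    have h: "h = h $ 1 *\<^sub>R axis 1 1 + h $ 2 *\<^sub>R axis 2 1"
      by (simp add: vec_eq_iff forall_2 axis_def)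
    have "?D h = h $ 1 * ?D (axis 1 1) + h $ 2 * ?D (axis 2 1)"
      by (subst h) (simp only: linear_add[OF lin] linear_scale[OF lin] real_scaleR_def)
    then show ?thesis by (simp add: gradv_def partial_def inner_vec_def sum_2)
  qed
  then have "?D = (\<lambda>h. gradv \<psi> x \<bullet> h)" by auto
  with D show ?thesis by simp
qed

lemmas smooth_has_derivative = has_derivative_gradv[OF smooth_differentiable]

lemma smooth_continuous: "smooth \<psi> \<Longrightarrow> continuous_on A \<psi>"
  using smooth_differentiable differentiable_imp_continuous_within
  by (metis continuous_at_imp_continuous_on)

lemma smooth_continuous_gradv: "smooth \<psi> \<Longrightarrow> continuous_on A (gradv \<psi>)"
  unfolding gradv_def
  by (intro continuous_on_vec_lambda smooth_continuous smooth_partial)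

lemma partial_linear:
  assumes "f differentiable (at x)" "g differentiable (at x)"
  shows "partial a (\<lambda>x. c * f x + d * g x) x = c * partial a f x + d * partial a g x"
proof -
  have "((\<lambda>x. c * f x + d * g x) has_derivative (\<lambda>h. (c *\<^sub>R gradv f x + d *\<^sub>R gradv g x) \<bullet> h)) (at x)"
    by (rule derivative_eq_intros has_derivative_gradv assms refl ext | simp add: inner_add_left)+
  from partial_eqI_inner[OF this] show ?thesis by (simp add: gradv_def)
qed

lemma smooth_linear:
  assumes "smooth f" "smooth g"
  shows "smooth (\<lambda>x. c * f x + d * g x)"
proof (rule smooth_coinduct[where X = "{\<lambda>x. c * f x + d * g x | f g. smooth f \<and> smooth g}"])
  show "(\<lambda>x. c * f x + d * g x) \<in> {\<lambda>x. c * f x + d * g x | f g. smooth f \<and> smooth g}"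
    using assms by blast
  fix F assume "F \<in> {\<lambda>x. c * f x + d * g x | f g. smooth f \<and> smooth g}"
  then obtain f g where F: "F = (\<lambda>x. c * f x + d * g x)" and fg: "smooth f" "smooth g" by blast
  show "F differentiable (at x)" for x
    unfolding F by (intro derivative_intros smooth_differentiable fg)
  show "partial a F \<in> {\<lambda>x. c * f x + d * g x | f g. smooth f \<and> smooth g}" for a
  proof -
    have "partial a F = (\<lambda>x. c * partial a f x + d * partial a g x)"
      unfolding F using fg by (intro ext partial_linear smooth_differentiable)
    then show ?thesis using fg smooth_partial by blast
  qed
qed

lemma smooth_add: "smooth f \<Longrightarrow> smooth g \<Longrightarrow> smooth (\<lambda>x. f x + g x)"
  using smooth_linear[of f g 1 1] by simp

lemma smooth_diff: "smooth f \<Longrightarrow> smooth g \<Longrightarrow> smooth (\<lambda>x. f x - g x)"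
  using smooth_linear[of f g 1 "-1"] by simp

lemma partial_const: "partial a (\<lambda>x. c) = (\<lambda>x. 0)"
  by (rule ext, rule partial_eqI_inner[of _ 0, simplified]) (auto intro: derivative_eq_intros)

lemma smooth_const: "smooth (\<lambda>x. c)"
proof (rule smooth_coinduct[where X = "range (\<lambda>c x. c)"])
  fix f a assume "f \<in> range (\<lambda>c (x :: real^2). c :: real)"
  then obtain c where f: "f = (\<lambda>x. c)" by auto
  show "partial a f \<in> range (\<lambda>c x. c)" unfolding f partial_const by auto
qed auto

text \<open>The point \<open>x\<close> is moved to position \<open>s\<close> on its line in
  direction \<open>i\<close>, so the average no longer depends on \<open>x $ i\<close>.\<close>

definition avg :: "2 \<Rightarrow> (real^2 \<Rightarrow> real) \<Rightarrow> real^2 \<Rightarrow> real" where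
  "avg i \<psi> x = integral {0..1} (\<lambda>s. \<psi> (x + (s - x $ i) *\<^sub>R axis i 1))"

text \<open>The integral along the line from coordinate \<open>0\<close> to \<open>x $ i\<close>,
  rescaled to the fixed interval \<open>{0..1}\<close>: parameter \<open>s\<close> stands for
  coordinate \<open>s * x $ i\<close>. This also covers negative \<open>x $ i\<close>, and it allows
  differentiation under the integral.\<close>

definition prim :: "2 \<Rightarrow> (real^2 \<Rightarrow> real) \<Rightarrow> real^2 \<Rightarrow> real" where
  "prim i \<psi> x = integral {0..1} (\<lambda>s. x $ i * \<psi> (x - ((1 - s) * x $ i) *\<^sub>R axis i 1))"

lemma has_derivative_integral_param:
  fixes f :: "real^2 \<Rightarrow> real \<Rightarrow> real"
  assumes D: "\<And>x s. ((\<lambda>x. f x s) has_derivative (\<lambda>h. V x s \<bullet> h)) (at x)"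
    and V: "continuous_on UNIV (\<lambda>(x, s). V x s)"
    and f: "\<And>x. continuous_on {0..1} (f x)"
  shows "(\<lambda>x. integral {0..1} (f x)) differentiable (at x)"
    and "partial a (\<lambda>x. integral {0..1} (f x)) x = integral {0..1} (\<lambda>s. V x s $ a)"
proof -
  let ?V = "\<lambda>x s. blinfun_inner_right (V x s)"
  have V': "continuous_on UNIV (\<lambda>(x, s). ?V x s)"
    using V unfolding case_prod_unfold by (intro continuous_intros)
  have "((\<lambda>x. integral (cbox 0 1) (f x)) has_derivative integral (cbox 0 1) (?V x)) (at x within UNIV)"
    by (rule leibniz_rule)
      (use D f V' in \<open>auto intro!: integrable_continuous_real continuous_on_subset[OF V']\<close>)
  then have der: "((\<lambda>x. integral {0..1} (f x)) has_derivative integral {0..1} (?V x)) (at x)"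
    by simp
  then show "(\<lambda>x. integral {0..1} (f x)) differentiable (at x)"
    by (auto simp: differentiable_def)
  have "continuous_on UNIV (?V x)"
    using continuous_on_compose2[OF V', of UNIV "\<lambda>s. (x, s)"] continuous_on_Pair[OF continuous_on_const continuous_on_id]
    by auto
  then have "?V x integrable_on {0..1}"
    by (rule integrable_continuous_real[OF continuous_on_subset[OF _ subset_UNIV]])
  with partial_eqI[OF der, of a] 
  show "partial a (\<lambda>x. integral {0..1} (f x)) x = integral {0..1} (\<lambda>s. V x s $ a)"
    by (simp add: blinfun_apply_integral inner_axis)
qed

lemma has_derivative_smooth_comp:
  assumes "smooth \<psi>" "(g has_derivative g') (at x)"
  shows "((\<lambda>x. \<psi> (g x)) has_derivative (\<lambda>h. gradv \<psi> (g x) \<bullet> g' h)) (at x)"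
  using has_derivative_compose[OF assms(2) smooth_has_derivative[OF assms(1)]] .

lemma has_derivative_nth: "((\<lambda>x :: real^2. x $ i) has_derivative (\<lambda>h. h $ i)) (at x)"
  by (rule bounded_linear_imp_has_derivative[OF bounded_linear_vec_nth])

lemma avg_partial:
  assumes "smooth \<psi>"
  shows "avg i \<psi> differentiable (at x)"
    and "partial a (avg i \<psi>) x = (if a = i then 0 else avg i (partial a \<psi>) x)"
proof -
  let ?y = "\<lambda>(x :: real^2) s. x + (s - x $ i) *\<^sub>R axis i 1"
  let ?V = "\<lambda>x s. gradv \<psi> (?y x s) - (gradv \<psi> (?y x s) $ i) *\<^sub>R axis i 1"
  have D: "((\<lambda>x. \<psi> (?y x s)) has_derivative (\<lambda>h. ?V x s \<bullet> h)) (at x)" for x s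
    by (rule has_derivative_eq_rhs, rule has_derivative_smooth_comp[OF assms])
      (auto intro!: derivative_eq_intros has_derivative_nth simp: inner_simps inner_axis inner_axis' fun_eq_iff)
  have V: "continuous_on UNIV (\<lambda>(x, s). ?V x s)"
    unfolding case_prod_unfold
    by (intro continuous_intros continuous_on_compose2[OF smooth_continuous_gradv[OF assms, of UNIV]]) auto
  have f: "continuous_on {0..1} (\<lambda>s. \<psi> (?y x s))" for x
    by (intro continuous_intros continuous_on_compose2[OF smooth_continuous[OF assms, of UNIV]]) auto
  show "avg i \<psi> differentiable (at x)"
    using has_derivative_integral_param(1)[OF D V f] by (simp add: avg_def[abs_def])
  show "partial a (avg i \<psi>) x = (if a = i then 0 else avg i (partial a \<psi>) x)"
    using has_derivative_integral_param(2)[OF D V f, of a x]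
    by (simp add: avg_def[abs_def] gradv_def axis_def)
qed

lemma prim_partial:
  assumes "smooth \<psi>"
  shows "prim i \<psi> differentiable (at x)"
    and "partial a (prim i \<psi>) x = (if a = i then \<psi> x else prim i (partial a \<psi>) x)"
proof -
  let ?y = "\<lambda>(x :: real^2) s. x - ((1 - s) * x $ i) *\<^sub>R axis i 1"
  let ?V = "\<lambda>x s. x $ i *\<^sub>R (gradv \<psi> (?y x s) - ((1 - s) * gradv \<psi> (?y x s) $ i) *\<^sub>R axis i 1)
     + \<psi> (?y x s) *\<^sub>R axis i 1"
  have D: "((\<lambda>x. x $ i * \<psi> (?y x s)) has_derivative (\<lambda>h. ?V x s \<bullet> h)) (at x)" for x s
    by (rule has_derivative_eq_rhs, rule has_derivative_mult[OF has_derivative_nth],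
        rule has_derivative_smooth_comp[OF assms])
      (auto intro!: derivative_eq_intros has_derivative_nth
        simp: inner_simps inner_axis inner_axis' fun_eq_iff algebra_simps)
  have V: "continuous_on UNIV (\<lambda>(x, s). ?V x s)"
    unfolding case_prod_unfold
    by (intro continuous_intros continuous_on_compose2[OF smooth_continuous_gradv[OF assms, of UNIV]]
      continuous_on_compose2[OF smooth_continuous[OF assms, of UNIV]]) auto
  have f: "continuous_on {0..1} (\<lambda>s. x $ i * \<psi> (?y x s))" for x
    by (intro continuous_intros continuous_on_compose2[OF smooth_continuous[OF assms, of UNIV]]) auto
  show "prim i \<psi> differentiable (at x)"
    using has_derivative_integral_param(1)[OF D V f] by (simp add: prim_def[abs_def])
  have *: "partial a (prim i \<psi>) x = integral {0..1} (\<lambda>s. ?V x s $ a)"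
    using has_derivative_integral_param(2)[OF D V f, of a x]
    by (simp add: prim_def[abs_def])
  show "partial a (prim i \<psi>) x = (if a = i then \<psi> x else prim i (partial a \<psi>) x)"
  proof (cases "a = i")
    case False
    then show ?thesis using * by (simp add: prim_def gradv_def axis_def)
  next
    case True
    \<comment> \<open>For \<open>a = i\<close> the differentiated integrand is itself the
      \<open>s\<close>-derivative of \<open>s * \<psi> (?y x s)\<close>, so the integral collapses
      to its value at \<open>s = 1\<close>.\<close>
    have "((\<lambda>s. s * \<psi> (?y x s)) has_vector_derivative (?V x s $ i)) (at s within {0..1})" for s
      unfolding has_vector_derivative_def
      by (rule has_derivative_eq_rhs, rule has_derivative_mult[OF has_derivative_ident],
          rule has_derivative_compose[OF _ smooth_has_derivative[OF assms]])
        (auto intro!: derivative_eq_intros simp: inner_simps inner_axis fun_eq_iff algebra_simps axis_nth)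
    then have "((\<lambda>s. ?V x s $ i) has_integral 1 * \<psi> (?y x 1) - 0 * \<psi> (?y x 0)) {0..1}"
      by (intro fundamental_theorem_of_calculus) auto
    from integral_unique[OF this] * True show ?thesis by simp
  qed
qed

text \<open>Neither averages nor primitives alone are closed under \<open>partial i\<close>. The
  sums are: differentiation in direction \<open>i\<close> kills the average and turns the primitive
  of \<open>\<gamma>\<close> into \<open>\<gamma>\<close>, which is absorbed by the free term; other
  directions pass inside.\<close>

lemma smooth_avg_prim:
  assumes "smooth \<alpha>" "smooth \<beta>" "smooth \<gamma>"
  shows "smooth (\<lambda>x. \<alpha> x + (avg i \<beta> x + prim i \<gamma> x))"
proof -
  let ?X = "{\<lambda>x. \<alpha> x + (avg i \<beta> x + prim i \<gamma> x) | \<alpha> \<beta> \<gamma>. smooth \<alpha> \<and> smooth \<beta> \<and> smooth \<gamma>}"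
  show ?thesis
  proof (rule smooth_coinduct[where X = ?X])
    show "(\<lambda>x. \<alpha> x + (avg i \<beta> x + prim i \<gamma> x)) \<in> ?X" using assms by blast
    fix f assume "f \<in> ?X"
    then obtain \<alpha> \<beta> \<gamma> where f: "f = (\<lambda>x. \<alpha> x + (avg i \<beta> x + prim i \<gamma> x))"
      and s: "smooth \<alpha>" "smooth \<beta>" "smooth \<gamma>" by blast
    show "f differentiable (at x)" for x
      unfolding f by (intro derivative_intros smooth_differentiable avg_partial prim_partial s)
    have p: "partial a f x = partial a \<alpha> x + (partial a (avg i \<beta>) x + partial a (prim i \<gamma>) x)" for a x
    proof -
      have "(\<lambda>x. avg i \<beta> x + prim i \<gamma> x) differentiable (at x)"
        by (intro derivative_intros avg_partial prim_partial s)
      with s have "partial a (\<lambda>x. 1 * \<alpha> x + 1 * (avg i \<beta> x + prim i \<gamma> x)) x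
          = 1 * partial a \<alpha> x + 1 * partial a (\<lambda>x. avg i \<beta> x + prim i \<gamma> x) x"
        by (intro partial_linear) (auto intro: smooth_differentiable)
      moreover have "partial a (\<lambda>x. 1 * avg i \<beta> x + 1 * prim i \<gamma> x) x
          = 1 * partial a (avg i \<beta>) x + 1 * partial a (prim i \<gamma>) x"
        using s by (intro partial_linear avg_partial prim_partial)
      ultimately show ?thesis by (simp add: f)
    qed
    show "partial a f \<in> ?X" for a
    proof (cases "a = i")
      case True
      have "avg i (\<lambda>x. 0) x + prim i (\<lambda>x. 0) x = 0" for x by (simp add: avg_def prim_def)
      then have "partial a f = (\<lambda>x. (\<lambda>x. partial a \<alpha> x + \<gamma> x) x + (avg i (\<lambda>x. 0) x + prim i (\<lambda>x. 0) x))"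
        using True by (simp add: p fun_eq_iff avg_partial prim_partial s)
      moreover have "smooth (\<lambda>x. partial a \<alpha> x + \<gamma> x)"
        by (intro smooth_add smooth_partial s)
      ultimately show ?thesis
        unfolding mem_Collect_eq
        by (intro exI[of _ "\<lambda>x. partial a \<alpha> x + \<gamma> x"] exI[of _ "\<lambda>x. 0"] conjI smooth_const)
    next
      case False
      then have "partial a f = (\<lambda>x. partial a \<alpha> x + (avg i (partial a \<beta>) x + prim i (partial a \<gamma>) x))"
        by (simp add: p fun_eq_iff avg_partial prim_partial s)
      then show ?thesis
        using s smooth_partial by blast
    qed
  qed
qed

lemma smooth_avg: "smooth \<psi> \<Longrightarrow> smooth (avg i \<psi>)"
  using smooth_avg_prim[OF smooth_const[of 0] _ smooth_const[of 0], of \<psi> i] by (simp add: prim_def)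

lemma smooth_prim: "smooth \<psi> \<Longrightarrow> smooth (prim i \<psi>)"
  using smooth_avg_prim[OF smooth_const[of 0] smooth_const[of 0], of \<psi> i] by (simp add: avg_def)

text \<open>The restricted function is constant along direction \<open>i\<close>, and a derivative
  in another direction keeps it so.\<close>

lemma partial_restrict:
  assumes "smooth \<psi>" "a \<noteq> i"
  shows "partial i (partial a (\<lambda>x. \<psi> (x - x $ i *\<^sub>R axis i 1))) x = 0"
proof -
  let ?y = "\<lambda>x :: real^2. x - x $ i *\<^sub>R axis i 1"
  have y: "(?y has_derivative ?y) (at x)" for x
    by (auto intro!: derivative_eq_intros has_derivative_nth)
  have p: "partial b (\<lambda>x. \<psi> (?y x)) x = gradv \<psi> (?y x) \<bullet> ?y (axis b 1)" if "smooth \<psi>" for \<psi> b x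
    by (rule partial_eqI[OF has_derivative_smooth_comp[OF that y]])
  have 0: "axis a (1 :: real) $ i = 0" using assms(2) by (simp add: axis_def)
  have "partial a (\<lambda>x. \<psi> (?y x)) = (\<lambda>x. partial a \<psi> (?y x))"
    using assms(1) 0 by (simp add: p fun_eq_iff inner_axis gradv_def)
  then show ?thesis
    using assms by (simp add: p[OF smooth_partial] axis_nth)
qed

lemma prim_partial_same:
  assumes "smooth \<psi>"
  shows "prim i (partial i \<psi>) x = \<psi> x - \<psi> (x - x $ i *\<^sub>R axis i 1)"
proof -
  let ?y = "\<lambda>s. x - ((1 - s) * x $ i) *\<^sub>R axis i 1"
  have "((\<lambda>s. \<psi> (?y s)) has_vector_derivative (x $ i * partial i \<psi> (?y s))) (at s within {0..1})" for s
    unfolding has_vector_derivative_def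
    by (rule has_derivative_eq_rhs, rule has_derivative_compose[OF _ smooth_has_derivative[OF assms]])
      (auto intro!: derivative_eq_intros simp: inner_axis gradv_def algebra_simps)
  then have "((\<lambda>s. x $ i * partial i \<psi> (?y s)) has_integral \<psi> (?y 1) - \<psi> (?y 0)) {0..1}"
    by (intro fundamental_theorem_of_calculus) auto
  from integral_unique[OF this] show ?thesis by (simp add: prim_def)
qed

text \<open>
  Writing \<open>\<psi>\<close> as its values on the axis \<open>x $ i = 0\<close> plus a primitive of \<open>partial i \<psi>\<close> reduces the
  symmetry of second derivatives to the formulas for the derivatives of \<open>prim\<close>.
\<close>

lemma partial_commute:
  assumes "smooth \<psi>" "a \<noteq> i"
  shows "partial i (partial a \<psi>) x = partial a (partial i \<psi>) x"
proof -
  let ?r = "\<lambda>x. \<psi> (x - x $ i *\<^sub>R axis i 1)"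
  have s: "smooth (prim i (partial i \<psi>))" by (intro smooth_prim smooth_partial assms)
  have r: "smooth ?r"
    using smooth_diff[OF assms(1) s] by (simp add: prim_partial_same assms)
  have \<psi>: "\<psi> = (\<lambda>x. 1 * ?r x + 1 * prim i (partial i \<psi>) x)"
    using assms by (simp add: prim_partial_same)
  have "partial a \<psi> = (\<lambda>x. 1 * partial a ?r x + 1 * prim i (partial a (partial i \<psi>)) x)"
    by (subst \<psi>) (use assms s r in \<open>simp only: partial_linear smooth_differentiable
        prim_partial(2)[OF smooth_partial] if_False fun_eq_iff simp_thms\<close>)
  then have "partial i (partial a \<psi>) x = 1 * partial i (partial a ?r) x + 1 * partial i (prim i (partial a (partial i \<psi>))) x"
    using assms s r by (simp only: partial_linear smooth_differentiable smooth_partial smooth_prim)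
  then show ?thesis
    using assms by (simp add: partial_restrict prim_partial(2) smooth_partial)
qed

subsection \<open>The unit cell\<close>

definition unit_lborel :: "real measure" where
  "unit_lborel = density lborel (indicator {0..1})"

text \<open>A Borel probability measure for the unit cell. Product measures and Fubini are used with
  Borel functions; \<open>lint_Q_eq_cell\<close> translates from the integrals over \<open>Q\<close>
  with respect to the completed measure.\<close>

definition cell :: "(real^2) measure" where
  "cell = density lborel (indicator Q)"

definition vec2 :: "real \<times> real \<Rightarrow> real^2" where
  "vec2 p = vector [fst p, snd p]"

lemma vec2_nth [simp]: "vec2 p $ 1 = fst p" "vec2 p $ 2 = snd p"
  by (simp_all add: vec2_def)

lemma vec2_eta [simp]: "vec2 (x $ 1, x $ 2) = x"
  by (simp add: vec_eq_iff forall_2)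

lemma sets_unit_lborel [simp, measurable_cong]: "sets unit_lborel = sets borel"
  and space_unit_lborel [simp]: "space unit_lborel = UNIV"
  by (simp_all add: unit_lborel_def)

lemma sets_cell [simp, measurable_cong]: "sets cell = sets borel"
  and space_cell [simp]: "space cell = UNIV"
  by (simp_all add: cell_def)

lemma closed_Q: "closed Q" and compact_Q: "compact Q"
  by (simp_all add: Q_def closed_cbox)

lemma Q_sets [measurable]: "Q \<in> sets borel"
  using closed_Q by simp

lemma Basis_2: "(Basis :: (real^2) set) = {axis 1 1, axis 2 1}"
  by (auto simp: Basis_vec_def) (metis exhaust_2)

lemma mem_Q: "x \<in> Q \<longleftrightarrow> 0 \<le> x $ 1 \<and> x $ 1 \<le> 1 \<and> 0 \<le> x $ 2 \<and> x $ 2 \<le> 1"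
  by (auto simp: Q_def mem_box Basis_2 inner_axis axis_eq_axis) (simp_all add: axis_def)

lemma continuous_vec2: "continuous_on UNIV vec2"
proof -
  have eq: "vec2 = (\<lambda>p. \<chi> i. if i = 1 then fst p else snd p)"
    by (simp add: fun_eq_iff vec_eq_iff forall_2)
  show ?thesis
    unfolding eq
  proof (rule continuous_on_vec_lambda)
    fix i :: 2
    show "continuous_on UNIV (\<lambda>p :: real \<times> real. if i = 1 then fst p else snd p)"
      by (cases "i = 1") (auto intro!: continuous_intros)
  qed
qed

lemma measurable_vec2 [measurable]: "vec2 \<in> borel_measurable borel"
  by (rule borel_measurable_continuous_onI[OF continuous_vec2])

lemma measurable_vec2_pair [measurable]: "vec2 \<in> borel_measurable (borel \<Otimes>\<^sub>M borel)"
  using measurable_vec2 by (simp add: borel_prod)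

lemma emeasure_unit_lborel: "emeasure unit_lborel UNIV = 1"
proof -
  have "emeasure unit_lborel (space unit_lborel) = (\<integral>\<^sup>+x. indicator {0..1::real} x \<partial>lborel)"
    by (simp add: unit_lborel_def emeasure_density)
  then show ?thesis by simp
qed

interpretation unit: finite_measure unit_lborel
  by standard (simp add: emeasure_unit_lborel)

lemma measure_unit_lborel [simp]: "measure unit_lborel UNIV = 1"
  by (simp add: measure_def emeasure_unit_lborel)

interpretation unit2: pair_sigma_finite unit_lborel unit_lborel ..

text \<open>\<open>real^2\<close> is not a product type, so Fubini has to be transported along
  \<open>vec2\<close>; the two measures agree since they agree on boxes.\<close>

lemma lborel_vec2: "(lborel :: (real^2) measure) = distr (lborel \<Otimes>\<^sub>M lborel) borel vec2"
proof (rule lborel_eqI)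
  fix l u :: "real^2" assume *: "\<And>b. b \<in> Basis \<Longrightarrow> l \<bullet> b \<le> u \<bullet> b"
  then have lu: "l $ 1 \<le> u $ 1" "l $ 2 \<le> u $ 2"
    using *[of "axis 1 1"] *[of "axis 2 1"] by (simp_all add: Basis_2 inner_axis)
  have "vec2 -` box l u \<inter> space (lborel \<Otimes>\<^sub>M lborel) = {l $ 1<..<u $ 1} \<times> {l $ 2<..<u $ 2}"
    by (auto simp: mem_box_cart forall_2 space_pair_measure)
  then have "emeasure (distr (lborel \<Otimes>\<^sub>M lborel) borel vec2) (box l u)
      = emeasure lborel {l $ 1<..<u $ 1} * emeasure lborel {l $ 2<..<u $ 2}"
    by (simp add: emeasure_distr lborel.emeasure_pair_measure_Times)
  also have "\<dots> = ennreal ((u $ 1 - l $ 1) * (u $ 2 - l $ 2))"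
    using lu by (simp add: ennreal_mult)
  also have "(u $ 1 - l $ 1) * (u $ 2 - l $ 2) = (\<Prod>b\<in>Basis. (u - l) \<bullet> b)"
    by (simp add: Basis_2 inner_axis axis_eq_axis)
  finally show "emeasure (distr (lborel \<Otimes>\<^sub>M lborel) borel vec2) (box l u)
      = (\<Prod>b\<in>Basis. (u - l) \<bullet> b)" .
qed simp

lemma cell_eq_distr: "cell = distr (unit_lborel \<Otimes>\<^sub>M unit_lborel) borel vec2"
proof -
  have "cell = density (distr (lborel \<Otimes>\<^sub>M lborel) borel vec2) (indicator Q)"
    unfolding cell_def by (subst lborel_vec2) (rule refl)
  also have "\<dots> = distr (density (lborel \<Otimes>\<^sub>M lborel) (\<lambda>p. indicator Q (vec2 p))) borel vec2"
    by (rule density_distr) auto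
  also have "(\<lambda>p. indicator Q (vec2 p) :: ennreal)
      = (\<lambda>(s, t). indicator {0..1} s * indicator {0..1} t)"
    by (auto simp: fun_eq_iff mem_Q indicator_def)
  also have "density (lborel \<Otimes>\<^sub>M lborel) \<dots> = unit_lborel \<Otimes>\<^sub>M unit_lborel"
    unfolding unit_lborel_def
    by (rule pair_measure_density[symmetric])
      (use unit.sigma_finite_measure_axioms in \<open>auto simp: unit_lborel_def lborel.sigma_finite_measure_axioms\<close>)
  finally show ?thesis .
qed

lemma emeasure_cell: "emeasure cell UNIV = 1"
  unfolding cell_eq_distr
  by (subst emeasure_distr)
    (simp_all add: space_pair_measure unit.emeasure_pair_measure_Times emeasure_unit_lborel flip: UNIV_Times_UNIV)

interpretation cell: finite_measure cell
  by standard (simp add: emeasure_cell)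

lemma measure_cell [simp]: "measure cell UNIV = 1"
  by (simp add: measure_def emeasure_cell)

interpretation cell2: pair_sigma_finite cell cell ..

lemma AE_unit: "AE s in unit_lborel. 0 < s \<and> s < 1"
proof -
  have "AE s in lborel. s \<noteq> (0::real)" "AE s in lborel. s \<noteq> (1::real)"
    by (rule AE_lborel_singleton)+
  then show ?thesis
    unfolding unit_lborel_def by (subst AE_density) (auto simp: indicator_def)
qed

lemma AE_cell_iff:
  "(AE x in cell. F x) \<longleftrightarrow> (AE x in lborel. x \<in> Q \<longrightarrow> F x)"
  unfolding cell_def by (subst AE_density) (auto simp: indicator_def)

lemma AE_unit2:
  "AE p in unit_lborel \<Otimes>\<^sub>M unit_lborel. 0 < fst p \<and> fst p < 1 \<and> 0 < snd p \<and> snd p < 1"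
proof (rule unit2.AE_pair_measure)
  show "{p \<in> space (unit_lborel \<Otimes>\<^sub>M unit_lborel). 0 < fst p \<and> fst p < 1 \<and> 0 < snd p \<and> snd p < 1}
      \<in> sets (unit_lborel \<Otimes>\<^sub>M unit_lborel)"
    by measurable
  have "AE t in unit_lborel. 0 < s \<and> s < 1 \<and> 0 < t \<and> t < 1" if "0 < s \<and> s < 1" for s
    using AE_unit that by (auto elim: eventually_mono)
  then show "AE s in unit_lborel. AE t in unit_lborel.
      0 < fst (s, t) \<and> fst (s, t) < 1 \<and> 0 < snd (s, t) \<and> snd (s, t) < 1"
    unfolding fst_conv snd_conv by (rule eventually_mono[OF AE_unit])
qed

lemma AE_cell: "AE x in cell. 0 < x $ 1 \<and> x $ 1 < 1 \<and> 0 < x $ 2 \<and> x $ 2 < 1"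
  unfolding cell_eq_distr using AE_unit2 by (subst AE_distr_iff) auto

lemma AE_cell_Q: "AE x in cell. x \<in> Q"
  using AE_cell by eventually_elim (auto simp: mem_Q)

lemma integral_cell_vec2:
  fixes f :: "real^2 \<Rightarrow> real"
  assumes "f \<in> borel_measurable borel"
  shows "(LINT x|cell. f x) = (LINT p|(unit_lborel \<Otimes>\<^sub>M unit_lborel). f (vec2 p))"
  unfolding cell_eq_distr using assms by (subst integral_distr) auto

lemma integrable_cell_vec2:
  fixes f :: "real^2 \<Rightarrow> real"
  assumes "f \<in> borel_measurable borel"
  shows "integrable cell f \<longleftrightarrow> integrable (unit_lborel \<Otimes>\<^sub>M unit_lborel) (\<lambda>p. f (vec2 p))"
  unfolding cell_eq_distr using assms by (subst integrable_distr_eq) auto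

lemma integral_cell_fst:
  fixes f :: "real^2 \<Rightarrow> real"
  assumes "integrable cell f" "f \<in> borel_measurable borel"
  shows "(LINT x|cell. f x) = (LINT s|unit_lborel. LINT t|unit_lborel. f (vec2 (s, t)))"
  using assms by (subst integral_cell_vec2, simp, subst unit2.integral_fst'[symmetric])
    (auto simp: integrable_cell_vec2)

lemma integral_cell_snd:
  fixes f :: "real^2 \<Rightarrow> real"
  assumes "integrable cell f" "f \<in> borel_measurable borel"
  shows "(LINT x|cell. f x) = (LINT t|unit_lborel. LINT s|unit_lborel. f (vec2 (s, t)))"
  using assms unit2.integral_snd[of "\<lambda>s t. f (vec2 (s, t))"]
  by (simp add: integral_cell_vec2 integrable_cell_vec2 case_prod_unfold)

lemma integral_unit_eq:
  fixes f :: "real \<Rightarrow> real"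
  assumes "continuous_on UNIV f"
  shows "integrable unit_lborel f" "(LINT s|unit_lborel. f s) = integral {0..1} f"
proof -
  have f: "f \<in> borel_measurable borel" by (rule borel_measurable_continuous_onI[OF assms])
  have "continuous_on {0..1} f" by (rule continuous_on_subset[OF assms]) simp
  then have i: "set_integrable lborel {0..1} f"
    by (rule borel_integrable_atLeastAtMost')
  have e: "unit_lborel = density lborel (\<lambda>x. ennreal (indicator {0..1} x))"
    by (simp add: unit_lborel_def ennreal_indicator)
  show "integrable unit_lborel f"
    using i f unfolding e set_integrable_def by (subst integrable_density) auto
  have "(LINT s|unit_lborel. f s) = (LINT s:{0..1}|lborel. f s)"
    using f unfolding e set_lebesgue_integral_def by (subst integral_density) auto
  also have "\<dots> = integral {0..1} f"
    by (rule set_borel_integral_eq_integral(2)[OF i])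
  finally show "(LINT s|unit_lborel. f s) = integral {0..1} f" .
qed

lemma integrable_cell_bounded:
  fixes f :: "real^2 \<Rightarrow> real"
  assumes "f \<in> borel_measurable borel" "\<And>x. x \<in> Q \<Longrightarrow> \<bar>f x\<bar> \<le> B"
  shows "integrable cell f"
  by (rule cell.integrable_const_bound[where B = B]) (use AE_cell_Q assms in \<open>auto elim: eventually_mono\<close>)

lemma bounded_on_Q:
  fixes f :: "real^2 \<Rightarrow> real"
  assumes "continuous_on UNIV f"
  obtains B where "0 \<le> B" "\<And>x. x \<in> Q \<Longrightarrow> \<bar>f x\<bar> \<le> B"
proof -
  have "compact (f ` Q)" by (intro compact_continuous_image compact_Q continuous_on_subset[OF assms]) simp
  then obtain B where "\<forall>y\<in>f ` Q. norm y \<le> B" using compact_imp_bounded bounded_iff by metis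
  then show thesis by (intro that[of "max 0 B"]) (auto simp: le_max_iff_disj)
qed

lemma integrable_cell_continuous:
  fixes f :: "real^2 \<Rightarrow> real"
  assumes "continuous_on UNIV f"
  shows "integrable cell f"
  using bounded_on_Q[OF assms] integrable_cell_bounded borel_measurable_continuous_onI[OF assms]
  by metis

text \<open>A Lebesgue measurable integrand may be replaced by any Borel function equal to it almost
  everywhere on the cell.\<close>

lemma lint_Q_eq_cell:
  fixes F G :: "real^2 \<Rightarrow> real"
  assumes F: "F \<in> borel_measurable lebesgue" and G [measurable]: "G \<in> borel_measurable borel"
    and eq: "AE x in cell. F x = G x"
  shows "(LINT x:Q|lebesgue. F x) = (LINT x|cell. G x)"
    and "set_integrable lebesgue Q F \<longleftrightarrow> integrable cell G"
proof -
  have Q: "Q \<in> sets lebesgue" by (simp add: closed_Q lmeasurable_compact fmeasurableD compact_Q)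
  have e: "cell = density lborel (\<lambda>x. ennreal (indicator Q x))"
    by (simp add: cell_def ennreal_indicator)
  have ae: "AE x in lebesgue. indicator Q x *\<^sub>R F x = indicator Q x *\<^sub>R G x"
    using eq unfolding AE_cell_iff by (intro AE_completion) (auto elim!: eventually_mono simp: indicator_def)
  have mF: "(\<lambda>x. indicator Q x *\<^sub>R F x) \<in> borel_measurable lebesgue"
    using Q F by measurable
  have mG: "(\<lambda>x. indicator Q x *\<^sub>R G x) \<in> borel_measurable lborel"
    by measurable
  then have mG': "(\<lambda>x. indicator Q x *\<^sub>R G x) \<in> borel_measurable lebesgue"
    by (rule measurable_completion)
  have "(LINT x:Q|lebesgue. F x) = (LINT x|lebesgue. indicator Q x *\<^sub>R G x)"
    unfolding set_lebesgue_integral_def by (rule integral_cong_AE[OF mF mG' ae])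
  also have "\<dots> = (LINT x|lborel. indicator Q x *\<^sub>R G x)"
    by (rule integral_completion[OF mG])
  also have "\<dots> = (LINT x|cell. G x)"
    unfolding e by (subst integral_density) auto
  finally show "(LINT x:Q|lebesgue. F x) = (LINT x|cell. G x)" .
  have "set_integrable lebesgue Q F \<longleftrightarrow> integrable lebesgue (\<lambda>x. indicator Q x *\<^sub>R G x)"
    unfolding set_integrable_def by (rule integrable_cong_AE[OF mF mG' ae])
  also have "\<dots> \<longleftrightarrow> integrable lborel (\<lambda>x. indicator Q x *\<^sub>R G x)"
    by (rule integrable_completion[OF mG])
  also have "\<dots> \<longleftrightarrow> integrable cell G"
    unfolding e by (subst integrable_density) auto
  finally show "set_integrable lebesgue Q F \<longleftrightarrow> integrable cell G" .
qed

lemma ex_borel_version: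
  fixes F :: "real^2 \<Rightarrow> real"
  assumes "F \<in> borel_measurable lebesgue"
  obtains G where "G \<in> borel_measurable borel" "AE x in cell. F x = G x"
proof -
  obtain G where "G \<in> borel_measurable lborel" "AE x in lborel. F x = G x"
    using completion_ex_borel_measurable_real[OF assms] by blast
  then show thesis by (intro that[of G]) (auto simp: AE_cell_iff elim: eventually_mono)
qed

section \<open>Borel representatives of square-integrable functions and approximation by continuous
  ones\<close>

definition L2cell :: "(real^2 \<Rightarrow> real) \<Rightarrow> bool" where
  "L2cell f \<longleftrightarrow> f \<in> borel_measurable borel \<and> integrable cell (\<lambda>x. (f x)\<^sup>2)"

lemma L2cellD [measurable_dest]: "L2cell f \<Longrightarrow> f \<in> borel_measurable borel"
  by (simp add: L2cell_def)

lemma two_abs_mult_le: "2 * \<bar>a * b :: real\<bar> \<le> a\<^sup>2 + b\<^sup>2"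
  using zero_le_power2[of "\<bar>a\<bar> - \<bar>b\<bar>"] by (simp add: power2_diff abs_mult)

lemma abs_mult_le: "\<bar>a * b :: real\<bar> \<le> a\<^sup>2 + b\<^sup>2"
  using two_abs_mult_le[of a b] zero_le_power2[of a] zero_le_power2[of b] by linarith

lemma L2cell_mult_integrable:
  assumes "L2cell f" "L2cell g"
  shows "integrable cell (\<lambda>x. f x * g x)"
proof (rule Bochner_Integration.integrable_bound)
  show "integrable cell (\<lambda>x. (f x)\<^sup>2 + (g x)\<^sup>2)"
    using assms by (simp add: L2cell_def)
  show "AE x in cell. norm (f x * g x) \<le> norm ((f x)\<^sup>2 + (g x)\<^sup>2)"
    using abs_mult_le by simp
qed (use assms in \<open>auto simp: L2cell_def\<close>)

lemma L2cell_const: "L2cell (\<lambda>x. c)"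
  by (simp add: L2cell_def)

lemma L2cell_integrable: "L2cell f \<Longrightarrow> integrable cell f"
  using L2cell_mult_integrable[OF _ L2cell_const[of 1]] by simp

lemma L2cell_add:
  assumes "L2cell f" "L2cell g"
  shows "L2cell (\<lambda>x. f x + g x)"
proof -
  have "integrable cell (\<lambda>x. (f x)\<^sup>2 + (g x)\<^sup>2 + 2 * (f x * g x))"
    using assms L2cell_mult_integrable[OF assms] by (simp add: L2cell_def)
  moreover have "(\<lambda>x. (f x)\<^sup>2 + (g x)\<^sup>2 + 2 * (f x * g x)) = (\<lambda>x. (f x + g x)\<^sup>2)"
    by (simp add: power2_sum mult.assoc fun_eq_iff)
  ultimately show ?thesis using assms unfolding L2cell_def by (auto intro: borel_measurable_add)
qed

lemma L2cell_cmult: "L2cell f \<Longrightarrow> L2cell (\<lambda>x. c * f x)"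
  unfolding L2cell_def power_mult_distrib by (auto intro: borel_measurable_times)

lemma L2cell_diff: "L2cell f \<Longrightarrow> L2cell g \<Longrightarrow> L2cell (\<lambda>x. f x - g x)"
  using L2cell_add[OF _ L2cell_cmult, of f g "-1"] by simp

lemma L2cell_continuous:
  assumes "continuous_on UNIV f"
  shows "L2cell f"
  using integrable_cell_continuous[of "\<lambda>x. (f x)\<^sup>2"] assms borel_measurable_continuous_onI[OF assms]
  by (auto simp: L2cell_def intro!: continuous_intros)

text \<open>Truncation at a large height \<open>m\<close> costs little by dominated convergence. A
  measurable function is an almost everywhere limit of continuous ones; truncating these at the same
  height gives the bound needed for a second dominated convergence. The two errors combine by
  \<open>(a + b)^2 <= 2 a^2 + 2 b^2\<close>, hence \<open>\<eta> / 4\<close> for each.\<close>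

lemma L2cell_approx:
  assumes f: "L2cell f" and \<eta>: "0 < \<eta>"
  obtains g where "continuous_on UNIV g" "(LINT x|cell. (f x - g x)\<^sup>2) < \<eta>"
proof -
  note [measurable] = L2cellD[OF f]
  define clip where "clip m v = max (- m) (min m v)" for m v :: real
  have clip_diff: "\<bar>v - clip m v\<bar> \<le> \<bar>v\<bar>" if "0 \<le> m" for m v
    using that by (auto simp: clip_def max_def min_def)
  have clip_bd: "\<bar>clip m v\<bar> \<le> m" if "0 \<le> m" for m v
    using that by (auto simp: clip_def max_def min_def)
  have [measurable]: "clip m \<in> borel_measurable borel" for m
    unfolding clip_def[abs_def] by measurable
  have "(\<lambda>m. LINT x|cell. (f x - clip (real m) (f x))\<^sup>2) \<longlonglongrightarrow> (LINT x|cell. 0)"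
  proof (rule integral_dominated_convergence[where w = "\<lambda>x. (f x)\<^sup>2"])
    have "(\<lambda>m. (v - clip (real m) v)\<^sup>2) \<longlonglongrightarrow> 0" for v
    proof (rule tendsto_eventually)
      obtain N :: nat where "\<bar>v\<bar> \<le> real N" using real_arch_simple by blast
      then show "\<forall>\<^sub>F m in sequentially. (v - clip (real m) v)\<^sup>2 = 0"
        by (intro eventually_sequentiallyI[of N]) (auto simp: clip_def max_def min_def)
    qed
    then show "AE x in cell. (\<lambda>m. (f x - clip (real m) (f x))\<^sup>2) \<longlonglongrightarrow> 0" by simp
    show "AE x in cell. norm ((f x - clip (real m) (f x))\<^sup>2) \<le> (f x)\<^sup>2" for m
      using clip_diff by (simp add: abs_le_square_iff[symmetric])
  qed (use f in \<open>auto simp: L2cell_def\<close>)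
  then have "\<forall>\<^sub>F m in sequentially. (LINT x|cell. (f x - clip (real m) (f x))\<^sup>2) < \<eta> / 4"
    using \<eta> by (intro order_tendstoD(2)) auto
  then obtain m :: nat where m: "(LINT x|cell. (f x - clip (real m) (f x))\<^sup>2) < \<eta> / 4"
    by (auto simp: eventually_sequentially)
  have "f \<in> borel_measurable lebesgue"
    using L2cellD[OF f] by (intro measurable_completion) simp
  then have "f measurable_on UNIV"
    by (rule lebesgue_measurable_imp_measurable_on) simp
  then obtain N g where N: "negligible N" and g: "\<And>k. continuous_on UNIV (g k)"
    and lim: "\<And>x. x \<notin> N \<Longrightarrow> (\<lambda>k. g k x) \<longlonglongrightarrow> f x"
    unfolding measurable_on_def by auto
  have [measurable]: "g k \<in> borel_measurable borel" for k
    by (rule borel_measurable_continuous_onI[OF g])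
  have "AE x in lebesgue. x \<notin> N"
    using N by (intro AE_not_in) (simp add: negligible_iff_null_sets)
  then have AE: "AE x in cell. x \<notin> N"
    unfolding AE_cell_iff AE_completion_iff by (auto elim: eventually_mono)
  have L2clip: "L2cell (\<lambda>x. clip (real m) (h x))" if "h \<in> borel_measurable borel" for h
    unfolding L2cell_def using that
    by (auto intro!: integrable_cell_bounded[where B = "(real m)\<^sup>2"] simp: clip_bd abs_le_square_iff[symmetric])
  have "(\<lambda>k. LINT x|cell. (clip (real m) (f x) - clip (real m) (g k x))\<^sup>2) \<longlonglongrightarrow> (LINT x|cell. 0)"
  proof (rule integral_dominated_convergence[where w = "\<lambda>x. (2 * real m)\<^sup>2"])
    show "AE x in cell. (\<lambda>k. (clip (real m) (f x) - clip (real m) (g k x))\<^sup>2) \<longlonglongrightarrow> 0"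
      using AE
    proof eventually_elim
      case (elim x)
      have "(\<lambda>k. (clip (real m) (f x) - clip (real m) (g k x))\<^sup>2)
          \<longlonglongrightarrow> (clip (real m) (f x) - clip (real m) (f x))\<^sup>2"
        unfolding clip_def by (intro tendsto_intros lim elim)
      then show ?case by simp
    qed
    show "AE x in cell. norm ((clip (real m) (f x) - clip (real m) (g k x))\<^sup>2) \<le> (2 * real m)\<^sup>2" for k
    proof (rule AE_I2)
      fix x
      have "\<bar>clip (real m) (f x) - clip (real m) (g k x)\<bar> \<le> \<bar>2 * real m\<bar>"
        using clip_bd[of "real m" "f x"] clip_bd[of "real m" "g k x"] by linarith
      then show "norm ((clip (real m) (f x) - clip (real m) (g k x))\<^sup>2) \<le> (2 * real m)\<^sup>2"
        unfolding abs_le_square_iff by simp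
    qed
  qed auto
  then have "\<forall>\<^sub>F k in sequentially. (LINT x|cell. (clip (real m) (f x) - clip (real m) (g k x))\<^sup>2) < \<eta> / 4"
    using \<eta> by (intro order_tendstoD(2)) auto
  then obtain k where k: "(LINT x|cell. (clip (real m) (f x) - clip (real m) (g k x))\<^sup>2) < \<eta> / 4"
    by (auto simp: eventually_sequentially)
  let ?g = "\<lambda>x. clip (real m) (g k x)" and ?f = "\<lambda>x. clip (real m) (f x)"
  have L: "L2cell (\<lambda>x. f x - ?f x)" "L2cell (\<lambda>x. ?f x - ?g x)" "L2cell (\<lambda>x. f x - ?g x)"
    by (intro L2cell_diff f L2clip; measurable)+
  have "(LINT x|cell. (f x - ?g x)\<^sup>2) \<le> (LINT x|cell. 2 * (f x - ?f x)\<^sup>2 + 2 * (?f x - ?g x)\<^sup>2)"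
  proof (rule integral_mono)
    fix x
    show "(f x - ?g x)\<^sup>2 \<le> 2 * (f x - ?f x)\<^sup>2 + 2 * (?f x - ?g x)\<^sup>2"
      using zero_le_power2[of "(f x - ?f x) - (?f x - ?g x)"]
      by (simp add: power2_eq_square algebra_simps)
  qed (use L in \<open>auto simp: L2cell_def\<close>)
  also have "\<dots> = 2 * (LINT x|cell. (f x - ?f x)\<^sup>2) + 2 * (LINT x|cell. (?f x - ?g x)\<^sup>2)"
    using L by (simp add: L2cell_def)
  also have "\<dots> < \<eta>" using m k by simp
  finally have "(LINT x|cell. (f x - ?g x)\<^sup>2) < \<eta>" .
  moreover have "continuous_on UNIV ?g"
    unfolding clip_def by (intro continuous_intros g)
  ultimately show thesis by (intro that)
qed

subsection \<open>Trigonometric approximation\<close>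

text \<open>
  The kernel is a normalised power \<open>cos (\<pi> (x - y)) ^ (2 n)\<close> in each variable. Unlike a mollifier
  with compact support it is a finite sum of products of trigonometric functions of \<open>x\<close> and of \<open>y\<close>,
  so smoothing with it produces test functions without differentiating under the integral sign.
\<close>

fun kern_const :: "nat \<Rightarrow> real" where
  "kern_const 0 = 1"
| "kern_const (Suc n) = kern_const n * (2 * real n + 2) / (2 * real n + 1)"

definition kern1 :: "nat \<Rightarrow> real \<Rightarrow> real \<Rightarrow> real" where
  "kern1 n x y = kern_const n * cos (pi * (x - y)) ^ (2 * n)"

definition kern :: "nat \<Rightarrow> real^2 \<Rightarrow> real^2 \<Rightarrow> real" where
  "kern n x y = kern1 n (x $ 1) (y $ 1) * kern1 n (x $ 2) (y $ 2)"

lemma kern_const_pos: "0 < kern_const n"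
  by (induction n) (auto intro!: divide_pos_pos mult_pos_pos)

lemma kern1_nonneg: "0 \<le> kern1 n x y"
  using kern_const_pos[of n] by (simp add: kern1_def less_imp_le)

lemma kern_nonneg: "0 \<le> kern n x y"
  by (simp add: kern_def kern1_nonneg)

lemma kern_sym: "kern n x y = kern n y x"
proof -
  have "cos (pi * (a - b)) = cos (pi * (b - a))" for a b
    using cos_minus[of "pi * (a - b)"] by (simp add: algebra_simps)
  then have "kern1 n a b = kern1 n b a" for a b unfolding kern1_def by metis
  then show ?thesis unfolding kern_def by metis
qed

text \<open>Wallis' recursion: the derivative of \<open>cos^(2 n + 1) * sin\<close> integrates to
  zero over a period. The recursion defining \<open>kern_const\<close> is its inverse, which gives
  the kernel mass one.\<close>

lemma integral_cos_power_rec: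
  "(2 * real n + 1) * integral {0..1} (\<lambda>y. cos (pi * (x - y)) ^ (2 * n))
     = (2 * real n + 2) * integral {0..1} (\<lambda>y. cos (pi * (x - y)) ^ (2 * Suc n))"
proof -
  let ?c = "\<lambda>y. cos (pi * (x - y))" and ?s = "\<lambda>y. sin (pi * (x - y))"
  let ?F = "\<lambda>y. ?c y ^ (2 * n + 1) * ?s y"
  have "(?F has_real_derivative
      pi * ((2 * real n + 1) * ?c y ^ (2 * n) - (2 * real n + 2) * ?c y ^ (2 * Suc n))) (at y)" for y
  proof -
    have d: "(?F has_real_derivative (real (2 * n + 1) * ?c y ^ (2 * n) * (pi * ?s y)) * ?s y
        + ?c y ^ (2 * n + 1) * (- (pi * ?c y))) (at y)"
    proof -
      have dc: "(?c has_real_derivative pi * ?s y) (at y)" and ds: "(?s has_real_derivative - (pi * ?c y)) (at y)"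
        by (auto intro!: derivative_eq_intros)
      show ?thesis
        by (rule DERIV_cong[OF DERIV_mult[OF DERIV_power[OF dc, of "2 * n + 1"] ds]]) simp
    qed
    have "?s y * ?s y = 1 - ?c y * ?c y"
      using sin_squared_eq[of "pi * (x - y)"] by (simp add: power2_eq_square)
    then have "(real (2 * n + 1) * ?c y ^ (2 * n) * (pi * ?s y)) * ?s y + ?c y ^ (2 * n + 1) * (- (pi * ?c y))
        = (real (2 * n + 1) * ?c y ^ (2 * n) * pi) * (1 - ?c y * ?c y) + ?c y ^ (2 * n + 1) * (- (pi * ?c y))"
      by (metis (no_types, lifting) mult.assoc)
    also have "\<dots> = pi * ((2 * real n + 1) * ?c y ^ (2 * n) - (2 * real n + 2) * ?c y ^ (2 * Suc n))"
      by (simp add: algebra_simps)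
    finally show ?thesis using d by (simp only:)
  qed
  then have "(?F has_vector_derivative
      pi * ((2 * real n + 1) * ?c y ^ (2 * n) - (2 * real n + 2) * ?c y ^ (2 * Suc n))) (at y within {0..1})" for y
    by (meson has_real_derivative_iff_has_vector_derivative has_vector_derivative_at_within)
  then have "((\<lambda>y. pi * ((2 * real n + 1) * ?c y ^ (2 * n) - (2 * real n + 2) * ?c y ^ (2 * Suc n)))
      has_integral ?F 1 - ?F 0) {0..1}"
    by (intro fundamental_theorem_of_calculus) auto
  from integral_unique[OF this]
  have "integral {0..1} (\<lambda>y. pi * ((2 * real n + 1) * ?c y ^ (2 * n) - (2 * real n + 2) * ?c y ^ (2 * Suc n))) = ?F 1 - ?F 0" .
  \<comment> \<open>A unit step shifts the angle by \<open>\<pi>\<close>, which reverses the signs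
    of both the odd power of the cosine and the sine.\<close>
  also have "?F 1 - ?F 0 = 0"
    by (simp add: right_diff_distrib cos_diff sin_diff)
  finally have "integral {0..1} (\<lambda>y. pi * ((2 * real n + 1) * ?c y ^ (2 * n) - (2 * real n + 2) * ?c y ^ (2 * Suc n))) = 0" .
  moreover have "integral {0..1} (\<lambda>y. pi * ((2 * real n + 1) * ?c y ^ (2 * n) - (2 * real n + 2) * ?c y ^ (2 * Suc n)))
      = pi * ((2 * real n + 1) * integral {0..1} (\<lambda>y. ?c y ^ (2 * n))
          - (2 * real n + 2) * integral {0..1} (\<lambda>y. ?c y ^ (2 * Suc n)))"
    by (subst integral_mult_right, subst integral_diff)
      (auto intro!: integrable_continuous_real continuous_intros)
  ultimately show ?thesis by simp
qed

lemma continuous_kern1: "continuous_on UNIV (kern1 n x)"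
  unfolding kern1_def[abs_def] by (intro continuous_intros)

lemma integral_kern1_HK: "integral {0..1} (kern1 n x) = 1"
proof (induction n)
  case 0
  show ?case by (simp add: kern1_def[abs_def])
next
  case (Suc n)
  let ?I = "\<lambda>n. integral {0..1} (\<lambda>y. cos (pi * (x - y)) ^ (2 * n))"
  have "(2 * real n + 1) * (kern_const (Suc n) * ?I (Suc n)) = kern_const n * ((2 * real n + 2) * ?I (Suc n))"
    by simp
  also have "\<dots> = (2 * real n + 1) * (kern_const n * ?I n)"
    by (simp only: integral_cos_power_rec[symmetric] mult.left_commute)
  also have "kern_const n * ?I n = 1" using Suc by (simp add: kern1_def[abs_def])
  finally have "kern_const (Suc n) * ?I (Suc n) = 1" by (simp del: kern_const.simps)
  then show ?case by (simp add: kern1_def[abs_def] del: kern_const.simps)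
qed

lemma integral_kern1: "(LINT y|unit_lborel. kern1 n x y) = 1"
  using integral_unit_eq(2)[OF continuous_kern1] integral_kern1_HK by simp

text \<open>Replacing the squared sine by one minus the squared cosine yields two consecutive
  kernels of mass one. The value tends to zero with \<open>n\<close>, so the mass concentrates where
  the sine vanishes.\<close>

lemma integral_kern1_sin:
  "(LINT y|unit_lborel. kern1 n x y * (sin (pi * (x - y)))\<^sup>2) = 1 / (2 * real n + 2)"
proof -
  have pos: "2 * real n + 2 \<noteq> 0" "2 * real n + 1 \<noteq> 0" by linarith+
  have eq: "kern1 n x y * (sin (pi * (x - y)))\<^sup>2 = kern1 n x y - (2 * real n + 1) / (2 * real n + 2) * kern1 (Suc n) x y" for y
  proof -
    have "kern1 (Suc n) x y = (2 * real n + 2) / (2 * real n + 1) * (kern1 n x y * (cos (pi * (x - y)))\<^sup>2)"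
      by (simp add: kern1_def power2_eq_square)
    then have "(2 * real n + 1) / (2 * real n + 2) * kern1 (Suc n) x y = kern1 n x y * (cos (pi * (x - y)))\<^sup>2"
      using pos by simp
    then show ?thesis by (simp add: sin_squared_eq right_diff_distrib)
  qed
  have "(LINT y|unit_lborel. kern1 n x y * (sin (pi * (x - y)))\<^sup>2) = 1 - (2 * real n + 1) / (2 * real n + 2)"
    unfolding eq using integral_unit_eq(1)[OF continuous_kern1]
    by (simp add: integral_kern1)
  then show ?thesis using pos by (simp add: field_simps)
qed

lemma integral_cell_times:
  fixes a b :: "real \<Rightarrow> real"
  assumes "continuous_on UNIV a" "continuous_on UNIV b"
  shows "(LINT y|cell. a (y $ 1) * b (y $ 2)) = (LINT s|unit_lborel. a s) * (LINT s|unit_lborel. b s)"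
proof -
  have c: "continuous_on UNIV (\<lambda>y :: real^2. a (y $ 1) * b (y $ 2))"
    by (intro continuous_intros continuous_on_compose2[OF assms(1)] continuous_on_compose2[OF assms(2)]) auto
  show ?thesis
    using integral_cell_fst[OF integrable_cell_continuous[OF c] borel_measurable_continuous_onI[OF c]]
    by simp
qed

lemma integral_kern: "(LINT y|cell. kern n x y) = 1"
  unfolding kern_def using integral_cell_times[OF continuous_kern1 continuous_kern1]
  by (simp add: integral_kern1)

text \<open>A periodic substitute for the squared distance whose integral against the kernel is
  explicit.\<close>

definition sinsq :: "real^2 \<Rightarrow> real^2 \<Rightarrow> real" where
  "sinsq x y = (sin (pi * (x $ 1 - y $ 1)))\<^sup>2 + (sin (pi * (x $ 2 - y $ 2)))\<^sup>2"

lemma continuous_kern: "continuous_on A (\<lambda>p. kern n (fst p) (snd p))"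
  unfolding kern_def kern1_def by (intro continuous_intros)

lemma continuous_kern_snd: "continuous_on A (kern n x)"
  unfolding kern_def kern1_def by (intro continuous_intros)

lemma continuous_sinsq: "continuous_on A (sinsq x)"
  unfolding sinsq_def by (intro continuous_intros)

lemma integral_kern_sinsq: "(LINT y|cell. kern n x y * sinsq x y) = 1 / (real n + 1)"
proof -
  let ?s = "\<lambda>x y. kern1 n x y * (sin (pi * (x - y)))\<^sup>2"
  have s: "continuous_on UNIV (?s x)" for x
    by (intro continuous_intros continuous_kern1)
  have c: "continuous_on UNIV (\<lambda>y :: real^2. ?s (x $ 1) (y $ 1) * kern1 n (x $ 2) (y $ 2))"
     "continuous_on UNIV (\<lambda>y :: real^2. kern1 n (x $ 1) (y $ 1) * ?s (x $ 2) (y $ 2))"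
    unfolding kern1_def by (intro continuous_intros)+
  have "(LINT y|cell. kern n x y * sinsq x y)
      = (LINT y|cell. ?s (x $ 1) (y $ 1) * kern1 n (x $ 2) (y $ 2) + kern1 n (x $ 1) (y $ 1) * ?s (x $ 2) (y $ 2))"
    by (simp add: kern_def sinsq_def algebra_simps)
  also have "\<dots> = 1 / (2 * real n + 2) + 1 / (2 * real n + 2)"
    using integrable_cell_continuous[OF c(1)] integrable_cell_continuous[OF c(2)]
    by (simp add: integral_cell_times[OF s continuous_kern1] integral_cell_times[OF continuous_kern1 s]
        integral_kern1_sin integral_kern1)
  also have "\<dots> = 1 / (real n + 1)" by (simp add: field_simps)
  finally show ?thesis .
qed

text \<open>
  A Korovkin-type bound: for \<open>x\<close> in the open cell, \<open>sinsq x\<close> vanishes on the closed cell only at \<open>x\<close>.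
\<close>

lemma local_modulus:
  assumes f: "continuous_on UNIV f" and x: "0 < x $ 1" "x $ 1 < 1" "0 < x $ 2" "x $ 2 < 1" and e: "0 < e"
  obtains C where "0 \<le> C" "\<And>y. y \<in> Q \<Longrightarrow> \<bar>f y - f x\<bar> \<le> e + C * sinsq x y"
proof -
  have fx: "continuous_on UNIV (\<lambda>y. f y - f x)" by (intro continuous_intros f)
  obtain B where B: "0 \<le> B" "\<And>y. y \<in> Q \<Longrightarrow> \<bar>f y - f x\<bar> \<le> B"
    using bounded_on_Q[OF fx] by blast
  define Z where "Z = Q \<inter> {y. e \<le> \<bar>f y - f x\<bar>}"
  have "closed {y. e \<le> \<bar>f y - f x\<bar>}"
    by (intro closed_Collect_le continuous_intros f)
  then have Z: "compact Z" unfolding Z_def using compact_Q by (rule compact_Int_closed[rotated])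
  show thesis
  proof (cases "Z = {}")
    case True
    then have "\<bar>f y - f x\<bar> \<le> e + 0 * sinsq x y" if "y \<in> Q" for y
      using that by (auto simp: Z_def)
    with that[of 0] show thesis by blast
  next
    case False
    obtain z where z: "z \<in> Z" "\<And>y. y \<in> Z \<Longrightarrow> sinsq x z \<le> sinsq x y"
      using continuous_attains_inf[OF Z False continuous_sinsq] by blast
    have "0 < sinsq x z"
    proof (rule ccontr)
      assume "\<not> 0 < sinsq x z"
      then have "sinsq x z = 0" by (simp add: sinsq_def not_less sum_power2_le_zero_iff)
      then have s: "sin (pi * (x $ i - z $ i)) = 0" for i
        using exhaust_2[of i] by (auto simp: sinsq_def add_nonneg_eq_0_iff)
      have "x $ i - z $ i = 0" if "0 < x $ i" "x $ i < 1" "0 \<le> z $ i" "z $ i \<le> 1" for i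
      proof -
        have "-1 < x $ i - z $ i" "x $ i - z $ i < 1" using that by auto
        then have "pi * (-1) < pi * (x $ i - z $ i)" "pi * (x $ i - z $ i) < pi * 1"
          by (intro mult_strict_left_mono; simp)+
        then show ?thesis using sin_eq_0_pi[OF _ _ s[of i]] by simp
      qed
      then have "x = z" using x z(1) by (simp add: vec_eq_iff forall_2 Z_def mem_Q)
      then show False using z(1) e by (simp add: Z_def)
    qed
    moreover have "\<bar>f y - f x\<bar> \<le> e + B / sinsq x z * sinsq x y" if "y \<in> Q" for y
    proof (cases "y \<in> Z")
      case True
      have "\<bar>f y - f x\<bar> \<le> B" using B that by auto
      also have "B * 1 \<le> B * (sinsq x y / sinsq x z)"
        using z(2)[OF True] \<open>0 < sinsq x z\<close> B(1) by (intro mult_left_mono) auto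
      finally show ?thesis using e by simp
    next
      case False
      then have "\<bar>f y - f x\<bar> \<le> e" using that by (auto simp: Z_def)
      moreover have "0 \<le> B / sinsq x z * sinsq x y"
        using \<open>0 < sinsq x z\<close> B(1) by (simp add: sinsq_def)
      ultimately show ?thesis by linarith
    qed
    ultimately show thesis using B(1) by (intro that[of "B / sinsq x z"]) auto
  qed
qed

section \<open>The smoothing operator and its weak convergence\<close>

lemma integrable_kern_mult:
  assumes "L2cell f"
  shows "integrable cell (\<lambda>y. f y * kern n x y)"
  by (rule L2cell_mult_integrable[OF assms L2cell_continuous[OF continuous_kern_snd]])

definition smoothing :: "nat \<Rightarrow> (real^2 \<Rightarrow> real) \<Rightarrow> real^2 \<Rightarrow> real" where
  "smoothing n f x = (LINT y|cell. f y * kern n x y)"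

text \<open>The constant from \<open>local_modulus\<close> may depend on \<open>x\<close>, so
  convergence is obtained pointwise in the open cell: the error is at most
  \<open>e / 2 + C / (n + 1)\<close>.\<close>

lemma smoothing_tendsto:
  assumes f: "continuous_on UNIV f" and x: "0 < x $ 1" "x $ 1 < 1" "0 < x $ 2" "x $ 2 < 1"
  shows "(\<lambda>n. smoothing n f x) \<longlonglongrightarrow> f x"
proof (rule LIMSEQ_I)
  fix e :: real assume e: "0 < e"
  obtain C where C: "0 \<le> C" "\<And>y. y \<in> Q \<Longrightarrow> \<bar>f y - f x\<bar> \<le> e / 2 + C * sinsq x y"
    using local_modulus[OF f x, of "e / 2"] e by auto
  have bd: "\<bar>smoothing n f x - f x\<bar> \<le> e / 2 + C / (real n + 1)" for n
  proof -
    have i: "integrable cell (\<lambda>y. f y * kern n x y)" "integrable cell (kern n x)"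
      "integrable cell (\<lambda>y. kern n x y * sinsq x y)"
      by (intro integrable_cell_continuous continuous_intros f continuous_kern_snd continuous_sinsq)+
    have "smoothing n f x - f x = (LINT y|cell. f y * kern n x y - f x * kern n x y)"
      using i by (simp add: smoothing_def integral_kern)
    also have "\<bar>\<dots>\<bar> \<le> (LINT y|cell. \<bar>f y * kern n x y - f x * kern n x y\<bar>)"
      by (rule integral_abs_bound)
    also have "\<dots> \<le> (LINT y|cell. e / 2 * kern n x y + C * (kern n x y * sinsq x y))"
    proof (rule integral_mono_AE)
      show "AE y in cell. \<bar>f y * kern n x y - f x * kern n x y\<bar> \<le> e / 2 * kern n x y + C * (kern n x y * sinsq x y)"
        using AE_cell_Q
      proof eventually_elim
        case (elim y)
        have "\<bar>f y - f x\<bar> * kern n x y \<le> (e / 2 + C * sinsq x y) * kern n x y"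
          using C(2)[OF elim] kern_nonneg by (rule mult_right_mono)
        also have "(e / 2 + C * sinsq x y) * kern n x y = e / 2 * kern n x y + C * (kern n x y * sinsq x y)"
          by (simp add: algebra_simps)
        also have "\<bar>f y - f x\<bar> * kern n x y = \<bar>f y * kern n x y - f x * kern n x y\<bar>"
          by (simp add: left_diff_distrib[symmetric] abs_mult kern_nonneg)
        finally show ?case .
      qed
    qed (use i in auto)
    also have "\<dots> = e / 2 + C / (real n + 1)"
      using i by (simp add: integral_kern integral_kern_sinsq)
    finally show ?thesis .
  qed
  obtain N :: nat where N: "2 * C / e < real N" using reals_Archimedean2 by blast
  have "\<bar>smoothing n f x - f x\<bar> < e" if "N \<le> n" for n
  proof -
    have "2 * C / e < real n + 1" using N that by simp
    then have "C / (real n + 1) < e / 2" using e by (simp add: field_simps)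
    then show ?thesis using bd[of n] by linarith
  qed
  then show "\<exists>N. \<forall>n\<ge>N. norm (smoothing n f x - f x) < e" by auto
qed

lemma measurable_kern [measurable]: "(\<lambda>p. kern n (fst p) (snd p)) \<in> borel_measurable (borel \<Otimes>\<^sub>M borel)"
  using borel_measurable_continuous_onI[OF continuous_kern] by (simp add: borel_prod)

lemma measurable_kern_snd [measurable]: "kern n x \<in> borel_measurable borel"
  by (rule borel_measurable_continuous_onI[OF continuous_kern_snd])

lemma integrable_pair_kern:
  assumes f: "f \<in> borel_measurable borel" "integrable cell f"
  shows "integrable (cell \<Otimes>\<^sub>M cell) (\<lambda>p. f (fst p) * kern n (fst p) (snd p))"
    and "(LINT p|(cell \<Otimes>\<^sub>M cell). f (fst p) * kern n (fst p) (snd p)) = (LINT x|cell. f x)"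
proof -
  note [measurable] = f(1)
  have k: "integrable cell (kern n x)" for x
    by (rule integrable_cell_continuous[OF continuous_kern_snd])
  show i: "integrable (cell \<Otimes>\<^sub>M cell) (\<lambda>p. f (fst p) * kern n (fst p) (snd p))"
  proof (rule cell2.Fubini_integrable)
    show "integrable cell (\<lambda>x. LINT y|cell. norm (f (fst (x, y)) * kern n (fst (x, y)) (snd (x, y))))"
      using f k by (simp add: abs_mult kern_nonneg integral_kern)
    show "AE x in cell. integrable cell (\<lambda>y. f (fst (x, y)) * kern n (fst (x, y)) (snd (x, y)))"
      using k by simp
  qed measurable
  show "(LINT p|(cell \<Otimes>\<^sub>M cell). f (fst p) * kern n (fst p) (snd p)) = (LINT x|cell. f x)"
    using cell2.integral_fst'[OF i] by (simp add: integral_kern)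
qed

lemma integrable_pair_kern_snd:
  assumes f: "f \<in> borel_measurable borel" "integrable cell f"
  shows "integrable (cell \<Otimes>\<^sub>M cell) (\<lambda>p. f (snd p) * kern n (fst p) (snd p))"
    and "(LINT p|(cell \<Otimes>\<^sub>M cell). f (snd p) * kern n (fst p) (snd p)) = (LINT x|cell. f x)"
proof -
  note [measurable] = f(1)
  have eq: "(\<lambda>p. f (snd p) * kern n (fst p) (snd p)) = (\<lambda>(x, y). (\<lambda>p. f (fst p) * kern n (fst p) (snd p)) (y, x))"
    by (auto simp: kern_sym)
  show "integrable (cell \<Otimes>\<^sub>M cell) (\<lambda>p. f (snd p) * kern n (fst p) (snd p))"
    unfolding eq by (rule cell2.integrable_product_swap[OF integrable_pair_kern(1)[OF f]])
  show "(LINT p|(cell \<Otimes>\<^sub>M cell). f (snd p) * kern n (fst p) (snd p)) = (LINT x|cell. f x)"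
    unfolding eq
    by (subst cell2.integral_product_swap) (measurable, rule integrable_pair_kern(2)[OF f])
qed

text \<open>Schur's test: \<open>2 |a b| <= a^2 + b^2\<close> is integrated against the kernel,
  which has mass one in each variable. The bound is uniform in \<open>n\<close>.\<close>

lemma smoothing_form:
  assumes h: "L2cell h" and f: "L2cell f"
  shows "integrable cell (\<lambda>x. h x * smoothing n f x)"
    and "2 * \<bar>LINT x|cell. h x * smoothing n f x\<bar> \<le> (LINT x|cell. (h x)\<^sup>2) + (LINT x|cell. (f x)\<^sup>2)"
proof -
  note [measurable] = L2cellD[OF h] L2cellD[OF f]
  let ?F = "\<lambda>p. h (fst p) * f (snd p) * kern n (fst p) (snd p)"
  let ?h = "\<lambda>p. (h (fst p))\<^sup>2 * kern n (fst p) (snd p)" and ?f = "\<lambda>p. (f (snd p))\<^sup>2 * kern n (fst p) (snd p)"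
  have hf: "integrable (cell \<Otimes>\<^sub>M cell) ?h" "integrable (cell \<Otimes>\<^sub>M cell) ?f"
    "(LINT p|(cell \<Otimes>\<^sub>M cell). ?h p) = (LINT x|cell. (h x)\<^sup>2)"
    "(LINT p|(cell \<Otimes>\<^sub>M cell). ?f p) = (LINT x|cell. (f x)\<^sup>2)"
    using h f unfolding L2cell_def
    by (auto intro!: integrable_pair_kern(1)[of "\<lambda>x. (h x)\<^sup>2"] integrable_pair_kern_snd(1)[of "\<lambda>x. (f x)\<^sup>2"]
        integrable_pair_kern(2)[of "\<lambda>x. (h x)\<^sup>2"] integrable_pair_kern_snd(2)[of "\<lambda>x. (f x)\<^sup>2"])
  have le: "2 * \<bar>?F p\<bar> \<le> ?h p + ?f p" for p
    using mult_right_mono[OF two_abs_mult_le[of "h (fst p)" "f (snd p)"] kern_nonneg[of n "fst p" "snd p"]]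
    by (simp add: abs_mult kern_nonneg distrib_right mult.assoc)
  have iF: "integrable (cell \<Otimes>\<^sub>M cell) ?F"
  proof (rule Bochner_Integration.integrable_bound)
    show "integrable (cell \<Otimes>\<^sub>M cell) (\<lambda>p. ?h p + ?f p)" using hf by auto
    show "AE p in cell \<Otimes>\<^sub>M cell. norm (?F p) \<le> norm (?h p + ?f p)"
    proof (rule AE_I2)
      fix p show "norm (?F p) \<le> norm (?h p + ?f p)"
        using le[of p] unfolding real_norm_def by linarith
    qed
  qed measurable
  have inner: "(LINT y|cell. ?F (x, y)) = h x * smoothing n f x" for x
    by (simp add: smoothing_def mult.assoc)
  show "integrable cell (\<lambda>x. h x * smoothing n f x)"
    using cell2.integrable_fst'[OF iF] unfolding inner .
  have "(LINT x|cell. h x * smoothing n f x) = (LINT p|(cell \<Otimes>\<^sub>M cell). ?F p)"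
    using cell2.integral_fst'[OF iF] unfolding inner .
  also have "2 * \<bar>\<dots>\<bar> \<le> 2 * (LINT p|(cell \<Otimes>\<^sub>M cell). \<bar>?F p\<bar>)"
    using integral_abs_bound by simp
  also have "\<dots> = (LINT p|(cell \<Otimes>\<^sub>M cell). 2 * \<bar>?F p\<bar>)" by simp
  also have "\<dots> \<le> (LINT p|(cell \<Otimes>\<^sub>M cell). ?h p + ?f p)"
    using iF hf(1,2) by (intro integral_mono le) auto
  also have "\<dots> = (LINT x|cell. (h x)\<^sup>2) + (LINT x|cell. (f x)\<^sup>2)"
    using hf by simp
  finally show "2 * \<bar>LINT x|cell. h x * smoothing n f x\<bar> \<le> (LINT x|cell. (h x)\<^sup>2) + (LINT x|cell. (f x)\<^sup>2)" .
qed

lemma smoothing_cmult: "smoothing n (\<lambda>x. c * f x) x = c * smoothing n f x"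
  by (simp add: smoothing_def mult.assoc)

lemma smoothing_add:
  assumes "L2cell f" "L2cell g"
  shows "smoothing n (\<lambda>x. f x + g x) x = smoothing n f x + smoothing n g x"
  unfolding smoothing_def distrib_right
  by (intro Bochner_Integration.integral_add integrable_kern_mult assms)

lemma L2cell_inner_bound:
  assumes "L2cell h" "L2cell f"
  shows "2 * \<bar>LINT x|cell. h x * f x\<bar> \<le> (LINT x|cell. (h x)\<^sup>2) + (LINT x|cell. (f x)\<^sup>2)"
proof -
  have "2 * \<bar>LINT x|cell. h x * f x\<bar> \<le> 2 * (LINT x|cell. \<bar>h x * f x\<bar>)"
    using integral_abs_bound by simp
  also have "\<dots> = (LINT x|cell. 2 * \<bar>h x * f x\<bar>)" by simp
  also have "\<dots> \<le> (LINT x|cell. (h x)\<^sup>2 + (f x)\<^sup>2)"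
    using assms L2cell_mult_integrable[OF assms]
    by (intro integral_mono two_abs_mult_le) (auto simp: L2cell_def)
  also have "\<dots> = (LINT x|cell. (h x)\<^sup>2) + (LINT x|cell. (f x)\<^sup>2)"
    using assms by (simp add: L2cell_def)
  finally show ?thesis .
qed

lemma smoothing_inner_tendsto_continuous:
  assumes h: "L2cell h" and f: "continuous_on UNIV f"
  shows "(\<lambda>n. LINT x|cell. h x * smoothing n f x) \<longlonglongrightarrow> (LINT x|cell. h x * f x)"
proof -
  note [measurable] = L2cellD[OF h]
  obtain B where B: "0 \<le> B" "\<And>x. x \<in> Q \<Longrightarrow> \<bar>f x\<bar> \<le> B"
    using bounded_on_Q[OF f] by blast
  have Lf: "L2cell f" by (rule L2cell_continuous[OF f])
  have bd: "\<bar>smoothing n f x\<bar> \<le> B" for n x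
  proof -
    have "\<bar>smoothing n f x\<bar> \<le> (LINT y|cell. \<bar>f y * kern n x y\<bar>)"
      unfolding smoothing_def by (rule integral_abs_bound)
    also have "\<dots> \<le> (LINT y|cell. B * kern n x y)"
    proof (rule integral_mono_AE)
      show "AE y in cell. \<bar>f y * kern n x y\<bar> \<le> B * kern n x y"
        using AE_cell_Q
        by eventually_elim (use B in \<open>auto simp: abs_mult kern_nonneg intro!: mult_right_mono\<close>)
    qed (use integrable_kern_mult[OF Lf] integrable_cell_continuous[OF continuous_kern_snd] in auto)
    also have "\<dots> = B" by (simp add: integral_kern)
    finally show ?thesis .
  qed
  show ?thesis
  proof (rule integral_dominated_convergence[where w = "\<lambda>x. B * \<bar>h x\<bar>"])
    show "AE x in cell. (\<lambda>n. h x * smoothing n f x) \<longlonglongrightarrow> h x * f x"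
      using AE_cell by eventually_elim (intro tendsto_mult tendsto_const smoothing_tendsto[OF f]; simp)
    show "AE x in cell. norm (h x * smoothing n f x) \<le> B * \<bar>h x\<bar>" for n
      using mult_right_mono[OF bd abs_ge_zero] by (auto simp: abs_mult mult.commute)
    show "(\<lambda>x. h x * smoothing n f x) \<in> borel_measurable cell" for n
      using smoothing_form(1)[OF h Lf] by auto
    show "(\<lambda>x. h x * f x) \<in> borel_measurable cell"
      using L2cell_mult_integrable[OF h Lf] by auto
    show "integrable cell (\<lambda>x. B * \<bar>h x\<bar>)"
      using L2cell_integrable[OF h] by auto
  qed
qed

text \<open>Density of continuous functions together with the uniform bound of
  \<open>smoothing_form\<close> for the remainder.\<close>

lemma smoothing_inner_tendsto:
  assumes h: "L2cell h" and f: "L2cell f"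
  shows "(\<lambda>n. LINT x|cell. h x * smoothing n f x) \<longlonglongrightarrow> (LINT x|cell. h x * f x)"
proof (rule LIMSEQ_I)
  fix e :: real assume e: "0 < e"
  let ?H = "LINT x|cell. (h x)\<^sup>2"
  have H: "0 \<le> ?H" by simp
  \<comment> \<open>\<open>?H\<close> may vanish; \<open>t\<close> is a positive bound for it, so
    that \<open>\<delta>\<close> is defined by a proper division and still gives
    \<open>\<delta> * ?H \<le> e / 4\<close>.\<close>
  define t where "t = ?H + 1"
  have t: "0 < t" "?H \<le> t" using add_nonneg_pos[OF H zero_less_one] by (simp_all add: t_def)
  define \<delta> where "\<delta> = e / (4 * t)"
  have \<delta>: "0 < \<delta>" "\<delta> * ?H \<le> e / 4"
  proof -
    show "0 < \<delta>" unfolding \<delta>_def using e t by simp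
    then have "\<delta> * ?H \<le> \<delta> * t" using t(2) by (intro mult_left_mono) auto
    also have "\<dots> = e / 4" using t by (simp add: \<delta>_def)
    finally show "\<delta> * ?H \<le> e / 4" .
  qed
  obtain g where g: "continuous_on UNIV g" and fg: "(LINT x|cell. (f x - g x)\<^sup>2) < \<delta> * e / 4"
    using L2cell_approx[OF f, of "\<delta> * e / 4"] \<delta> e by auto
  let ?r = "\<lambda>x. f x - g x"
  have Lg: "L2cell g" by (rule L2cell_continuous[OF g])
  have r: "L2cell ?r" by (rule L2cell_diff[OF f Lg])
  \<comment> \<open>The available bounds are sums of squares rather than products of norms. Scaling
    \<open>h\<close> by \<open>c\<close> and the remainder by \<open>1 / c\<close> leaves their
    pairing unchanged and weights the sum by \<open>\<delta>\<close> and
    \<open>1 / \<delta>\<close>.\<close>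
  define c where "c = sqrt \<delta>"
  have c: "c \<noteq> 0" "c\<^sup>2 = \<delta>" using \<delta> by (simp_all add: c_def)
  have weighted: "(c\<^sup>2 * ?H + (LINT x|cell. (?r x)\<^sup>2) / c\<^sup>2) < e / 2"
  proof -
    have "(LINT x|cell. (?r x)\<^sup>2) / \<delta> < e / 4" using fg \<delta> by (simp add: field_simps)
    with \<delta> show ?thesis unfolding c by linarith
  qed
  have scaled: "(LINT x|cell. (c * h x)\<^sup>2) + (LINT x|cell. (1 / c * ?r x)\<^sup>2) = c\<^sup>2 * ?H + (LINT x|cell. (?r x)\<^sup>2) / c\<^sup>2"
    by (simp add: power_mult_distrib power_divide)
  have 1: "2 * \<bar>LINT x|cell. h x * smoothing n ?r x\<bar> < e / 2" for n
    using le_less_trans[OF smoothing_form(2)[OF L2cell_cmult[OF h, of c] L2cell_cmult[OF r, of "1 / c"], of n,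
        unfolded scaled smoothing_cmult] weighted] c(1)
    by simp
  have 2: "2 * \<bar>LINT x|cell. h x * ?r x\<bar> < e / 2"
    using le_less_trans[OF L2cell_inner_bound[OF L2cell_cmult[OF h, of c] L2cell_cmult[OF r, of "1 / c"],
        unfolded scaled] weighted] c(1)
    by simp
  obtain N where N: "\<And>n. N \<le> n \<Longrightarrow>
      \<bar>(LINT x|cell. h x * smoothing n g x) - (LINT x|cell. h x * g x)\<bar> < e / 2"
    using LIMSEQ_D[OF smoothing_inner_tendsto_continuous[OF h g], of "e / 2"] e by auto
  have "\<bar>(LINT x|cell. h x * smoothing n f x) - (LINT x|cell. h x * f x)\<bar> < e" if "N \<le> n" for n
  proof -
    have "smoothing n f x = smoothing n g x + smoothing n ?r x" for x
      using smoothing_add[OF Lg r, of n x] by simp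
    then have "(LINT x|cell. h x * smoothing n f x)
        = (LINT x|cell. h x * smoothing n g x) + (LINT x|cell. h x * smoothing n ?r x)"
      using smoothing_form(1)[OF h Lg] smoothing_form(1)[OF h r] by (simp add: distrib_left)
    moreover have "(LINT x|cell. h x * f x) = (LINT x|cell. h x * g x) + (LINT x|cell. h x * ?r x)"
      using L2cell_mult_integrable[OF h Lg] L2cell_mult_integrable[OF h r]
      by (subst Bochner_Integration.integral_add[symmetric]) (auto simp: algebra_simps)
    ultimately show ?thesis using 1[of n] 2 N[OF that] by linarith
  qed
  then show "\<exists>N. \<forall>n\<ge>N. norm ((LINT x|cell. h x * smoothing n f x) - (LINT x|cell. h x * f x)) < e"
    by auto
qed

text \<open>The frequency is \<open>\<pi>\<close>, matching the cosines in the kernel, so members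
  need not have period one. Periodicity of the kernel comes from its even exponent
  (\<open>periodic_kern\<close>).\<close>

inductive_set trig :: "(real^2 \<Rightarrow> real) set" where
  trig_const: "(\<lambda>x. c) \<in> trig"
| trig_sin: "(\<lambda>x. sin (pi * x $ i)) \<in> trig"
| trig_cos: "(\<lambda>x. cos (pi * x $ i)) \<in> trig"
| trig_add: "f \<in> trig \<Longrightarrow> g \<in> trig \<Longrightarrow> (\<lambda>x. f x + g x) \<in> trig"
| trig_mult: "f \<in> trig \<Longrightarrow> g \<in> trig \<Longrightarrow> (\<lambda>x. f x * g x) \<in> trig"

lemma partial_mult:
  assumes "f differentiable (at x)" "g differentiable (at x)"
  shows "partial a (\<lambda>x. f x * g x) x = partial a f x * g x + f x * partial a g x"
proof -
  have "((\<lambda>x. f x * g x) has_derivative (\<lambda>h. (g x *\<^sub>R gradv f x + f x *\<^sub>R gradv g x) \<bullet> h)) (at x)"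
    by (rule has_derivative_eq_rhs[OF has_derivative_mult[OF has_derivative_gradv[OF assms(1)] has_derivative_gradv[OF assms(2)]]])
      (simp add: fun_eq_iff inner_add_left)
  from partial_eqI_inner[OF this] show ?thesis by (simp add: gradv_def mult.commute)
qed

lemma partial_add:
  assumes "f differentiable (at x)" "g differentiable (at x)"
  shows "partial a (\<lambda>x. f x + g x) x = partial a f x + partial a g x"
  using partial_linear[OF assms, of a 1 1] by simp

lemma trig_partial:
  assumes "f \<in> trig"
  shows "(\<forall>x. f differentiable (at x)) \<and> (\<forall>a. partial a f \<in> trig)"
  using assms
proof induction
  case (trig_const c)
  show ?case by (auto simp: partial_const intro: trig.trig_const)
next
  case (trig_sin i)
  have d: "((\<lambda>x. sin (pi * x $ i)) has_derivative (\<lambda>h. pi * cos (pi * x $ i) * h $ i)) (at x)" for x :: "real^2"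
    by (auto intro!: derivative_eq_intros has_derivative_nth)
  have "partial a (\<lambda>x. sin (pi * x $ i)) = (\<lambda>x. (pi * axis a 1 $ i) * cos (pi * x $ i))" for a
    by (rule ext) (simp add: partial_eqI[OF d])
  with d show ?case by (auto intro!: trig.intros simp: differentiable_def)
next
  case (trig_cos i)
  have d: "((\<lambda>x. cos (pi * x $ i)) has_derivative (\<lambda>h. - (pi * sin (pi * x $ i) * h $ i))) (at x)" for x :: "real^2"
    by (auto intro!: derivative_eq_intros has_derivative_nth)
  have "partial a (\<lambda>x. cos (pi * x $ i)) = (\<lambda>x. (- pi * axis a 1 $ i) * sin (pi * x $ i))" for a
    by (rule ext) (simp add: partial_eqI[OF d])
  moreover have "(\<lambda>x. (- pi * axis a 1 $ i) * sin (pi * x $ i)) \<in> trig" for a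
    by (intro trig.intros)
  ultimately show ?case using d unfolding differentiable_def by metis
next
  case (trig_add f g)
  then have "partial a (\<lambda>x. f x + g x) = (\<lambda>x. partial a f x + partial a g x)" for a
    by (simp add: fun_eq_iff partial_add)
  with trig_add show ?case by (auto intro: trig.intros)
next
  case (trig_mult f g)
  then have "partial a (\<lambda>x. f x * g x) = (\<lambda>x. partial a f x * g x + f x * partial a g x)" for a
    by (simp add: fun_eq_iff partial_mult)
  with trig_mult show ?case by (auto intro!: trig.intros)
qed

lemma trig_smooth: "f \<in> trig \<Longrightarrow> smooth f"
  by (rule smooth_coinduct[where X = trig]) (auto simp: trig_partial)

inductive_set separated :: "(real^2 \<Rightarrow> real^2 \<Rightarrow> real) set" where
  sep_mult: "f \<in> trig \<Longrightarrow> g \<in> trig \<Longrightarrow> (\<lambda>x y. f x * g y) \<in> separated"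
| sep_add: "F \<in> separated \<Longrightarrow> G \<in> separated \<Longrightarrow> (\<lambda>x y. F x y + G x y) \<in> separated"

lemma separated_mult:
  assumes "F \<in> separated" "G \<in> separated"
  shows "(\<lambda>x y. F x y * G x y) \<in> separated"
  using assms
proof (induction F)
  case (sep_mult f g)
  from sep_mult(3) show ?case
  proof (induction G)
    case (sep_mult f' g')
    have "(\<lambda>x y. (f x * f' x) * (g y * g' y)) \<in> separated"
      using sep_mult \<open>f \<in> trig\<close> \<open>g \<in> trig\<close> by (intro separated.intros trig.intros)
    then show ?case by (simp add: mult.assoc mult.left_commute)
  next
    case (sep_add F G)
    then show ?case using separated.sep_add[OF sep_add(3,4)] by (simp add: distrib_left)
  qed
next
  case (sep_add F H)
  then show ?case using separated.sep_add[OF sep_add(3,4)] by (simp add: distrib_right)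
qed

lemma separated_const: "(\<lambda>x y. c) \<in> separated"
  using separated.sep_mult[OF trig_const[of c] trig_const[of 1]] by simp

lemma separated_power:
  assumes "F \<in> separated"
  shows "(\<lambda>x y. F x y ^ n) \<in> separated"
proof (induction n)
  case 0
  show ?case using separated_const[of 1] by simp
next
  case (Suc n)
  show ?case using separated_mult[OF assms Suc] by simp
qed

lemma separated_cos: "(\<lambda>x y. cos (pi * (x $ i - y $ i))) \<in> separated"
proof -
  have "(\<lambda>x y. cos (pi * x $ i) * cos (pi * y $ i) + sin (pi * x $ i) * sin (pi * y $ i)) \<in> separated"
    by (intro separated.intros trig.intros)
  then show ?thesis by (simp add: right_diff_distrib cos_diff)
qed

lemma kern_separated: "kern n \<in> separated"
proof -
  have "(\<lambda>x y. (kern_const n * kern_const n) * (cos (pi * (x $ 1 - y $ 1)) ^ (2 * n) * cos (pi * (x $ 2 - y $ 2)) ^ (2 * n))) \<in> separated"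
    by (intro separated_mult separated_const separated_power separated_cos)
  moreover have "kern n = (\<lambda>x y. (kern_const n * kern_const n) * (cos (pi * (x $ 1 - y $ 1)) ^ (2 * n) * cos (pi * (x $ 2 - y $ 2)) ^ (2 * n)))"
    by (simp add: kern_def kern1_def fun_eq_iff)
  ultimately show ?thesis by simp
qed

text \<open>For a product the integral over \<open>y\<close> is a constant factor, so
  differentiation in \<open>x\<close> is trivial. The integrability and differentiability clauses
  are there to carry the induction through sums.\<close>

lemma separated_integral:
  assumes "F \<in> separated" and f: "L2cell f"
  shows "(\<lambda>x. LINT y|cell. f y * F x y) \<in> trig \<and>
    (\<forall>a x. partial a (\<lambda>x. LINT y|cell. f y * F x y) x = (LINT y|cell. f y * partial a (\<lambda>x. F x y) x)) \<and>
    (\<forall>x. integrable cell (\<lambda>y. f y * F x y)) \<and>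
    (\<forall>a x. integrable cell (\<lambda>y. f y * partial a (\<lambda>x. F x y) x)) \<and>
    (\<forall>x y. (\<lambda>x. F x y) differentiable (at x))"
  using assms(1)
proof induction
  case (sep_mult u v)
  then have "L2cell v" by (intro L2cell_continuous smooth_continuous trig_smooth)
  then have i: "integrable cell (\<lambda>y. f y * v y)" by (rule L2cell_mult_integrable[OF f])
  let ?c = "LINT y|cell. f y * v y"
  have u: "u differentiable (at x)" for x using trig_partial[OF sep_mult(1)] by blast
  have eq: "f y * (w * v y) = w * (f y * v y)" for y w by simp
  have p: "partial a (\<lambda>x. u x * r) x = partial a u x * r" for a x r
  proof -
    have "partial a (\<lambda>x. r * u x + 0 * u x) x = r * partial a u x + 0 * partial a u x"
      by (rule partial_linear[OF u u])
    then show ?thesis by (simp add: mult.commute)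
  qed
  have "(\<lambda>x. u x * ?c) \<in> trig" by (intro trig.intros sep_mult)
  with i u show ?case
    by (auto simp: p eq differentiable_mult)
next
  case (sep_add F G)
  let ?F = "\<lambda>x. LINT y|cell. f y * F x y" and ?G = "\<lambda>x. LINT y|cell. f y * G x y"
  have d: "?F differentiable (at x)" "?G differentiable (at x)" for x
    using sep_add trig_partial by blast+
  have p: "partial a (\<lambda>x. F x y + G x y) x = partial a (\<lambda>x. F x y) x + partial a (\<lambda>x. G x y) x" for a x y
    using sep_add by (intro partial_add) auto
  have s: "(LINT y|cell. f y * (F x y + G x y)) = ?F x + ?G x" for x
    using sep_add by (simp add: distrib_left)
  have "(\<lambda>x. ?F x + ?G x) \<in> trig" using sep_add by (intro trig.intros) auto
  moreover have "partial a (\<lambda>x. ?F x + ?G x) x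
      = (LINT y|cell. f y * partial a (\<lambda>x. F x y + G x y) x)" for a x
    using sep_add by (simp add: p partial_add[OF d] distrib_left)
  ultimately show ?case
    using sep_add unfolding s by (auto simp: p distrib_left)
qed

lemma periodic_kern: "kern n (x + axis i 1) y = kern n x y"
proof -
  have "kern1 n (a + 1) b = kern1 n a b" for a b
  proof -
    have "cos (pi * (a + 1 - b)) = - cos (pi * (a - b))"
      using cos_periodic_pi[of "pi * (a - b)"] by (simp add: algebra_simps)
    then show ?thesis by (simp add: kern1_def)
  qed
  then show ?thesis using exhaust_2[of i] by (auto simp: kern_def axis_def)
qed

lemma test_fun_smoothing:
  assumes "L2cell f"
  shows "test_fun (smoothing n f)"
proof -
  have "smoothing n f \<in> trig"
    using separated_integral[OF kern_separated assms] by (simp add: smoothing_def[abs_def])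
  then show ?thesis
    by (simp add: test_fun_iff trig_smooth periodic_def) (simp add: smoothing_def periodic_kern)
qed

lemma test_fun_kern: "test_fun (kern n x)"
proof -
  have "kern n x = (\<lambda>y. kern n y x)" by (simp add: fun_eq_iff kern_sym)
  moreover have "(\<lambda>y. F y x) \<in> trig" if "F \<in> separated" for F
    using that by induction (auto intro!: trig.intros)
  ultimately have "kern n x \<in> trig" using kern_separated by auto
  moreover have "kern n x (y + axis i 1) = kern n x y" for y i
    using periodic_kern[of n y i x] by (simp add: kern_sym)
  ultimately show ?thesis by (simp add: test_fun_iff trig_smooth periodic_def)
qed

lemma partial_kern: "partial a (\<lambda>x. kern n x y) x = - partial a (kern n x) y"
proof -
  define k where "k = (\<lambda>z. kern n z 0)"
  have k: "kern n x y = k (x - y)" for x y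
    by (simp add: k_def kern_def kern1_def)
  have "k = kern n 0" unfolding k_def using kern_sym by blast
  then have s: "smooth k" using test_fun_kern[of n 0] by (simp add: test_fun_iff)
  have "((\<lambda>x. k (x - y)) has_derivative (\<lambda>h. gradv k (x - y) \<bullet> h)) (at x)"
    by (rule has_derivative_smooth_comp[OF s]) (auto intro!: derivative_eq_intros)
  moreover have "((\<lambda>y. k (x - y)) has_derivative (\<lambda>h. gradv k (x - y) \<bullet> (- h))) (at y)"
    by (rule has_derivative_smooth_comp[OF s]) (auto intro!: derivative_eq_intros)
  moreover have "kern n x = (\<lambda>y. k (x - y))" "(\<lambda>x. kern n x y) = (\<lambda>x. k (x - y))"
    using k by auto
  ultimately show ?thesis by (simp add: partial_eqI)
qed

text \<open>The kernel depends only on \<open>x - y\<close>, so the derivative can be moved to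
  \<open>y\<close>, where \<open>kern n x\<close> is a test function for the weak derivative.
  Smoothing thus turns weak derivatives into classical ones.\<close>

lemma partial_smoothing:
  assumes f: "L2cell f" and g: "L2cell g"
    and weak: "\<And>\<psi>. test_fun \<psi> \<Longrightarrow> (LINT x|cell. f x * partial a \<psi> x) = - (LINT x|cell. g x * \<psi> x)"
  shows "partial a (smoothing n f) x = smoothing n g x"
proof -
  have "partial a (smoothing n f) x = (LINT y|cell. f y * partial a (\<lambda>x. kern n x y) x)"
    using separated_integral[OF kern_separated f] by (simp add: smoothing_def[abs_def])
  also have "\<dots> = - (LINT y|cell. f y * partial a (kern n x) y)"
    by (simp add: partial_kern)
  also have "\<dots> = smoothing n g x"
    using weak[OF test_fun_kern] by (simp add: smoothing_def)
  finally show ?thesis .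
qed

text \<open>The function \<open>smoothing n \<phi>\<close> is a test function with partial
  derivatives \<open>smoothing n (g a)\<close>. Testing the divergence of \<open>J\<close> with it
  gives zero for every \<open>n\<close>, and the pairings converge.\<close>

lemma div_curl_cell:
  assumes J: "\<And>a. L2cell (J a)" and g: "\<And>a. L2cell (g a)" and \<phi>: "L2cell \<phi>"
    and divJ: "\<And>\<psi>. test_fun \<psi> \<Longrightarrow> (LINT x|cell. J 1 x * partial 1 \<psi> x + J 2 x * partial 2 \<psi> x) = 0"
    and weak: "\<And>\<psi> a. test_fun \<psi> \<Longrightarrow> (LINT x|cell. \<phi> x * partial a \<psi> x) = - (LINT x|cell. g a x * \<psi> x)"
  shows "(LINT x|cell. J (1::2) x * g 1 x + J 2 x * g 2 x) = 0"
proof -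
  have "(LINT x|cell. J 1 x * smoothing n (g 1) x) + (LINT x|cell. J 2 x * smoothing n (g 2) x) = 0" for n
    using divJ[OF test_fun_smoothing[OF \<phi>, of n]]
      smoothing_form(1)[OF J[of 1] g[of 1]] smoothing_form(1)[OF J[of 2] g[of 2]]
    by (simp add: partial_smoothing[OF \<phi> g weak])
  then have "(\<lambda>n. (LINT x|cell. J 1 x * smoothing n (g 1) x) + (LINT x|cell. J 2 x * smoothing n (g 2) x)) \<longlonglongrightarrow> 0"
    by simp
  moreover have "(\<lambda>n. (LINT x|cell. J 1 x * smoothing n (g 1) x) + (LINT x|cell. J 2 x * smoothing n (g 2) x))
      \<longlonglongrightarrow> (LINT x|cell. J 1 x * g 1 x) + (LINT x|cell. J 2 x * g 2 x)"
    by (intro tendsto_add smoothing_inner_tendsto J g)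
  ultimately have "(LINT x|cell. J 1 x * g 1 x) + (LINT x|cell. J 2 x * g 2 x) = 0"
    using LIMSEQ_unique by blast
  then show ?thesis
    using L2cell_mult_integrable[OF J[of 1] g[of 1]] L2cell_mult_integrable[OF J[of 2] g[of 2]] by simp
qed

text \<open>Testing with the smoothings of \<open>f\<close> itself gives in the limit that the
  square of \<open>f\<close> has integral zero.\<close>

lemma L2cell_eq_0:
  assumes f: "L2cell f" and weak: "\<And>\<psi>. test_fun \<psi> \<Longrightarrow> (LINT x|cell. f x * \<psi> x) = 0"
  shows "AE x in cell. f x = 0"
proof -
  have "(\<lambda>n. LINT x|cell. f x * smoothing n f x) \<longlonglongrightarrow> (LINT x|cell. f x * f x)"
    by (rule smoothing_inner_tendsto[OF f f])
  then have "(LINT x|cell. f x * f x) = 0"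
    by (simp add: weak[OF test_fun_smoothing[OF f]] LIMSEQ_const_iff)
  then have "AE x in cell. f x * f x = 0"
    using L2cell_mult_integrable[OF f f] by (subst (asm) integral_nonneg_eq_0_iff_AE) auto
  then show ?thesis by eventually_elim simp
qed

subsection \<open>Periodic primitives\<close>

text \<open>Subtracting the line average makes the increment of the primitive over one period
  vanish, so that primitives of test functions are test functions
  (\<open>test_fun_nprim\<close>).\<close>

definition nprim :: "2 \<Rightarrow> (real^2 \<Rightarrow> real) \<Rightarrow> real^2 \<Rightarrow> real" where
  "nprim i \<psi> = prim i (\<lambda>x. \<psi> x - avg i \<psi> x)"

lemma avg_shift: "avg i \<psi> (x + r *\<^sub>R axis i 1) = avg i \<psi> x"
  by (simp add: avg_def axis_def[of i] algebra_simps)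

lemma avg_avg: "avg i (avg i \<psi>) x = avg i \<psi> x"
  by (subst avg_def) (simp add: avg_shift)

lemma integrable_line:
  fixes \<psi> :: "real^2 \<Rightarrow> real"
  assumes "continuous_on UNIV \<psi>"
  shows "(\<lambda>s. \<psi> (x + (s - x $ i) *\<^sub>R axis i 1)) integrable_on {0..1::real}"
  by (intro integrable_continuous_real continuous_on_compose2[OF assms] continuous_intros) auto

lemma avg_diff_avg:
  assumes "smooth \<psi>"
  shows "avg i (\<lambda>x. \<psi> x - avg i \<psi> x) x = 0"
proof -
  have "avg i (\<lambda>x. \<psi> x - avg i \<psi> x) x = avg i \<psi> x - avg i (avg i \<psi>) x"
    unfolding avg_def[of i "\<lambda>x. \<psi> x - avg i \<psi> x"] avg_def[of i \<psi> x] avg_def[of i "avg i \<psi>"]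
    by (intro Henstock_Kurzweil_Integration.integral_diff integrable_line smooth_continuous smooth_avg assms)
  then show ?thesis by (simp add: avg_avg)
qed

lemma smooth_nprim: "smooth \<psi> \<Longrightarrow> smooth (nprim i \<psi>)"
  unfolding nprim_def by (intro smooth_prim smooth_diff smooth_avg)

lemma nprim_partial:
  assumes "smooth \<psi>"
  shows "partial a (nprim i \<psi>) x = (if a = i then \<psi> x - avg i \<psi> x else nprim i (partial a \<psi>) x)"
proof (cases "a = i")
  case True
  then show ?thesis
    using assms by (simp add: nprim_def prim_partial(2) smooth_diff smooth_avg)
next
  case False
  have "partial a (\<lambda>x. \<psi> x - avg i \<psi> x) = (\<lambda>x. partial a \<psi> x - avg i (partial a \<psi>) x)"
  proof
    fix x
    have "partial a (\<lambda>x. 1 * \<psi> x + (-1) * avg i \<psi> x) x = 1 * partial a \<psi> x + (-1) * partial a (avg i \<psi>) x"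
      by (rule partial_linear[OF smooth_differentiable[OF assms] avg_partial(1)[OF assms]])
    then show "partial a (\<lambda>x. \<psi> x - avg i \<psi> x) x = partial a \<psi> x - avg i (partial a \<psi>) x"
      using False by (simp add: avg_partial(2)[OF assms])
  qed
  then show ?thesis
    using assms False by (simp add: nprim_def prim_partial(2) smooth_diff smooth_avg)
qed

lemma prim_eq:
  "prim i \<psi> x = x $ i * integral {0..1} (\<lambda>s. \<psi> (x - ((1 - s) * x $ i) *\<^sub>R axis i 1))"
  by (simp add: prim_def)

lemma nprim_eq: 
  assumes "smooth \<psi>"
  shows "nprim i \<psi> x = prim i \<psi> x - x $ i * avg i \<psi> x"
proof -
  have "avg i \<psi> (x - r *\<^sub>R axis i 1) = avg i \<psi> x" for r
    using avg_shift[of i \<psi> x "-r"] by simp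
  moreover have "(\<lambda>s. \<psi> (x - ((1 - s) * x $ i) *\<^sub>R axis i 1)) integrable_on {0..1}"
    by (intro integrable_continuous_real continuous_on_compose2[OF smooth_continuous[OF assms, of UNIV]] continuous_intros) auto
  from Henstock_Kurzweil_Integration.integral_diff[OF this integrable_const_ivl[of "avg i \<psi> x"]]
  have "integral {0..1} (\<lambda>s. \<psi> (x - ((1 - s) * x $ i) *\<^sub>R axis i 1) - avg i \<psi> x)
      = integral {0..1} (\<lambda>s. \<psi> (x - ((1 - s) * x $ i) *\<^sub>R axis i 1)) - avg i \<psi> x"
    by simp
  ultimately show ?thesis
    unfolding nprim_def prim_eq by (simp add: right_diff_distrib)
qed

lemma has_derivative_line:
  assumes "smooth \<psi>"
  shows "((\<lambda>r. \<psi> (x + r *\<^sub>R axis i 1)) has_real_derivative partial i \<psi> (x + r *\<^sub>R axis i 1)) (at r)"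
proof -
  have "((\<lambda>r. \<psi> (x + r *\<^sub>R axis i 1)) has_derivative
      (\<lambda>h. gradv \<psi> (x + r *\<^sub>R axis i 1) \<bullet> (h *\<^sub>R axis i 1))) (at r)"
    by (rule has_derivative_compose[OF _ smooth_has_derivative[OF assms]])
      (auto intro!: derivative_eq_intros)
  then show ?thesis
    unfolding has_field_derivative_def by (simp add: inner_axis gradv_def mult_commute_abs)
qed

lemma prim_has_derivative_line:
  assumes "smooth \<psi>"
  shows "((\<lambda>r. prim i \<psi> (x + r *\<^sub>R axis i 1)) has_real_derivative \<psi> (x + r *\<^sub>R axis i 1)) (at r)"
  using has_derivative_line[OF smooth_prim[OF assms], of i x i] by (simp add: prim_partial(2)[OF assms])

lemma test_fun_avg:
  assumes "test_fun \<psi>"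
  shows "test_fun (avg i \<psi>)"
proof -
  have s: "smooth \<psi>" and per: "\<psi> (x + axis j 1) = \<psi> x" for x j
    using assms by (auto simp: test_fun_iff periodic_def)
  have "avg i \<psi> (x + axis j 1) = avg i \<psi> x" for x j
  proof (cases "j = i")
    case True
    then show ?thesis using avg_shift[of i \<psi> x 1] by simp
  next
    case False
    then have "axis j 1 $ i = (0::real)" by (simp add: axis_def)
    moreover have "\<psi> (x + axis j 1 + v) = \<psi> (x + v)" for v
      using per[of "x + v" j] by (simp add: add.assoc add.commute[of v])
    ultimately show ?thesis by (simp add: avg_def)
  qed
  then show ?thesis by (simp add: test_fun_iff smooth_avg[OF s] periodic_def)
qed

lemma test_fun_nprim:
  assumes "test_fun \<psi>"
  shows "test_fun (nprim i \<psi>)"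
proof -
  have s: "smooth \<psi>" and per: "\<psi> (x + axis j 1) = \<psi> x" for x j
    using assms by (auto simp: test_fun_iff periodic_def)
  let ?\<chi> = "\<lambda>x. \<psi> x - avg i \<psi> x"
  have s\<chi>: "smooth ?\<chi>" by (intro smooth_diff smooth_avg s)
  have avg_per: "avg i \<psi> (x + axis j 1) = avg i \<psi> x" for x j
    using test_fun_avg[OF assms] by (simp add: test_fun_iff periodic_def)
  have \<chi>_per: "?\<chi> (x + axis j 1) = ?\<chi> x" for x j using per avg_per by simp
  have "nprim i \<psi> (x + axis j 1) = nprim i \<psi> x" for x j
  proof (cases "j = i")
    case False
    then have "axis j 1 $ i = (0::real)" by (simp add: axis_def)
    moreover have "?\<chi> (x + axis j 1 - v) = ?\<chi> (x - v)" for v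
      using \<chi>_per[of "x - v" j] by (simp only: diff_add_eq)
    ultimately show ?thesis unfolding nprim_def prim_def by simp
  next
    case True
    define x0 where "x0 = x - x $ i *\<^sub>R axis i 1"
    let ?p = "\<lambda>r. prim i ?\<chi> (x0 + r *\<^sub>R axis i 1)"
    have d: "(?p has_real_derivative ?\<chi> (x0 + r *\<^sub>R axis i 1)) (at r)" for r
      by (rule prim_has_derivative_line[OF s\<chi>])
    \<comment> \<open>By periodicity of the integrand the increment over a unit step does not depend
      on \<open>r\<close>; at \<open>r = 0\<close> it is the line average of \<open>?\<chi>\<close>,
      which is zero.\<close>
    have "((\<lambda>r. ?p (r + 1) - ?p r) has_real_derivative 0) (at r)" for r
    proof -
      have "((\<lambda>r. ?p (r + 1)) has_real_derivative ?\<chi> (x0 + (r + 1) *\<^sub>R axis i 1)) (at r)"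
      proof -
        have "((\<lambda>r. r + 1) has_real_derivative 1) (at r)" by (auto intro!: derivative_eq_intros)
        from DERIV_chain2[where f = ?p and g = "\<lambda>r. r + 1", OF d[of "r + 1"] this]
        show ?thesis by simp
      qed
      from DERIV_diff[OF this d[of r]]
      show ?thesis using \<chi>_per[of "x0 + r *\<^sub>R axis i 1" i] by (simp add: algebra_simps)
    qed
    then have "?p (x $ i + 1) - ?p (x $ i) = ?p (0 + 1) - ?p 0"
      using DERIV_isconst_all[of "\<lambda>r. ?p (r + 1) - ?p r" "x $ i" 0] by blast
    moreover have x0: "x0 $ i = 0" by (simp add: x0_def axis_def)
    have "?p 0 = 0" using x0 by (simp add: prim_def)
    moreover have "?p 1 = avg i ?\<chi> x0"
      using x0 by (simp add: prim_def avg_def axis_def[of i] algebra_simps)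
    moreover have "avg i ?\<chi> x0 = 0" by (rule avg_diff_avg[OF s])
    ultimately have "?p (x $ i + 1) = ?p (x $ i)" by simp
    then show ?thesis using True by (simp add: nprim_def x0_def algebra_simps)
  qed
  then show ?thesis by (simp add: test_fun_iff smooth_nprim[OF s] periodic_def)
qed

lemma test_fun_partial:
  assumes "test_fun \<psi>"
  shows "test_fun (partial a \<psi>)"
proof -
  have s: "smooth \<psi>" and per: "\<psi> (x + axis j 1) = \<psi> x" for x j
    using assms by (auto simp: test_fun_iff periodic_def)
  have "partial a \<psi> (x + axis j 1) = partial a \<psi> x" for x j
  proof -
    have "((\<lambda>x. \<psi> (x + axis j 1)) has_derivative (\<lambda>h. gradv \<psi> (x + axis j 1) \<bullet> h)) (at x)"
      by (rule has_derivative_smooth_comp[OF s]) (auto intro!: derivative_eq_intros)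
    then have "(\<psi> has_derivative (\<lambda>h. gradv \<psi> (x + axis j 1) \<bullet> h)) (at x)" by (simp add: per)
    from partial_eqI_inner[OF this] show ?thesis by (simp add: gradv_def)
  qed
  then show ?thesis using smooth_partial[OF s] by (simp add: test_fun_iff periodic_def)
qed

section \<open>Integrals along coordinate lines\<close>

lemma vec2_line:
  "vec2 (r, t) + c *\<^sub>R axis 1 1 = vec2 (r + c, t)" "vec2 (r, t) + c *\<^sub>R axis 2 1 = vec2 (r, t + c)"
  "vec2 (r, t) - c *\<^sub>R axis 1 1 = vec2 (r - c, t)" "vec2 (r, t) - c *\<^sub>R axis 2 1 = vec2 (r, t - c)"
  by (simp_all add: vec_eq_iff forall_2 axis_def)

lemma continuous_vec2_comp:
  assumes "continuous_on UNIV \<psi>" "continuous_on A f" "continuous_on A g"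
  shows "continuous_on A (\<lambda>x. \<psi> (vec2 (f x, g x)))"
  by (rule continuous_on_compose2[OF assms(1) continuous_on_compose2[OF continuous_vec2]])
    (auto intro!: continuous_intros assms)

lemma integral_unit_avg:
  assumes "continuous_on UNIV \<psi>"
  shows "(LINT s|unit_lborel. \<psi> (vec2 (s, t))) = avg 1 \<psi> (vec2 (r, t))"
proof -
  have "continuous_on UNIV (\<lambda>s. \<psi> (vec2 (s, t)))"
    by (intro continuous_vec2_comp[OF assms] continuous_intros)
  from integral_unit_eq(2)[OF this] show ?thesis by (simp add: avg_def vec2_line)
qed

lemma integral_unit_tail:
  assumes p: "\<And>s. (p has_real_derivative \<xi> s) (at s)" and \<xi>: "continuous_on UNIV \<xi>"
    and r: "0 \<le> r" "r \<le> 1"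
  shows "(LINT s|unit_lborel. (if r < s then \<xi> s else 0)) = p 1 - p r"
proof -
  have e: "unit_lborel = density lborel (\<lambda>x. ennreal (indicator {0..1} x))"
    by (simp add: unit_lborel_def ennreal_indicator)
  have m[measurable]: "\<xi> \<in> borel_measurable borel" by (rule borel_measurable_continuous_onI[OF \<xi>])
  have i: "set_integrable lborel {r..1} \<xi>"
    by (rule borel_integrable_atLeastAtMost'[OF continuous_on_subset[OF \<xi>]]) simp
  have "(LINT s|unit_lborel. (if r < s then \<xi> s else 0))
      = (LINT s|lborel. indicator {0..1} s *\<^sub>R (if r < s then \<xi> s else 0))"
    unfolding e by (subst integral_density) auto
  also have "\<dots> = (LINT s:{r..1}|lborel. \<xi> s)"
    unfolding set_lebesgue_integral_def
  proof (rule integral_cong_AE)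
    show "AE s in lborel. indicator {0..1} s *\<^sub>R (if r < s then \<xi> s else 0) = indicator {r..1} s *\<^sub>R \<xi> s"
      using AE_lborel_singleton[of r] by eventually_elim (use r in \<open>auto simp: indicator_def\<close>)
  qed measurable
  also have "\<dots> = integral {r..1} \<xi>"
    by (rule set_borel_integral_eq_integral(2)[OF i])
  also have "\<dots> = p 1 - p r"
  proof (rule integral_unique, rule fundamental_theorem_of_calculus[OF r(2)])
    show "(p has_vector_derivative \<xi> s) (at s within {r..1})" for s
      using p by (meson has_real_derivative_iff_has_vector_derivative has_vector_derivative_at_within)
  qed
  finally show ?thesis .
qed

lemma integral_unit_tail_fst:
  assumes "smooth \<xi>" "0 \<le> r" "r \<le> 1"
  shows "(LINT s|unit_lborel. (if r < s then \<xi> (vec2 (s, t)) else 0))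
    = avg 1 \<xi> (vec2 (r, t)) - prim 1 \<xi> (vec2 (r, t))"
proof -
  have "((\<lambda>s. prim 1 \<xi> (vec2 (s, t))) has_real_derivative \<xi> (vec2 (s, t))) (at s)" for s
    using prim_has_derivative_line[OF assms(1), of 1 "vec2 (0, t)"] by (simp add: vec2_line)
  moreover have "continuous_on UNIV (\<lambda>s. \<xi> (vec2 (s, t)))"
    by (intro continuous_vec2_comp[OF smooth_continuous[OF assms(1)]] continuous_intros)
  ultimately have "(LINT s|unit_lborel. (if r < s then \<xi> (vec2 (s, t)) else 0))
      = prim 1 \<xi> (vec2 (1, t)) - prim 1 \<xi> (vec2 (r, t))"
    by (rule integral_unit_tail) (use assms in auto)
  also have "prim 1 \<xi> (vec2 (1, t)) = avg 1 \<xi> (vec2 (r, t))"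
    by (simp add: prim_def avg_def vec2_line)
  finally show ?thesis .
qed

lemma integral_unit_tail_partial:
  assumes "smooth \<psi>" "0 \<le> r" "r \<le> 1"
  shows "(LINT s|unit_lborel. (if r < s then partial 1 \<psi> (vec2 (s, t)) else 0))
      = \<psi> (vec2 (1, t)) - \<psi> (vec2 (r, t))"
    and "(LINT s|unit_lborel. (if r < s then partial 2 \<psi> (vec2 (t, s)) else 0))
      = \<psi> (vec2 (t, 1)) - \<psi> (vec2 (t, r))"
proof -
  have "((\<lambda>s. \<psi> (vec2 (s, t))) has_real_derivative partial 1 \<psi> (vec2 (s, t))) (at s)"
    "((\<lambda>s. \<psi> (vec2 (t, s))) has_real_derivative partial 2 \<psi> (vec2 (t, s))) (at s)" for s
    using has_derivative_line[OF assms(1), of "vec2 (0, t)" 1] has_derivative_line[OF assms(1), of "vec2 (t, 0)" 2]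
    by (simp_all add: vec2_line)
  moreover have "continuous_on UNIV (\<lambda>s. partial 1 \<psi> (vec2 (s, t)))"
    "continuous_on UNIV (\<lambda>s. partial 2 \<psi> (vec2 (t, s)))"
    by (intro continuous_vec2_comp[OF smooth_continuous[OF smooth_partial[OF assms(1)]]] continuous_intros)+
  ultimately show "(LINT s|unit_lborel. (if r < s then partial 1 \<psi> (vec2 (s, t)) else 0))
      = \<psi> (vec2 (1, t)) - \<psi> (vec2 (r, t))"
    "(LINT s|unit_lborel. (if r < s then partial 2 \<psi> (vec2 (t, s)) else 0))
      = \<psi> (vec2 (t, 1)) - \<psi> (vec2 (t, r))"
    using assms(2,3) by (auto intro!: integral_unit_tail)
qed

lemma avg_partial_same:
  assumes "test_fun \<psi>"
  shows "avg i (partial i \<psi>) x = 0"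
proof -
  have s: "smooth \<psi>" and per: "\<psi> (x + axis j 1) = \<psi> x" for x j
    using assms by (auto simp: test_fun_iff periodic_def)
  have d: "((\<lambda>s. \<psi> (x + (s - x $ i) *\<^sub>R axis i 1)) has_vector_derivative
      partial i \<psi> (x + (s - x $ i) *\<^sub>R axis i 1)) (at s within {0..1})" for s
  proof -
    have eq: "x + (s - x $ i) *\<^sub>R axis i 1 = (x - x $ i *\<^sub>R axis i 1) + s *\<^sub>R axis i 1" for s
      by (simp add: algebra_simps)
    show ?thesis
      unfolding eq using has_derivative_line[OF s]
      by (meson has_real_derivative_iff_has_vector_derivative has_vector_derivative_at_within)
  qed
  have "((\<lambda>s. partial i \<psi> (x + (s - x $ i) *\<^sub>R axis i 1)) has_integral
      \<psi> (x + (1 - x $ i) *\<^sub>R axis i 1) - \<psi> (x + (0 - x $ i) *\<^sub>R axis i 1)) {0..1}"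
    by (rule fundamental_theorem_of_calculus[OF _ d]) simp
  from integral_unique[OF this] show ?thesis
    using per[of "x + (0 - x $ i) *\<^sub>R axis i 1" i] by (simp add: avg_def algebra_simps)
qed

text \<open>Nonnegativity of the variance for a measure of mass one.\<close>

lemma integral_unit_square_le:
  fixes f :: "real \<Rightarrow> real"
  assumes f: "f \<in> borel_measurable borel" and i: "integrable unit_lborel (\<lambda>x. (f x)\<^sup>2)"
  shows "integrable unit_lborel f"
    and "(LINT x|unit_lborel. f x)\<^sup>2 \<le> (LINT x|unit_lborel. (f x)\<^sup>2)"
proof -
  show fi: "integrable unit_lborel f"
  proof (rule Bochner_Integration.integrable_bound)
    show "integrable unit_lborel (\<lambda>x. 1 + (f x)\<^sup>2)" using i by simp
    have "\<bar>v\<bar> \<le> 1 + v\<^sup>2" for v :: real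
      using abs_mult_le[of 1 v] by simp
    then show "AE x in unit_lborel. norm (f x) \<le> norm (1 + (f x)\<^sup>2)" by simp
  qed (use f in simp)
  define m where "m = (LINT x|unit_lborel. f x)"
  have "0 \<le> (LINT x|unit_lborel. (f x - m)\<^sup>2)" by simp
  also have "(LINT x|unit_lborel. (f x - m)\<^sup>2) = (LINT x|unit_lborel. (f x)\<^sup>2 + m\<^sup>2 - 2 * m * f x)"
    by (simp add: power2_diff mult.assoc mult.left_commute mult.commute)
  also have "\<dots> = (LINT x|unit_lborel. (f x)\<^sup>2) - m\<^sup>2"
    using fi i by (simp add: m_def[symmetric] power2_eq_square)
  finally show "(LINT x|unit_lborel. f x)\<^sup>2 \<le> (LINT x|unit_lborel. (f x)\<^sup>2)"
    by (simp add: m_def)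
qed

lemma integrable_unit2_snd:
  fixes f :: "real \<Rightarrow> real"
  assumes f: "f \<in> borel_measurable borel" "integrable unit_lborel f"
  shows "integrable (unit_lborel \<Otimes>\<^sub>M unit_lborel) (\<lambda>p. f (snd p))"
proof -
  note [measurable] = f(1)
  have "integrable (unit_lborel \<Otimes>\<^sub>M unit_lborel) (\<lambda>p. f (fst p))"
    by (rule unit2.Fubini_integrable) (use f in \<open>auto\<close>)
  from unit2.integrable_product_swap[OF this] show ?thesis by (simp add: case_prod_unfold)
qed

lemma AE_cell_snd:
  assumes "AE t in unit_lborel. F t" "Measurable.pred borel F"
  shows "AE x in cell. F (x $ 2)"
proof -
  note [measurable] = assms(2)
  have "AE p in unit_lborel \<Otimes>\<^sub>M unit_lborel. F (snd p)"
  proof (rule unit2.AE_pair_measure)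
    show "{p \<in> space (unit_lborel \<Otimes>\<^sub>M unit_lborel). F (snd p)} \<in> sets (unit_lborel \<Otimes>\<^sub>M unit_lborel)"
      by measurable
  qed (use assms(1) in simp)
  then show ?thesis
    unfolding cell_eq_distr by (subst AE_distr_iff) (simp_all, measurable)
qed

lemma measurable_vec2_slice [measurable]:
  assumes [measurable]: "f \<in> borel_measurable N" "g \<in> borel_measurable N"
  shows "(\<lambda>x. vec2 (f x, g x)) \<in> borel_measurable N"
  using measurable_compose[OF measurable_Pair[OF assms] measurable_vec2_pair] .

subsection \<open>Potentials of curl-free fields on the cell\<close>

text \<open>An integral operator in the first variable, applied on each horizontal line
  separately.\<close>

definition slice_op :: "(real \<Rightarrow> real \<Rightarrow> real) \<Rightarrow> (real^2 \<Rightarrow> real) \<Rightarrow> real^2 \<Rightarrow> real" where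
  "slice_op k G x = (LINT r|unit_lborel. k (x $ 1) r * G (vec2 (r, x $ 2)))"

lemma borel_measurable_nth2 [measurable]: "(\<lambda>x :: real^2. x $ i) \<in> borel_measurable borel"
  by (intro borel_measurable_continuous_onI continuous_intros)

context
  fixes k :: "real \<Rightarrow> real \<Rightarrow> real" and B :: real
  assumes k: "(\<lambda>p. k (fst p) (snd p)) \<in> borel_measurable (borel \<Otimes>\<^sub>M borel)"
    and kB: "\<And>s r. s \<in> {0<..<1} \<Longrightarrow> r \<in> {0<..<1} \<Longrightarrow> \<bar>k s r\<bar> \<le> B"
begin

lemma measurable_k2:
  assumes [measurable]: "f \<in> borel_measurable N" "g \<in> borel_measurable N"
  shows "(\<lambda>x. k (f x) (g x)) \<in> borel_measurable N"
  using measurable_compose[OF measurable_Pair[OF assms] k] by simp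

text \<open>By \<open>integral_unit_square_le\<close> on each line, the square is at most
  \<open>B^2\<close> times the integral of the squared \<open>G\<close> over that line, and this is
  integrable in the other variable. The bound on \<open>k\<close> is used inside the open square
  only; the edges are null.\<close>

lemma L2cell_slice_op:
  assumes G: "L2cell G"
  shows "L2cell (slice_op k G)"
proof -
  note [measurable] = L2cellD[OF G]
  note [measurable (raw)] = measurable_k2
  let ?w = "\<lambda>t. LINT r|unit_lborel. (G (vec2 (r, t)))\<^sup>2"
  have G2: "integrable (unit_lborel \<Otimes>\<^sub>M unit_lborel) (\<lambda>p. (G (vec2 p))\<^sup>2)"
    using G integrable_cell_vec2[of "\<lambda>x. (G x)\<^sup>2"] by (simp add: L2cell_def)
  have i: "AE t in unit_lborel. integrable unit_lborel (\<lambda>r. (G (vec2 (r, t)))\<^sup>2)"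
    and w: "integrable unit_lborel ?w"
    using unit2.AE_integrable_snd[of "\<lambda>s t. (G (vec2 (s, t)))\<^sup>2"]
      unit2.integrable_snd[of "\<lambda>s t. (G (vec2 (s, t)))\<^sup>2"] G2
    by (simp_all add: case_prod_unfold)
  have [measurable]: "?w \<in> borel_measurable borel" by measurable
  have m [measurable]: "slice_op k G \<in> borel_measurable borel"
    unfolding slice_op_def[abs_def] by measurable
  have i1: "integrable cell (\<lambda>x. B\<^sup>2 * ?w (x $ 2))"
    using integrable_unit2_snd[OF _ w] integrable_cell_vec2[of "\<lambda>x. ?w (x $ 2)"] by simp
  have i2: "AE x in cell. norm ((slice_op k G x)\<^sup>2) \<le> norm (B\<^sup>2 * ?w (x $ 2))"
  proof -
    have "AE x in cell. integrable unit_lborel (\<lambda>r. (G (vec2 (r, x $ 2)))\<^sup>2)"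
      by (rule AE_cell_snd[OF i]) measurable
    with AE_cell show ?thesis
    proof eventually_elim
      case (elim x)
      let ?f = "\<lambda>r. k (x $ 1) r * G (vec2 (r, x $ 2))"
      have le: "AE r in unit_lborel. (?f r)\<^sup>2 \<le> B\<^sup>2 * (G (vec2 (r, x $ 2)))\<^sup>2"
        using AE_unit
      proof eventually_elim
        case (elim r)
        then have "\<bar>k (x $ 1) r\<bar>\<^sup>2 \<le> B\<^sup>2"
          using kB[of "x $ 1" r] \<open>0 < x $ 1 \<and> _\<close> by (intro power_mono) auto
        then show ?case by (simp add: power_mult_distrib mult_right_mono)
      qed
      have fi: "integrable unit_lborel (\<lambda>r. (?f r)\<^sup>2)"
        by (rule Bochner_Integration.integrable_bound[where f = "\<lambda>r. B\<^sup>2 * (G (vec2 (r, x $ 2)))\<^sup>2"])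
          (use elim le in auto)
      have "(slice_op k G x)\<^sup>2 \<le> (LINT r|unit_lborel. (?f r)\<^sup>2)"
        unfolding slice_op_def by (rule integral_unit_square_le(2)[OF _ fi]) measurable
      also have "\<dots> \<le> (LINT r|unit_lborel. B\<^sup>2 * (G (vec2 (r, x $ 2)))\<^sup>2)"
        by (rule integral_mono_AE[OF fi _ le]) (use elim in simp)
      finally show ?case by simp
    qed
  qed
  have "integrable cell (\<lambda>x. (slice_op k G x)\<^sup>2)"
    by (rule Bochner_Integration.integrable_bound[OF i1 _ i2]) measurable
  then show ?thesis by (simp add: L2cell_def)
qed

text \<open>The adjoint acts on \<open>\<xi>\<close> through the transposed kernel. Weak derivatives
  of a slice operator thereby become computations with smooth functions on lines.\<close>

lemma slice_op_fubini:
  assumes G: "L2cell G" and \<xi>: "continuous_on UNIV \<xi>"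
  shows "(LINT x|cell. slice_op k G x * \<xi> x)
    = (LINT x|cell. G x * (LINT s|unit_lborel. k s (x $ 1) * \<xi> (vec2 (s, x $ 2))))"
proof -
  note [measurable] = L2cellD[OF G] borel_measurable_continuous_onI[OF \<xi>]
  note [measurable (raw)] = measurable_k2
  let ?K = "\<lambda>x :: real^2. LINT s|unit_lborel. k s (x $ 1) * \<xi> (vec2 (s, x $ 2))"
  obtain C where C: "0 \<le> C" "\<And>x. x \<in> Q \<Longrightarrow> \<bar>\<xi> x\<bar> \<le> C" using bounded_on_Q[OF \<xi>] by blast
  have B: "0 \<le> B" using kB[of "1/2" "1/2"] by simp
  have L\<xi>: "L2cell \<xi>" by (rule L2cell_continuous[OF \<xi>])
  have [measurable]: "slice_op k G \<in> borel_measurable borel"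
    by (rule L2cellD[OF L2cell_slice_op[OF G]])
  have KB: "\<bar>?K x\<bar> \<le> B * C" if x: "0 < x $ 1 \<and> x $ 1 < 1 \<and> 0 < x $ 2 \<and> x $ 2 < 1" for x
  proof -
    have le: "AE s in unit_lborel. \<bar>k s (x $ 1) * \<xi> (vec2 (s, x $ 2))\<bar> \<le> B * C"
      using AE_unit
    proof eventually_elim
      case (elim s)
      then have "\<bar>\<xi> (vec2 (s, x $ 2))\<bar> \<le> C" using x by (intro C) (auto simp: mem_Q)
      then show ?case unfolding abs_mult using elim x B kB[of s "x $ 1"] by (intro mult_mono) auto
    qed
    have "\<bar>?K x\<bar> \<le> (LINT s|unit_lborel. \<bar>k s (x $ 1) * \<xi> (vec2 (s, x $ 2))\<bar>)"
      by (rule integral_abs_bound)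
    also have "\<dots> \<le> (LINT s|unit_lborel. B * C)"
    proof (rule integral_mono_AE[OF _ _ le])
      show "integrable unit_lborel (\<lambda>s. \<bar>k s (x $ 1) * \<xi> (vec2 (s, x $ 2))\<bar>)"
        by (rule unit.integrable_const_bound[where B = "B * C"]) (use le in auto)
    qed simp
    finally show ?thesis by simp
  qed
  have mK [measurable]: "?K \<in> borel_measurable borel" by measurable
  have LK: "L2cell ?K"
    unfolding L2cell_def
  proof (intro conjI mK cell.integrable_const_bound[where B = "(B * C)\<^sup>2"])
    show "AE x in cell. norm ((?K x)\<^sup>2) \<le> (B * C)\<^sup>2"
      using AE_cell
    proof eventually_elim
      case (elim x)
      have "\<bar>?K x\<bar>\<^sup>2 \<le> (B * C)\<^sup>2" by (intro power_mono KB elim) simp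
      then show ?case by simp
    qed
  qed measurable
  have Gi: "integrable (unit_lborel \<Otimes>\<^sub>M unit_lborel) (\<lambda>p. G (vec2 p))"
    using L2cell_integrable[OF G] integrable_cell_vec2[of G] by simp
  have AEi: "AE t in unit_lborel. integrable unit_lborel (\<lambda>r. G (vec2 (r, t)))"
    using unit2.AE_integrable_snd[of "\<lambda>s t. G (vec2 (s, t))"] Gi by (simp add: case_prod_unfold)
  have "(LINT x|cell. slice_op k G x * \<xi> x)
      = (LINT t|unit_lborel. LINT s|unit_lborel. slice_op k G (vec2 (s, t)) * \<xi> (vec2 (s, t)))"
    by (rule integral_cell_snd[OF L2cell_mult_integrable[OF L2cell_slice_op[OF G] L\<xi>]]) measurable
  also have "\<dots> = (LINT t|unit_lborel. LINT r|unit_lborel. G (vec2 (r, t)) * ?K (vec2 (r, t)))"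
  proof (rule integral_cong_AE)
    show "AE t in unit_lborel. (LINT s|unit_lborel. slice_op k G (vec2 (s, t)) * \<xi> (vec2 (s, t)))
        = (LINT r|unit_lborel. G (vec2 (r, t)) * ?K (vec2 (r, t)))"
      using AEi AE_unit
    proof eventually_elim
      case (elim t)
      let ?f = "\<lambda>s r. k s r * G (vec2 (r, t)) * \<xi> (vec2 (s, t))"
      have "integrable (unit_lborel \<Otimes>\<^sub>M unit_lborel) (case_prod ?f)"
      proof (rule Bochner_Integration.integrable_bound)
        show "integrable (unit_lborel \<Otimes>\<^sub>M unit_lborel) (\<lambda>p. B * C * G (vec2 (snd p, t)))"
          using integrable_unit2_snd[OF _ elim(1)] by simp
        show "AE p in unit_lborel \<Otimes>\<^sub>M unit_lborel. norm (case_prod ?f p) \<le> norm (B * C * G (vec2 (snd p, t)))"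
          using AE_unit2
        proof eventually_elim
          case (elim p)
          have "\<bar>\<xi> (vec2 (fst p, t))\<bar> \<le> C" using elim \<open>0 < t \<and> t < 1\<close> by (intro C) (auto simp: mem_Q)
          moreover have "\<bar>k (fst p) (snd p)\<bar> \<le> B" using elim by (intro kB) auto
          ultimately have "\<bar>k (fst p) (snd p)\<bar> * \<bar>\<xi> (vec2 (fst p, t))\<bar> * \<bar>G (vec2 (snd p, t))\<bar> \<le> B * C * \<bar>G (vec2 (snd p, t))\<bar>"
            using B by (intro mult_mono mult_nonneg_nonneg) auto
          then show ?case using B C(1) by (simp add: case_prod_unfold abs_mult mult.assoc mult.left_commute mult.commute)
        qed
      qed measurable
      from unit2.Fubini_integral[OF this]
      have "(LINT s|unit_lborel. LINT r|unit_lborel. ?f s r) = (LINT r|unit_lborel. LINT s|unit_lborel. ?f s r)" by simp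
      moreover have a: "(LINT r|unit_lborel. ?f s r) = slice_op k G (vec2 (s, t)) * \<xi> (vec2 (s, t))" for s
        by (simp add: slice_op_def)
      moreover have b: "(LINT s|unit_lborel. ?f s r) = G (vec2 (r, t)) * ?K (vec2 (r, t))" for r
      proof -
        have "?f s r = G (vec2 (r, t)) * (k s r * \<xi> (vec2 (s, t)))" for s by simp
        then show ?thesis unfolding vec2_nth fst_conv snd_conv by (simp only: integral_mult_right_zero)
      qed
      ultimately show ?case by (simp only: a b)
    qed
  qed measurable
  also have "\<dots> = (LINT x|cell. G x * ?K x)"
    by (rule integral_cell_snd[OF L2cell_mult_integrable[OF G LK], symmetric]) measurable
  finally show ?thesis .
qed

end

lemma avg_avg_const:
  assumes "smooth \<psi>"
  shows "avg 2 (avg 1 \<psi>) x = avg 2 (avg 1 \<psi>) y"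
proof -
  let ?a = "avg 2 (avg 1 \<psi>)"
  have 1: "?a (x + r *\<^sub>R axis 1 1) = ?a x" for x r
  proof -
    have "avg 1 \<psi> (x + r *\<^sub>R axis 1 1 + v) = avg 1 \<psi> (x + v)" for v
      using avg_shift[of 1 \<psi> "x + v" r] by (simp add: algebra_simps)
    then show ?thesis by (simp add: avg_def[of 2] axis_def[of 1])
  qed
  have "?a x = ?a 0" for x
  proof -
    have "x = 0 + x $ 1 *\<^sub>R axis 1 1 + x $ 2 *\<^sub>R axis 2 1"
      by (simp add: vec_eq_iff forall_2 axis_def)
    then show ?thesis by (metis 1 avg_shift)
  qed
  then show ?thesis by metis
qed

context
  fixes G1 G2 :: "real^2 \<Rightarrow> real"
  assumes G1: "L2cell G1" and G2: "L2cell G2"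
    and G1_mean: "(LINT x|cell. G1 x) = 0" and G2_mean: "(LINT x|cell. G2 x) = 0"
    and curl: "\<And>\<psi>. test_fun \<psi> \<Longrightarrow>
      (LINT x|cell. G1 x * partial 2 \<psi> x) = (LINT x|cell. G2 x * partial 1 \<psi> x)"
begin

text \<open>
  The field \<open>(G1, G2)\<close> is curl-free in the weak sense. Its potential is
  \<open>\<phi>(s, t) = \<integral>\<^sub>0\<^sup>s G1(r, t) dr + \<integral>\<^sub>0\<^sup>1 r G1(r, t) dr + \<integral>\<^sub>0\<^sup>t \<integral>\<^sub>0\<^sup>1 G2(a, r) da dr\<close>;
  the first two terms form \<open>slice_op pot_kernel G1\<close> and the third is \<open>pot2\<close>.
\<close>

lemma line_mean_zero:
  assumes \<xi>: "continuous_on UNIV \<xi>"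
  shows "(LINT x|cell. G1 x * (LINT s|unit_lborel. \<xi> (vec2 (s, x $ 2)))) = 0"
proof -
  let ?m = "slice_op (\<lambda>s r. 1) G1"
  have fub: "(LINT x|cell. ?m x * \<xi> x) = (LINT x|cell. G1 x * (LINT s|unit_lborel. \<xi> (vec2 (s, x $ 2))))"
    if "continuous_on UNIV \<xi>" for \<xi>
    using slice_op_fubini[of "\<lambda>s r. 1" 1, OF _ _ G1 that] by simp
  have "AE x in cell. ?m x = 0"
  proof (rule L2cell_eq_0)
    show "L2cell ?m" using L2cell_slice_op[of "\<lambda>s r. 1" 1, OF _ _ G1] by simp
    fix \<psi> assume t: "test_fun \<psi>"
    then have s: "smooth \<psi>" by (simp add: test_fun_iff)
    \<comment> \<open>\<open>?\<eta>\<close> depends on the second coordinate only, and up to its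
      mean \<open>c0\<close> it is the second derivative \<open>partial 2\<close> of the test
      function \<open>nprim 2 ?\<eta>\<close>. Since \<open>partial 1\<close> of that function is
      zero, the curl condition loses its \<open>G2\<close> side; \<open>c0\<close> is removed by the
      zero mean of \<open>G1\<close>.\<close>
    let ?\<eta> = "avg 1 \<psi>"
    define c0 where "c0 = avg 2 ?\<eta> 0"
    have s\<eta>: "smooth ?\<eta>" by (rule smooth_avg[OF s])
    have c: "avg 2 ?\<eta> x = c0" for x unfolding c0_def by (rule avg_avg_const[OF s])
    have p1: "partial 1 (nprim 2 ?\<eta>) x = 0" for x
    proof -
      have "partial 1 ?\<eta> = (\<lambda>x. 0)" by (simp add: fun_eq_iff avg_partial(2)[OF s])
      moreover have "nprim 2 (\<lambda>x. 0) x = 0" by (simp add: nprim_def prim_def avg_def)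
      ultimately show ?thesis by (simp add: nprim_partial[OF s\<eta>])
    qed
    have p2: "partial 2 (nprim 2 ?\<eta>) x = ?\<eta> x - c0" for x
      by (simp add: nprim_partial[OF s\<eta>] c)
    have "(LINT x|cell. G1 x * (?\<eta> x - c0)) = 0"
      using curl[OF test_fun_nprim[OF test_fun_avg[OF t]], of 2 1] by (simp add: p1 p2)
    moreover have "(LINT x|cell. G1 x * (?\<eta> x - c0)) = (LINT x|cell. G1 x * ?\<eta> x) - c0 * (LINT x|cell. G1 x)"
      using L2cell_mult_integrable[OF G1 L2cell_continuous[OF smooth_continuous[OF s\<eta>]]] L2cell_integrable[OF G1]
      by (simp add: right_diff_distrib)
    ultimately have "(LINT x|cell. G1 x * ?\<eta> x) = 0" using G1_mean by simp
    moreover have "(LINT s|unit_lborel. \<psi> (vec2 (s, x $ 2))) = ?\<eta> x" for x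
      using integral_unit_avg[OF smooth_continuous[OF s], of "x $ 2" "x $ 1"] by simp
    ultimately show "(LINT x|cell. ?m x * \<psi> x) = 0"
      using fub[OF smooth_continuous[OF s]] by simp
  qed
  then have "(LINT x|cell. ?m x * \<xi> x) = (LINT x|cell. 0)"
  proof (intro integral_cong_AE)
    have "L2cell ?m" using L2cell_slice_op[of "\<lambda>s r. 1" 1, OF _ _ G1] by simp
    note [measurable] = L2cellD[OF this] borel_measurable_continuous_onI[OF \<xi>]
    show "(\<lambda>x. ?m x * \<xi> x) \<in> borel_measurable cell" by measurable
  qed (auto elim: eventually_mono)
  with fub[OF \<xi>] show ?thesis by simp
qed

text \<open>The summand \<open>r\<close> makes the integral over \<open>s\<close> equal to one, so
  that the resulting function has the same line integrals as \<open>G1\<close>, which vanish almost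
  everywhere. On the dual side it replaces \<open>prim 1\<close> by the periodic
  \<open>nprim 1\<close>.\<close>

definition pot_kernel :: "real \<Rightarrow> real \<Rightarrow> real" where
  "pot_kernel s r = (if r < s then 1 else 0) + r"

text \<open>The iterated integral of \<open>G2\<close> over the strip below \<open>x\<close>,
  written as one integral over the cell; it depends on \<open>x $ 2\<close> only.\<close>

definition pot2 :: "real^2 \<Rightarrow> real" where
  "pot2 x = (LINT y|cell. (if y $ 2 < x $ 2 then G2 y else 0))"

lemma pot_kernel_simps:
  "(\<lambda>p. pot_kernel (fst p) (snd p)) \<in> borel_measurable (borel \<Otimes>\<^sub>M borel)"
  "s \<in> {0<..<1} \<Longrightarrow> r \<in> {0<..<1} \<Longrightarrow> \<bar>pot_kernel s r\<bar> \<le> 2"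
  by (auto simp: pot_kernel_def)

lemma pot_kernel_integral:
  assumes "continuous_on UNIV \<xi>" "0 \<le> r" "r \<le> 1"
  shows "(LINT s|unit_lborel. pot_kernel s r * \<xi> (vec2 (s, t)))
    = (LINT s|unit_lborel. (if r < s then \<xi> (vec2 (s, t)) else 0)) + r * avg 1 \<xi> (vec2 (r, t))"
proof -
  have c: "continuous_on UNIV (\<lambda>s. \<xi> (vec2 (s, t)))"
    by (intro continuous_vec2_comp[OF assms(1)] continuous_intros)
  note [measurable] = borel_measurable_continuous_onI[OF c]
  have i: "integrable unit_lborel (\<lambda>s. \<xi> (vec2 (s, t)))" by (rule integral_unit_eq(1)[OF c])
  have "integrable unit_lborel (\<lambda>s. if r < s then \<xi> (vec2 (s, t)) else 0)"
    by (rule Bochner_Integration.integrable_bound[OF i]) simp_all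
  moreover have "pot_kernel s r * \<xi> (vec2 (s, t)) = (if r < s then \<xi> (vec2 (s, t)) else 0) + r * \<xi> (vec2 (s, t))" for s
    by (simp add: pot_kernel_def distrib_right)
  ultimately show ?thesis
    using i by (simp add: integral_unit_avg[OF assms(1), of t r])
qed

lemma pot1_partial:
  assumes t: "test_fun \<psi>"
  shows "(LINT x|cell. slice_op pot_kernel G1 x * partial 1 \<psi> x) = - (LINT x|cell. G1 x * \<psi> x)"
    and "(LINT x|cell. slice_op pot_kernel G1 x * partial 2 \<psi> x)
      = - (LINT x|cell. G2 x * \<psi> x) + (LINT x|cell. G2 x * avg 1 \<psi> x)"
proof -
  have s: "smooth \<psi>" using t by (simp add: test_fun_iff)
  note c = smooth_continuous[OF smooth_partial[OF s], of UNIV]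
  note [measurable] = L2cellD[OF G1] L2cellD[OF G2]
  have int: "integrable cell (\<lambda>x. G x * f x)" if "L2cell G" "continuous_on UNIV f" for G f
    by (rule L2cell_mult_integrable[OF that(1) L2cell_continuous[OF that(2)]])
  have eq: "(LINT x|cell. slice_op pot_kernel G1 x * partial a \<psi> x) = (LINT x|cell. G1 x * f x)"
    if f: "continuous_on UNIV f" and "\<And>r t. 0 \<le> r \<Longrightarrow> r \<le> 1 \<Longrightarrow>
      (LINT s|unit_lborel. pot_kernel s r * partial a \<psi> (vec2 (s, t))) = f (vec2 (r, t))" for a f
  proof -
    have m [measurable]: "(\<lambda>x :: real^2. LINT s|unit_lborel. pot_kernel s (x $ 1) * partial a \<psi> (vec2 (s, x $ 2)))
        \<in> borel_measurable borel"
    proof -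
      note [measurable] = borel_measurable_continuous_onI[OF c]
      show ?thesis unfolding pot_kernel_def by measurable
    qed
    have "AE x in cell. G1 x * (LINT s|unit_lborel. pot_kernel s (x $ 1) * partial a \<psi> (vec2 (s, x $ 2))) = G1 x * f x"
      using AE_cell by eventually_elim (simp add: that(2))
    moreover have [measurable]: "f \<in> borel_measurable borel" by (rule borel_measurable_continuous_onI[OF f])
    ultimately have "(LINT x|cell. G1 x * (LINT s|unit_lborel. pot_kernel s (x $ 1) * partial a \<psi> (vec2 (s, x $ 2))))
        = (LINT x|cell. G1 x * f x)"
      by (intro integral_cong_AE borel_measurable_times) simp_all
    then show ?thesis
      using slice_op_fubini[of pot_kernel 2, OF pot_kernel_simps G1 c] by simp
  qed
  have c1: "continuous_on UNIV (\<lambda>x. \<psi> (vec2 (1, x $ 2)))"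
    by (intro continuous_vec2_comp[OF smooth_continuous[OF s]] continuous_intros)
  have c\<psi>: "continuous_on UNIV \<psi>" by (rule smooth_continuous[OF s])
  have "(LINT x|cell. slice_op pot_kernel G1 x * partial 1 \<psi> x)
      = (LINT x|cell. G1 x * (\<psi> (vec2 (1, x $ 2)) - \<psi> x))"
    by (rule eq) (use c1 c\<psi> in \<open>auto intro!: continuous_intros
        simp: pot_kernel_integral[OF c] integral_unit_tail_partial(1)[OF s] avg_partial_same[OF t]\<close>)
  also have "\<dots> = (LINT x|cell. G1 x * \<psi> (vec2 (1, x $ 2))) - (LINT x|cell. G1 x * \<psi> x)"
    using int[OF G1 c1] int[OF G1 c\<psi>] by (simp add: right_diff_distrib)
  \<comment> \<open>The boundary value at \<open>s = 1\<close> is a function of the second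
    coordinate alone, against which \<open>G1\<close> integrates to zero by
    \<open>line_mean_zero\<close>.\<close>
  also have "(LINT x|cell. G1 x * \<psi> (vec2 (1, x $ 2))) = 0"
    using line_mean_zero[OF c1] by simp
  finally show "(LINT x|cell. slice_op pot_kernel G1 x * partial 1 \<psi> x) = - (LINT x|cell. G1 x * \<psi> x)"
    by simp
  let ?\<xi> = "partial 2 \<psi>"
  have s2: "smooth ?\<xi>" by (rule smooth_partial[OF s])
  have ca: "continuous_on UNIV (avg 1 ?\<xi>)" and cn: "continuous_on UNIV (nprim 1 ?\<xi>)"
    and ca': "continuous_on UNIV (avg 1 \<psi>)"
    by (intro smooth_continuous smooth_avg smooth_nprim s2 s)+
  have "(LINT x|cell. slice_op pot_kernel G1 x * partial 2 \<psi> x)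
      = (LINT x|cell. G1 x * (avg 1 ?\<xi> x - nprim 1 ?\<xi> x))"
    by (rule eq) (use ca cn in \<open>auto intro!: continuous_intros
        simp: pot_kernel_integral[OF c] integral_unit_tail_fst[OF s2] nprim_eq[OF s2]\<close>)
  also have "\<dots> = (LINT x|cell. G1 x * avg 1 ?\<xi> x) - (LINT x|cell. G1 x * nprim 1 ?\<xi> x)"
    using int[OF G1 ca] int[OF G1 cn] by (simp add: right_diff_distrib)
  also have "(LINT x|cell. G1 x * avg 1 ?\<xi> x) = 0"
  proof -
    have "(LINT s|unit_lborel. ?\<xi> (vec2 (s, x $ 2))) = avg 1 ?\<xi> x" for x
      using integral_unit_avg[OF c, of 2 "x $ 2" "x $ 1"] by simp
    with line_mean_zero[OF c, of 2] show ?thesis by simp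
  qed
  \<comment> \<open>\<open>partial 2\<close> commutes with \<open>nprim 1\<close>, so the second
    factor is the derivative of the test function \<open>nprim 1 \<psi>\<close> and the curl
    condition exchanges \<open>G1\<close> for \<open>G2\<close>.\<close>
  also have "(LINT x|cell. G1 x * nprim 1 ?\<xi> x) = (LINT x|cell. G1 x * partial 2 (nprim 1 \<psi>) x)"
    by (simp add: nprim_partial[OF s])
  also have "\<dots> = (LINT x|cell. G2 x * partial 1 (nprim 1 \<psi>) x)"
    by (rule curl[OF test_fun_nprim[OF t]])
  also have "\<dots> = (LINT x|cell. G2 x * (\<psi> x - avg 1 \<psi> x))"
    by (simp add: nprim_partial[OF s])
  also have "\<dots> = (LINT x|cell. G2 x * \<psi> x) - (LINT x|cell. G2 x * avg 1 \<psi> x)"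
    using int[OF G2 c\<psi>] int[OF G2 ca'] by (simp add: right_diff_distrib)
  finally show "(LINT x|cell. slice_op pot_kernel G1 x * partial 2 \<psi> x)
      = - (LINT x|cell. G2 x * \<psi> x) + (LINT x|cell. G2 x * avg 1 \<psi> x)"
    by simp
qed

lemma L2cell_pot2: "L2cell pot2"
proof -
  note [measurable] = L2cellD[OF G2]
  have [measurable]: "pot2 \<in> borel_measurable borel"
    unfolding pot2_def[abs_def] by measurable
  have "\<bar>pot2 x\<bar> \<le> (LINT y|cell. \<bar>G2 y\<bar>)" for x
  proof -
    have i: "integrable cell (\<lambda>y. if y $ 2 < x $ 2 then G2 y else 0)"
      by (rule Bochner_Integration.integrable_bound[OF L2cell_integrable[OF G2]]) simp_all
    have "\<bar>pot2 x\<bar> \<le> (LINT y|cell. \<bar>if y $ 2 < x $ 2 then G2 y else 0\<bar>)"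
      unfolding pot2_def by (rule integral_abs_bound)
    also have "\<dots> \<le> (LINT y|cell. \<bar>G2 y\<bar>)"
      using i L2cell_integrable[OF G2] by (intro integral_mono) auto
    finally show ?thesis .
  qed
  then have "(pot2 x)\<^sup>2 \<le> (LINT y|cell. \<bar>G2 y\<bar>)\<^sup>2" for x
    using power_mono[of "\<bar>pot2 x\<bar>" "LINT y|cell. \<bar>G2 y\<bar>" 2] by simp
  then have "integrable cell (\<lambda>x. (pot2 x)\<^sup>2)"
    by (intro cell.integrable_const_bound[where B = "(LINT y|cell. \<bar>G2 y\<bar>)\<^sup>2"]) auto
  then show ?thesis by (simp add: L2cell_def)
qed

lemma pot2_inner:
  assumes \<xi>: "continuous_on UNIV \<xi>"
  shows "(LINT x|cell. pot2 x * \<xi> x) = (LINT y|cell. G2 y * (LINT x|cell. (if y $ 2 < x $ 2 then \<xi> x else 0)))"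
proof -
  note [measurable] = L2cellD[OF G2] borel_measurable_continuous_onI[OF \<xi>]
  let ?f = "\<lambda>x y :: real^2. (if y $ 2 < x $ 2 then G2 y * \<xi> x else 0)"
  have iG: "integrable cell G2" by (rule L2cell_integrable[OF G2])
  have i\<xi>: "integrable cell \<xi>" by (rule integrable_cell_continuous[OF \<xi>])
  have i0: "integrable (cell \<Otimes>\<^sub>M cell) (\<lambda>(x, y). \<xi> x * G2 y)"
    by (rule cell2.Fubini_integrable) (use iG i\<xi> in \<open>auto simp: abs_mult\<close>)
  have "integrable (cell \<Otimes>\<^sub>M cell) (case_prod ?f)"
    by (rule Bochner_Integration.integrable_bound[OF i0]) (measurable, auto simp: abs_mult)
  from cell2.Fubini_integral[OF this]
  have "(LINT y|cell. LINT x|cell. ?f x y) = (LINT x|cell. LINT y|cell. ?f x y)" .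
  moreover have "(LINT x|cell. ?f x y) = G2 y * (LINT x|cell. (if y $ 2 < x $ 2 then \<xi> x else 0))" for y
  proof -
    have "?f x y = G2 y * (if y $ 2 < x $ 2 then \<xi> x else 0)" for x by simp
    then show ?thesis by (simp only: integral_mult_right_zero)
  qed
  moreover have "(LINT y|cell. ?f x y) = pot2 x * \<xi> x" for x
  proof -
    have "?f x y = (if y $ 2 < x $ 2 then G2 y else 0) * \<xi> x" for y by simp
    then show ?thesis by (simp only: integral_mult_left_zero pot2_def)
  qed
  ultimately show ?thesis by simp
qed

text \<open>In the first direction the line integral of a periodic derivative vanishes. In the
  second, the boundary value \<open>?a\<close> is constant and meets the zero mean of
  \<open>G2\<close>; the remaining term cancels the surplus average in
  \<open>pot1_partial\<close>.\<close>

lemma pot2_partial: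
  assumes t: "test_fun \<psi>"
  shows "(LINT x|cell. pot2 x * partial 1 \<psi> x) = 0"
    and "(LINT x|cell. pot2 x * partial 2 \<psi> x) = - (LINT x|cell. G2 x * avg 1 \<psi> x)"
proof -
  have s: "smooth \<psi>" using t by (simp add: test_fun_iff)
  note c = smooth_continuous[OF smooth_partial[OF s], of UNIV]
  note [measurable] = L2cellD[OF G2] borel_measurable_continuous_onI[OF c]
  have i: "integrable cell (\<lambda>x. if r < x $ 2 then partial a \<psi> x else 0)" for a r
    by (rule Bochner_Integration.integrable_bound[OF integrable_cell_continuous[OF c, of a]]) simp_all
  have "(LINT x|cell. (if r < x $ 2 then partial 1 \<psi> x else 0)) = 0" for r
  proof -
    have "(LINT u|unit_lborel. (if r < t then partial 1 \<psi> (vec2 (u, t)) else 0)) = 0" for t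
      using integral_unit_avg[OF c, of 1 t 0] by (cases "r < t") (simp_all add: avg_partial_same[OF t])
    then show ?thesis using integral_cell_snd[OF i[of r 1]] by simp
  qed
  then show "(LINT x|cell. pot2 x * partial 1 \<psi> x) = 0"
    by (simp add: pot2_inner[OF c])
  have ca: "continuous_on UNIV (avg 1 \<psi>)" by (intro smooth_continuous smooth_avg s)
  note [measurable] = borel_measurable_continuous_onI[OF ca]
  let ?a = "avg 1 \<psi> (vec2 (0, 1))"
  have "(LINT x|cell. (if y $ 2 < x $ 2 then partial 2 \<psi> x else 0)) = ?a - avg 1 \<psi> y"
    if y: "0 \<le> y $ 2" "y $ 2 \<le> 1" for y
  proof -
    have cl: "continuous_on UNIV (\<lambda>s. \<psi> (vec2 (s, t)))" for t
      by (intro continuous_vec2_comp[OF smooth_continuous[OF s]] continuous_intros)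
    have "(LINT x|cell. (if y $ 2 < x $ 2 then partial 2 \<psi> x else 0))
        = (LINT s|unit_lborel. \<psi> (vec2 (s, 1)) - \<psi> (vec2 (s, y $ 2)))"
      using integral_cell_fst[OF i[of "y $ 2" 2]] y by (simp add: integral_unit_tail_partial(2)[OF s])
    also have "\<dots> = ?a - avg 1 \<psi> (vec2 (y $ 1, y $ 2))"
      using integral_unit_eq(1)[OF cl]
      by (simp add: integral_unit_avg[OF smooth_continuous[OF s], of 1 0]
          integral_unit_avg[OF smooth_continuous[OF s], of "y $ 2" "y $ 1"])
    finally show ?thesis by simp
  qed
  note inner = this
  have "AE y in cell. G2 y * (LINT x|cell. (if y $ 2 < x $ 2 then partial 2 \<psi> x else 0)) = G2 y * (?a - avg 1 \<psi> y)"
    using AE_cell by eventually_elim (simp add: inner)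
  then have "(LINT x|cell. pot2 x * partial 2 \<psi> x) = (LINT y|cell. G2 y * (?a - avg 1 \<psi> y))"
    unfolding pot2_inner[OF c] by (intro integral_cong_AE) (measurable)
  also have "\<dots> = ?a * (LINT y|cell. G2 y) - (LINT y|cell. G2 y * avg 1 \<psi> y)"
    using L2cell_mult_integrable[OF G2 L2cell_continuous[OF ca]] L2cell_integrable[OF G2]
    by (simp add: right_diff_distrib)
  finally show "(LINT x|cell. pot2 x * partial 2 \<psi> x) = - (LINT x|cell. G2 x * avg 1 \<psi> x)"
    by (simp add: G2_mean)
qed

lemma ex_potential_cell:
  "\<exists>\<phi>. L2cell \<phi> \<and> (\<forall>\<psi>. test_fun \<psi> \<longrightarrow>
     (LINT x|cell. \<phi> x * partial 1 \<psi> x) = - (LINT x|cell. G1 x * \<psi> x) \<and>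
     (LINT x|cell. \<phi> x * partial 2 \<psi> x) = - (LINT x|cell. G2 x * \<psi> x))"
proof (intro exI conjI allI impI)
  have L1: "L2cell (slice_op pot_kernel G1)"
    by (rule L2cell_slice_op[OF pot_kernel_simps G1])
  let ?\<phi> = "\<lambda>x. slice_op pot_kernel G1 x + pot2 x"
  show "L2cell ?\<phi>" by (intro L2cell_add L1 L2cell_pot2)
  fix \<psi> assume t: "test_fun \<psi>"
  then have s: "smooth \<psi>" by (simp add: test_fun_iff)
  have L: "L2cell (partial a \<psi>)" for a
    by (intro L2cell_continuous smooth_continuous smooth_partial s)
  have "(LINT x|cell. ?\<phi> x * partial a \<psi> x)
      = (LINT x|cell. slice_op pot_kernel G1 x * partial a \<psi> x) + (LINT x|cell. pot2 x * partial a \<psi> x)" for a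
    using L2cell_mult_integrable[OF L1 L] L2cell_mult_integrable[OF L2cell_pot2 L]
    by (simp add: distrib_right)
  then show "(LINT x|cell. ?\<phi> x * partial 1 \<psi> x) = - (LINT x|cell. G1 x * \<psi> x)"
    "(LINT x|cell. ?\<phi> x * partial 2 \<psi> x) = - (LINT x|cell. G2 x * \<psi> x)"
    by (simp_all add: pot1_partial[OF t] pot2_partial[OF t])
qed

end

subsection \<open>Periodic square-integrable fields\<close>

lemma Q_lebesgue [measurable]: "Q \<in> sets lebesgue"
  using Q_sets by simp

lemma set_integrable_Q_const: "set_integrable lebesgue Q (\<lambda>x. c :: 'b :: {banach, second_countable_topology})"
proof -
  have "emeasure lebesgue Q < \<infinity>"
    using lmeasurable_compact[OF compact_Q] by (simp add: fmeasurable_def)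
  then show ?thesis
    unfolding set_integrable_def by (intro integrable_scaleR_left integrable_real_indicator) auto
qed

lemma L2per_bound:
  fixes f :: "real^2 \<Rightarrow> 'b :: euclidean_space" and g :: "real^2 \<Rightarrow> 'c :: euclidean_space"
  assumes "L2per g" "periodic f" "f \<in> borel_measurable lebesgue" "\<And>x. norm (f x) \<le> C * norm (g x)"
  shows "L2per f"
  unfolding L2per_def
proof (intro conjI assms)
  have "set_integrable lebesgue Q (\<lambda>x. C\<^sup>2 * (norm (g x))\<^sup>2)"
    using assms(1) by (simp add: L2per_def)
  then show "set_integrable lebesgue Q (\<lambda>x. (norm (f x))\<^sup>2)"
  proof (rule set_integrable_bound)
    show "set_borel_measurable lebesgue Q (\<lambda>x. (norm (f x))\<^sup>2)"
      unfolding set_borel_measurable_def using assms(3) by measurable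
    show "AE x in lebesgue. x \<in> Q \<longrightarrow> norm ((norm (f x))\<^sup>2) \<le> norm (C\<^sup>2 * (norm (g x))\<^sup>2)"
    proof (intro AE_I2 impI)
      fix x
      have "(norm (f x))\<^sup>2 \<le> (C * norm (g x))\<^sup>2" by (intro power_mono assms(4)) simp
      then show "norm ((norm (f x))\<^sup>2) \<le> norm (C\<^sup>2 * (norm (g x))\<^sup>2)"
        by (simp add: power_mult_distrib)
    qed
  qed
qed

lemma L2per_add:
  fixes f g :: "real^2 \<Rightarrow> 'b :: euclidean_space"
  assumes f: "L2per f" and g: "L2per g"
  shows "L2per (\<lambda>x. f x + g x)"
  unfolding L2per_def
proof (intro conjI)
  show "periodic (\<lambda>x. f x + g x)" using f g by (simp add: L2per_def periodic_def)
  have [measurable]: "f \<in> borel_measurable lebesgue" "g \<in> borel_measurable lebesgue"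
    using f g by (auto simp: L2per_def)
  show "(\<lambda>x. f x + g x) \<in> borel_measurable lebesgue" by measurable
  have "set_integrable lebesgue Q (\<lambda>x. 2 * (norm (f x))\<^sup>2 + 2 * (norm (g x))\<^sup>2)"
    using f g by (intro set_integral_add(1)) (auto simp: L2per_def)
  then show "set_integrable lebesgue Q (\<lambda>x. (norm (f x + g x))\<^sup>2)"
  proof (rule set_integrable_bound)
    show "set_borel_measurable lebesgue Q (\<lambda>x. (norm (f x + g x))\<^sup>2)"
      unfolding set_borel_measurable_def by measurable
    show "AE x in lebesgue. x \<in> Q \<longrightarrow> norm ((norm (f x + g x))\<^sup>2) \<le> norm (2 * (norm (f x))\<^sup>2 + 2 * (norm (g x))\<^sup>2)"
    proof (intro AE_I2 impI)
      fix x
      have "(norm (f x + g x))\<^sup>2 \<le> (norm (f x) + norm (g x))\<^sup>2"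
        by (intro power_mono norm_triangle_ineq) simp
      also have "\<dots> \<le> 2 * (norm (f x))\<^sup>2 + 2 * (norm (g x))\<^sup>2"
        using two_abs_mult_le[of "norm (f x)" "norm (g x)"] by (simp add: power2_sum)
      finally show "norm ((norm (f x + g x))\<^sup>2) \<le> norm (2 * (norm (f x))\<^sup>2 + 2 * (norm (g x))\<^sup>2)"
        by simp
    qed
  qed
qed

lemma L2per_const: "L2per (\<lambda>x. c :: 'b :: euclidean_space)"
  using set_integrable_Q_const[of "(norm c)\<^sup>2"] by (simp add: L2per_def periodic_def)

lemma L2per_linear:
  fixes h :: "'b :: euclidean_space \<Rightarrow> 'c :: euclidean_space"
  assumes f: "L2per f" and h: "linear h"
  shows "L2per (\<lambda>x. h (f x))"
proof -
  obtain C where C: "\<And>x. norm (h x) \<le> C * norm x"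
    using linear_bounded[OF h] by blast
  show ?thesis
  proof (rule L2per_bound[OF f])
    show "periodic (\<lambda>x. h (f x))" using f by (simp add: L2per_def periodic_def)
    show "(\<lambda>x. h (f x)) \<in> borel_measurable lebesgue"
    proof (rule measurable_compose[where f = f and g = h and N = borel])
      show "f \<in> borel_measurable lebesgue" using f by (simp add: L2per_def)
      show "h \<in> borel_measurable borel"
        by (rule borel_measurable_continuous_onI[OF linear_continuous_on[OF h[unfolded linear_conv_bounded_linear]]])
    qed
  qed (rule C)
qed

lemma L2per_set_integrable:
  fixes f :: "real^2 \<Rightarrow> 'b :: euclidean_space"
  assumes "L2per f"
  shows "set_integrable lebesgue Q f"
proof -
  have [measurable]: "f \<in> borel_measurable lebesgue" using assms by (simp add: L2per_def)
  have "set_integrable lebesgue Q (\<lambda>x. 1 + (norm (f x))\<^sup>2)"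
    using assms set_integrable_Q_const[of "1::real"] by (intro set_integral_add(1)) (auto simp: L2per_def)
  then show ?thesis
  proof (rule set_integrable_bound)
    show "set_borel_measurable lebesgue Q f"
      unfolding set_borel_measurable_def by measurable
    show "AE x in lebesgue. x \<in> Q \<longrightarrow> norm (f x) \<le> norm (1 + (norm (f x))\<^sup>2)"
      using abs_mult_le[of 1 "norm (f _)"] by simp
  qed
qed

lemma L2per_mult_integrable:
  fixes f g :: "real^2 \<Rightarrow> 'b :: euclidean_space"
  assumes "L2per f" "L2per g"
  shows "set_integrable lebesgue Q (\<lambda>x. f x \<bullet> g x)"
proof -
  have [measurable]: "f \<in> borel_measurable lebesgue" "g \<in> borel_measurable lebesgue"
    using assms by (simp_all add: L2per_def)
  have "set_integrable lebesgue Q (\<lambda>x. (norm (f x))\<^sup>2 + (norm (g x))\<^sup>2)"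
    using assms by (intro set_integral_add(1)) (auto simp: L2per_def)
  then show ?thesis
  proof (rule set_integrable_bound)
    show "set_borel_measurable lebesgue Q (\<lambda>x. f x \<bullet> g x)"
      unfolding set_borel_measurable_def by measurable
    show "AE x in lebesgue. x \<in> Q \<longrightarrow> norm (f x \<bullet> g x) \<le> norm ((norm (f x))\<^sup>2 + (norm (g x))\<^sup>2)"
    proof (intro AE_I2 impI)
      fix x
      have "norm (f x \<bullet> g x) \<le> norm (f x) * norm (g x)"
        using Cauchy_Schwarz_ineq2[of "f x" "g x"] by simp
      also have "\<dots> \<le> (norm (f x))\<^sup>2 + (norm (g x))\<^sup>2"
        using abs_mult_le[of "norm (f x)" "norm (g x)"] by simp
      finally show "norm (f x \<bullet> g x) \<le> norm ((norm (f x))\<^sup>2 + (norm (g x))\<^sup>2)" by simp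
    qed
  qed
qed

lemma LINT_Q_linear:
  fixes h :: "'b :: euclidean_space \<Rightarrow> 'c :: euclidean_space"
  assumes f: "set_integrable lebesgue Q f" and h: "linear h"
  shows "(LINT x:Q|lebesgue. h (f x)) = h (LINT x:Q|lebesgue. f x)"
proof -
  have "bounded_linear h" using h by (simp add: linear_conv_bounded_linear)
  from integral_bounded_linear[OF this f[unfolded set_integrable_def]]
  show ?thesis by (simp add: set_lebesgue_integral_def linear_scale[OF h])
qed

lemma LINT_Q_const: "(LINT x:Q|lebesgue. c :: real) = c"
  using lint_Q_eq_cell(1)[of "\<lambda>x. c" "\<lambda>x. c"] by simp

lemma ex_L2cell_version:
  assumes "L2per f"
  obtains f' where "L2cell f'" "AE x in cell. f x = f' x"
proof -
  have m: "f \<in> borel_measurable lebesgue" using assms by (simp add: L2per_def)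
  obtain f' where f': "f' \<in> borel_measurable borel" "AE x in cell. f x = f' x"
    using ex_borel_version[OF m] by blast
  have "AE x in cell. (norm (f x))\<^sup>2 = (f' x)\<^sup>2" using f'(2) by eventually_elim simp
  from lint_Q_eq_cell(2)[OF _ _ this] m f' assms have "integrable cell (\<lambda>x. (f' x)\<^sup>2)"
    by (auto simp: L2per_def)
  with f' show thesis by (intro that) (auto simp: L2cell_def)
qed

lemma continuous_measurable_lebesgue:
  fixes f :: "real^2 \<Rightarrow> real"
  assumes "continuous_on UNIV f"
  shows "f \<in> borel_measurable lebesgue"
  using borel_measurable_continuous_onI[OF assms] by (intro measurable_completion) simp

lemma test_fun_continuous: "test_fun \<psi> \<Longrightarrow> continuous_on A \<psi>"
  by (simp add: test_fun_iff smooth_continuous)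

lemma LINT_Q_test:
  assumes f: "L2per f" and f': "L2cell f'" "AE x in cell. f x = f' x" and \<psi>: "continuous_on UNIV \<psi>"
  shows "(LINT x:Q|lebesgue. f x * \<psi> x) = (LINT x|cell. f' x * \<psi> x)"
    and "set_integrable lebesgue Q (\<lambda>x. f x * \<psi> x)"
proof -
  note [measurable] = L2cellD[OF f'(1)] borel_measurable_continuous_onI[OF \<psi>] continuous_measurable_lebesgue[OF \<psi>]
  have [measurable]: "f \<in> borel_measurable lebesgue" using f by (simp add: L2per_def)
  have eq: "AE x in cell. f x * \<psi> x = f' x * \<psi> x" using f'(2) by eventually_elim simp
  have m: "(\<lambda>x. f x * \<psi> x) \<in> borel_measurable lebesgue" "(\<lambda>x. f' x * \<psi> x) \<in> borel_measurable borel"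
    by measurable
  show "(LINT x:Q|lebesgue. f x * \<psi> x) = (LINT x|cell. f' x * \<psi> x)"
    by (rule lint_Q_eq_cell(1)[OF m eq])
  show "set_integrable lebesgue Q (\<lambda>x. f x * \<psi> x)"
    unfolding lint_Q_eq_cell(2)[OF m eq] by (rule L2cell_mult_integrable[OF f'(1) L2cell_continuous[OF \<psi>]])
qed

lemma L2per_test_integrable:
  fixes f \<psi> :: "real^2 \<Rightarrow> real"
  assumes "L2per f" "continuous_on UNIV \<psi>"
  shows "set_integrable lebesgue Q (\<lambda>x. f x * \<psi> x)"
  using ex_L2cell_version[OF assms(1)] LINT_Q_test(2)[OF assms(1) _ _ assms(2)] by metis

lemma linear_vec_nth: "linear (\<lambda>v :: real^'n. v $ a)"
  by (rule linearI) simp_all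

lemma L2per_nth:
  fixes g :: "real^2 \<Rightarrow> real^'n"
  shows "L2per g \<Longrightarrow> L2per (\<lambda>x. g x $ a)"
  by (rule L2per_linear[OF _ linear_vec_nth])

lemma test_fun_const: "test_fun (\<lambda>x. c)"
  by (simp add: test_fun_iff smooth_const periodic_def)

lemma integral_cell_partial:
  assumes t: "test_fun \<psi>"
  shows "(LINT x|cell. partial a \<psi> x) = 0"
proof -
  have c: "continuous_on UNIV (partial b \<psi>)" for b
    using t by (intro smooth_continuous smooth_partial) (simp add: test_fun_iff)
  have "(LINT x|cell. partial 1 \<psi> x) = 0"
  proof -
    have "(LINT s|unit_lborel. partial 1 \<psi> (vec2 (s, r))) = 0" for r
      using integral_unit_avg[OF c, of 1 r 0] by (simp add: avg_partial_same[OF t])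
    then show ?thesis
      using integral_cell_snd[OF integrable_cell_continuous[OF c] borel_measurable_continuous_onI[OF c], of 1] by simp
  qed
  moreover have "(LINT x|cell. partial 2 \<psi> x) = 0"
  proof -
    have "(LINT s|unit_lborel. partial 2 \<psi> (vec2 (r, s))) = avg 2 (partial 2 \<psi>) (vec2 (r, 0))" for r
    proof -
      have "continuous_on UNIV (\<lambda>s. partial 2 \<psi> (vec2 (r, s)))"
        by (intro continuous_vec2_comp[OF c] continuous_intros)
      from integral_unit_eq(2)[OF this] show ?thesis by (simp add: avg_def vec2_line)
    qed
    then show ?thesis
      using integral_cell_fst[OF integrable_cell_continuous[OF c] borel_measurable_continuous_onI[OF c], of 2]
      by (simp add: avg_partial_same[OF t])
  qed
  ultimately show ?thesis using exhaust_2[of a] by auto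
qed

lemma inner_gradient: "v \<bullet> (\<chi> a. partial a \<psi> x) = v $ 1 * partial 1 \<psi> x + v $ 2 * partial 2 \<psi> x"
  by (simp add: inner_vec_def sum_2)

lemma LINT_Q_gradient:
  assumes J: "L2per J" and t: "test_fun \<psi>"
    and J': "\<And>a. L2cell (J' a)" "\<And>a. AE x in cell. J x $ a = J' a x"
  shows "(LINT x:Q|lebesgue. J x \<bullet> (\<chi> a. partial a \<psi> x))
    = (LINT x|cell. J' 1 x * partial 1 \<psi> x + J' 2 x * partial 2 \<psi> x)"
proof -
  have c: "continuous_on UNIV (partial b \<psi>)" for b
    using t by (intro test_fun_continuous test_fun_partial)
  have "(LINT x:Q|lebesgue. J x \<bullet> (\<chi> a. partial a \<psi> x))
      = (LINT x:Q|lebesgue. J x $ 1 * partial 1 \<psi> x) + (LINT x:Q|lebesgue. J x $ 2 * partial 2 \<psi> x)"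
    unfolding inner_gradient
    by (intro set_integral_add(2) L2per_test_integrable L2per_nth J c)
  also have "\<dots> = (LINT x|cell. J' 1 x * partial 1 \<psi> x) + (LINT x|cell. J' 2 x * partial 2 \<psi> x)"
    by (simp add: LINT_Q_test(1)[OF L2per_nth[OF J] J' c])
  also have "\<dots> = (LINT x|cell. J' 1 x * partial 1 \<psi> x + J' 2 x * partial 2 \<psi> x)"
    using L2cell_mult_integrable[OF J'(1) L2cell_continuous[OF c]] by simp
  finally show ?thesis .
qed

lemma ex_L2cell_version_vec:
  fixes J :: "real^2 \<Rightarrow> real^2"
  assumes "L2per J"
  obtains J' where "\<And>a. L2cell (J' a)" "\<And>a. AE x in cell. J x $ a = J' a x"
proof -
  have "\<exists>f'. L2cell f' \<and> (AE x in cell. J x $ a = f' x)" for a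
    using ex_L2cell_version[OF L2per_nth[OF assms, of a]] by metis
  then show thesis using that by metis
qed

lemma div_curl:
  assumes J: "L2per J" "div_free J" and g: "H1per_with_gradient \<phi> g"
  shows "(LINT x:Q|lebesgue. J x \<bullet> g x) = 0"
proof -
  have gL: "L2per g" and \<phi>L: "L2per \<phi>" and w: "weak_gradient \<phi> g"
    using g by (auto simp: H1per_with_gradient_def)
  obtain J' where J': "\<And>a. L2cell (J' a)" "\<And>a. AE x in cell. J x $ a = J' a x"
    using ex_L2cell_version_vec[OF J(1)] by blast
  obtain g' where g': "\<And>a. L2cell (g' a)" "\<And>a. AE x in cell. g x $ a = g' a x"
    using ex_L2cell_version_vec[OF gL] by blast
  obtain \<phi>' where \<phi>': "L2cell \<phi>'" "AE x in cell. \<phi> x = \<phi>' x"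
    using ex_L2cell_version[OF \<phi>L] by blast
  have "(LINT x|cell. J' 1 x * g' 1 x + J' 2 x * g' 2 x) = 0"
  proof (rule div_curl_cell[OF J'(1) g'(1) \<phi>'(1)])
    fix \<psi> assume t: "test_fun \<psi>"
    then show "(LINT x|cell. J' 1 x * partial 1 \<psi> x + J' 2 x * partial 2 \<psi> x) = 0"
      using J(2) LINT_Q_gradient[OF J(1) t J'] by (simp add: div_free_def)
    fix a
    have c: "continuous_on UNIV (partial a \<psi>)" "continuous_on UNIV \<psi>"
      using t by (intro test_fun_continuous test_fun_partial; assumption)+
    show "(LINT x|cell. \<phi>' x * partial a \<psi> x) = - (LINT x|cell. g' a x * \<psi> x)"
      using w t LINT_Q_test(1)[OF \<phi>L \<phi>' c(1)] LINT_Q_test(1)[OF L2per_nth[OF gL] g'(1)[of a] g'(2)[of a] c(2)]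
      by (simp add: weak_gradient_def)
  qed
  moreover have "(LINT x:Q|lebesgue. J x \<bullet> g x) = (LINT x|cell. J' 1 x * g' 1 x + J' 2 x * g' 2 x)"
  proof (rule lint_Q_eq_cell(1))
    show "(\<lambda>x. J x \<bullet> g x) \<in> borel_measurable lebesgue"
      using J(1) gL by (intro borel_measurable_inner) (auto simp: L2per_def)
    show "(\<lambda>x. J' 1 x * g' 1 x + J' 2 x * g' 2 x) \<in> borel_measurable borel"
      using L2cellD[OF J'(1)] L2cellD[OF g'(1)] by (intro borel_measurable_add borel_measurable_times)
    show "AE x in cell. J x \<bullet> g x = J' 1 x * g' 1 x + J' 2 x * g' 2 x"
      using J'(2)[of 1] J'(2)[of 2] g'(2)[of 1] g'(2)[of 2]
      by eventually_elim (simp add: inner_vec_def sum_2)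
  qed
  ultimately show ?thesis by simp
qed

lemma linear_R_perp: "linear ((*v) R_perp)"
  by (rule matrix_vector_mul_linear)

lemma R_perp_nth: "(R_perp *v u) $ 1 = - u $ 2" "(R_perp *v u) $ 2 = u $ 1"
  by (simp_all add: vec2_simps)

text \<open>Rotation turns zero divergence into zero curl. Subtracting the mean provides the
  zero-mean condition required by \<open>ex_potential_cell\<close>.\<close>

lemma ex_potential:
  assumes J: "L2per J" "div_free J"
  shows "\<exists>\<phi>. H1per_with_gradient \<phi> (\<lambda>x. R_perp *v J x - R_perp *v (LINT x:Q|lebesgue. J x))"
proof -
  define m where "m = (LINT x:Q|lebesgue. J x)"
  define g where "g = (\<lambda>x. R_perp *v J x - R_perp *v m)"
  obtain J' where J': "\<And>a. L2cell (J' a)" "\<And>a. AE x in cell. J x $ a = J' a x"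
    using ex_L2cell_version_vec[OF J(1)] by blast
  have mean: "(LINT x|cell. J' a x) = m $ a" for a
  proof -
    have "m $ a = (LINT x:Q|lebesgue. J x $ a)"
      unfolding m_def by (rule LINT_Q_linear[symmetric, OF L2per_set_integrable[OF J(1)] linear_vec_nth])
    also have "\<dots> = (LINT x|cell. J' a x)"
      using LINT_Q_test(1)[OF L2per_nth[OF J(1)] J'(1)[of a] J'(2)[of a], of "\<lambda>x. 1"] by simp
    finally show ?thesis by simp
  qed
  \<comment> \<open>The components of the rotated field \<open>g\<close>. The constants do not
    affect the curl condition, since derivatives of test functions have mean zero.\<close>
  let ?G1 = "\<lambda>x. m $ 2 - J' 2 x" and ?G2 = "\<lambda>x. J' 1 x - m $ 1"
  have G: "L2cell ?G1" "L2cell ?G2" by (intro L2cell_diff L2cell_const J')+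
  have Gmean: "(LINT x|cell. ?G1 x) = 0" "(LINT x|cell. ?G2 x) = 0"
    using L2cell_integrable[OF J'(1)] by (simp_all add: mean)
  have curl: "(LINT x|cell. ?G1 x * partial 2 \<psi> x) = (LINT x|cell. ?G2 x * partial 1 \<psi> x)" if t: "test_fun \<psi>" for \<psi>
  proof -
    have c: "continuous_on UNIV (partial b \<psi>)" for b
      using t by (intro test_fun_continuous test_fun_partial)
    have i: "integrable cell (\<lambda>x. J' a x * partial b \<psi> x)" "integrable cell (partial b \<psi>)" for a b
      using L2cell_mult_integrable[OF J'(1) L2cell_continuous[OF c]] integrable_cell_continuous[OF c] by auto
    have "(LINT x|cell. J' 1 x * partial 1 \<psi> x) + (LINT x|cell. J' 2 x * partial 2 \<psi> x) = 0"
      using J(2) t LINT_Q_gradient[OF J(1) t J'] i by (simp add: div_free_def)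
    moreover have "(LINT x|cell. ?G1 x * partial 2 \<psi> x) = - (LINT x|cell. J' 2 x * partial 2 \<psi> x)"
      using i by (simp add: left_diff_distrib integral_cell_partial[OF t])
    moreover have "(LINT x|cell. ?G2 x * partial 1 \<psi> x) = (LINT x|cell. J' 1 x * partial 1 \<psi> x)"
      using i by (simp add: left_diff_distrib integral_cell_partial[OF t])
    ultimately show ?thesis by simp
  qed
  obtain \<phi>' where \<phi>': "L2cell \<phi>'"
    and pot: "\<And>\<psi>. test_fun \<psi> \<Longrightarrow>
     (LINT x|cell. \<phi>' x * partial 1 \<psi> x) = - (LINT x|cell. ?G1 x * \<psi> x) \<and>
     (LINT x|cell. \<phi>' x * partial 2 \<psi> x) = - (LINT x|cell. ?G2 x * \<psi> x)"
    using ex_potential_cell[OF G Gmean curl] by blast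
  \<comment> \<open>Periodic extension of the potential. No matching at the edges has to be checked:
    weak gradients are tested by integrals over \<open>Q\<close> against periodic functions, which
    \<open>\<phi>'\<close> already satisfies.\<close>
  define \<phi> where "\<phi> = (\<lambda>x :: real^2. \<phi>' (vec2 (frac (x $ 1), frac (x $ 2))))"
  note [measurable] = L2cellD[OF \<phi>']
  have m\<phi>: "\<phi> \<in> borel_measurable borel"
    unfolding \<phi>_def frac_def by measurable
  then have m\<phi>': "\<phi> \<in> borel_measurable lebesgue" by (intro measurable_completion) simp
  have per: "periodic \<phi>"
    unfolding periodic_def
  proof (intro allI)
    fix x :: "real^2" and i :: 2
    have "frac ((x + axis i 1) $ j) = frac (x $ j)" for j
      using frac_1_eq[of "x $ i"] by (simp add: axis_def)
    then show "\<phi> (x + axis i 1) = \<phi> x" unfolding \<phi>_def by metis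
  qed
  have \<phi>eq: "AE x in cell. \<phi> x = \<phi>' x"
    using AE_cell by eventually_elim (simp add: \<phi>_def frac_eq)
  have L\<phi>: "L2per \<phi>"
  proof -
    have "AE x in cell. (norm (\<phi> x))\<^sup>2 = (\<phi>' x)\<^sup>2" using \<phi>eq by eventually_elim simp
    from lint_Q_eq_cell(2)[OF _ _ this] m\<phi>' \<phi>' per show ?thesis
      by (auto simp: L2per_def L2cell_def)
  qed
  have Lg: "L2per g"
    unfolding g_def using L2per_add[OF L2per_linear[OF J(1) linear_R_perp] L2per_const[of "- (R_perp *v m)"]] by simp
  have "weak_gradient \<phi> g"
    unfolding weak_gradient_def
  proof (intro allI impI)
    fix \<psi> and a :: 2 assume t: "test_fun \<psi>"
    have c: "continuous_on UNIV (partial a \<psi>)" "continuous_on UNIV \<psi>"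
      using t by (intro test_fun_continuous test_fun_partial; assumption)+
    have 1: "AE x in cell. g x $ 1 = ?G1 x"
      using J'(2)[of 2] by eventually_elim (simp add: g_def R_perp_nth)
    have 2: "AE x in cell. g x $ 2 = ?G2 x"
      using J'(2)[of 1] by eventually_elim (simp add: g_def R_perp_nth)
    show "(LINT x:Q|lebesgue. \<phi> x * partial a \<psi> x) = - (LINT x:Q|lebesgue. g x $ a * \<psi> x)"
      using exhaust_2[of a] pot[OF t] LINT_Q_test(1)[OF L\<phi> \<phi>' \<phi>eq c(1)]
        LINT_Q_test(1)[OF L2per_nth[OF Lg] G(1) 1 c(2)] LINT_Q_test(1)[OF L2per_nth[OF Lg] G(2) 2 c(2)]
      by auto
  qed
  with L\<phi> Lg show ?thesis
    unfolding H1per_with_gradient_def g_def m_def by blast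
qed

lemma LINT_Q_partial:
  assumes t: "test_fun \<psi>"
  shows "(LINT x:Q|lebesgue. c \<bullet> (\<chi> a. partial a \<psi> x)) = 0"
proof -
  have L: "L2cell (\<lambda>x. c $ a)" for a by (rule L2cell_const)
  have "integrable cell (partial b \<psi>)" for b
    using t by (intro integrable_cell_continuous test_fun_continuous test_fun_partial)
  then show ?thesis
    using LINT_Q_gradient[OF L2per_const[of c] t, of "\<lambda>a x. c $ a"] L
    by (simp add: integral_cell_partial[OF t])
qed

lemma div_free_const: "div_free (\<lambda>x. c)"
  by (simp add: div_free_def LINT_Q_partial)

lemma L2per_gradient_integrable:
  assumes "L2per J" "test_fun \<psi>"
  shows "set_integrable lebesgue Q (\<lambda>x. J x \<bullet> (\<chi> a. partial a \<psi> x))"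
  unfolding inner_gradient
  by (intro set_integral_add(1) L2per_test_integrable L2per_nth test_fun_continuous test_fun_partial assms)

lemma div_free_add:
  assumes "L2per J" "L2per K" "div_free J" "div_free K"
  shows "div_free (\<lambda>x. J x + K x)"
  unfolding div_free_def inner_add_left
  using assms by (simp add: set_integral_add(2) L2per_gradient_integrable div_free_def)

lemma div_free_scaleR: "div_free J \<Longrightarrow> div_free (\<lambda>x. c *\<^sub>R J x)"
  by (simp add: div_free_def)

text \<open>The derivatives of a test function are test functions, so the weak gradient can be used
  on them; the two second derivatives of \<open>\<psi>\<close> then cancel by
  \<open>partial_commute\<close>.\<close>

lemma div_free_R_perp:
  assumes "H1per_with_gradient \<phi> g"
  shows "div_free (\<lambda>x. R_perp *v g x)"
  unfolding div_free_def
proof (intro allI impI)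
  fix \<psi> assume t: "test_fun \<psi>"
  have g: "L2per g" and w: "weak_gradient \<phi> g"
    using assms by (auto simp: H1per_with_gradient_def)
  have c: "continuous_on UNIV (partial b \<psi>)" for b
    using t by (intro test_fun_continuous test_fun_partial)
  have w': "(LINT x:Q|lebesgue. g x $ a * partial b \<psi> x) = - (LINT x:Q|lebesgue. \<phi> x * partial a (partial b \<psi>) x)" for a b
    using w test_fun_partial[OF t] by (simp add: weak_gradient_def)
  have "(LINT x:Q|lebesgue. (R_perp *v g x) \<bullet> (\<chi> a. partial a \<psi> x))
      = (LINT x:Q|lebesgue. g x $ 1 * partial 2 \<psi> x - g x $ 2 * partial 1 \<psi> x)"
    unfolding inner_gradient R_perp_nth by (simp add: algebra_simps)
  also have "\<dots> = (LINT x:Q|lebesgue. g x $ 1 * partial 2 \<psi> x) - (LINT x:Q|lebesgue. g x $ 2 * partial 1 \<psi> x)"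
    by (intro set_integral_diff(2) L2per_test_integrable L2per_nth g c)
  also have "\<dots> = 0"
    using t by (simp add: w' partial_commute test_fun_iff)
  finally show "(LINT x:Q|lebesgue. (R_perp *v g x) \<bullet> (\<chi> a. partial a \<psi> x)) = 0" .
qed

lemma weak_gradient_mean:
  assumes "H1per_with_gradient \<phi> g"
  shows "(LINT x:Q|lebesgue. g x) = 0"
proof -
  have g: "L2per g" and w: "weak_gradient \<phi> g"
    using assms by (auto simp: H1per_with_gradient_def)
  have "(LINT x:Q|lebesgue. g x $ a) = 0" for a
    using w[unfolded weak_gradient_def] test_fun_const[of 1] by (fastforce simp: partial_const)
  moreover have "(LINT x:Q|lebesgue. g x) $ a = (LINT x:Q|lebesgue. g x $ a)" for a
    by (rule LINT_Q_linear[symmetric, OF L2per_set_integrable[OF g] linear_vec_nth])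
  ultimately show ?thesis by (simp add: vec_eq_iff)
qed

subsection \<open>Gradient fields and effective tensors\<close>

text \<open>The part of \<open>cell_field\<close> that does not involve a tensor; one field can thus
  serve in the cell problems of both \<open>frakL L M\<close> and its Kronecker companion.\<close>

definition grad_field :: "tvec \<Rightarrow> (real^2 \<Rightarrow> tvec) \<Rightarrow> bool" where
  "grad_field E0 E \<longleftrightarrow> (\<exists>\<phi> g. \<forall>i. H1per_with_gradient (\<phi> i) (g i) \<and> (\<forall>x. comp i (E x) = comp i E0 + g i x))"

lemma cell_field_iff:
  "cell_field L E0 E \<longleftrightarrow> grad_field E0 E \<and> (\<forall>i. div_free (\<lambda>x. comp i (L x *v E x)))"
  by (simp add: cell_field_def grad_field_def)

lemma grad_field_iff:
  "grad_field E0 E \<longleftrightarrow> (\<forall>i. \<exists>\<phi>. H1per_with_gradient \<phi> (\<lambda>x. comp i (E x) - comp i E0))"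
proof
  assume "grad_field E0 E"
  then obtain \<phi> g where *: "\<And>i. H1per_with_gradient (\<phi> i) (g i)" "\<And>i x. comp i (E x) = comp i E0 + g i x"
    by (auto simp: grad_field_def)
  then have "g i = (\<lambda>x. comp i (E x) - comp i E0)" for i by auto
  with *(1) show "\<forall>i. \<exists>\<phi>. H1per_with_gradient \<phi> (\<lambda>x. comp i (E x) - comp i E0)" by metis
next
  assume "\<forall>i. \<exists>\<phi>. H1per_with_gradient \<phi> (\<lambda>x. comp i (E x) - comp i E0)"
  then obtain \<phi> where "\<And>i. H1per_with_gradient (\<phi> i) (\<lambda>x. comp i (E x) - comp i E0)" by metis
  then show "grad_field E0 E"
    unfolding grad_field_def by (intro exI[of _ \<phi>] exI[of _ "\<lambda>i x. comp i (E x) - comp i E0"]) simp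
qed

lemma tpair_eq: "tpair u v = tpair u 0 + tpair 0 v"
  by (simp add: tvec_eq_iff)

lemma tpair_comp: "tpair (comp 1 v) (comp 2 v) = v"
  by (simp add: tvec_eq_iff)

lemma linear_tpair: "linear (\<lambda>u. tpair u 0)" "linear (tpair 0)"
  by (rule linearI; simp add: tvec_eq_iff)+

lemma L2per_tvec:
  assumes "\<And>i. L2per (\<lambda>x. comp i (E x))"
  shows "L2per E"
proof -
  have "L2per (\<lambda>x. tpair (comp 1 (E x)) 0 + tpair 0 (comp 2 (E x)))"
    by (intro L2per_add L2per_linear[OF assms] linear_tpair)
  then show ?thesis by (simp add: tpair_eq[symmetric] tpair_comp)
qed

lemma L2per_comp: "L2per E \<Longrightarrow> L2per (\<lambda>x. comp i (E x))"
  by (rule L2per_linear[OF _ linear_comp])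

lemma grad_field_L2per:
  assumes "grad_field E0 E"
  shows "L2per E"
proof (rule L2per_tvec)
  fix i
  obtain \<phi> where "H1per_with_gradient \<phi> (\<lambda>x. comp i (E x) - comp i E0)"
    using assms by (auto simp: grad_field_iff)
  then have "L2per (\<lambda>x. (comp i (E x) - comp i E0) + comp i E0)"
    by (intro L2per_add L2per_const) (simp add: H1per_with_gradient_def)
  then show "L2per (\<lambda>x. comp i (E x))" by simp
qed

lemma LINT_Q_comp:
  assumes "L2per E"
  shows "(LINT x:Q|lebesgue. comp i (E x)) = comp i (LINT x:Q|lebesgue. E x)"
  by (rule LINT_Q_linear[OF L2per_set_integrable[OF assms] linear_comp])

lemma LINT_Q_matrix:
  fixes B :: tens
  assumes "L2per E"
  shows "(LINT x:Q|lebesgue. B *v E x) = B *v (LINT x:Q|lebesgue. E x)"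
  by (rule LINT_Q_linear[OF L2per_set_integrable[OF assms] matrix_vector_mul_linear])

lemma L2per_matrix:
  fixes B :: tens
  shows "L2per E \<Longrightarrow> L2per (\<lambda>x. B *v E x)"
  by (rule L2per_linear[OF _ matrix_vector_mul_linear])

lemma L2per_uminus: "L2per (f :: real^2 \<Rightarrow> 'b :: euclidean_space) \<Longrightarrow> L2per (\<lambda>x. - f x)"
  by (rule L2per_linear) (auto intro: linearI)

lemma L2per_diff: "L2per (f :: real^2 \<Rightarrow> 'b :: euclidean_space) \<Longrightarrow> L2per g \<Longrightarrow> L2per (\<lambda>x. f x - g x)"
  using L2per_add[OF _ L2per_uminus, of f g] by simp

lemma LINT_Q_vec_const: "(LINT x:Q|lebesgue. c) = (c :: 'b :: euclidean_space)"
proof -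
  have "linear (\<lambda>r. r *\<^sub>R c)" by (rule linearI) (simp_all add: scaleR_left_distrib)
  from LINT_Q_linear[OF set_integrable_Q_const[of "1::real"] this]
  show ?thesis by (simp add: LINT_Q_const)
qed

lemma grad_field_mean:
  assumes "grad_field E0 E"
  shows "(LINT x:Q|lebesgue. E x) = E0"
proof -
  have L: "L2per E" by (rule grad_field_L2per[OF assms])
  have "comp i (LINT x:Q|lebesgue. E x) = comp i E0" for i
  proof -
    obtain \<phi> where *: "H1per_with_gradient \<phi> (\<lambda>x. comp i (E x) - comp i E0)"
      using assms by (auto simp: grad_field_iff)
    have "(LINT x:Q|lebesgue. comp i (E x) - comp i E0) = comp i (LINT x:Q|lebesgue. E x) - comp i E0"
      using L2per_set_integrable[OF L2per_comp[OF L]] L2per_set_integrable[OF L2per_const[of "comp i E0"]]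
      by (simp add: set_integral_diff(2) LINT_Q_comp[OF L] LINT_Q_vec_const)
    with weak_gradient_mean[OF *] show ?thesis by simp
  qed
  then show ?thesis by (simp add: tvec_eq_iff)
qed

lemma H1per_scaleR:
  assumes "H1per_with_gradient \<phi> g"
  shows "H1per_with_gradient (\<lambda>x. c * \<phi> x) (\<lambda>x. c *\<^sub>R g x)"
  unfolding H1per_with_gradient_def weak_gradient_def
proof (intro conjI allI impI)
  show "L2per (\<lambda>x. c * \<phi> x)"
    using assms by (intro L2per_linear[of \<phi> "(*) c"]) (auto simp: H1per_with_gradient_def algebra_simps intro!: linearI)
  show "L2per (\<lambda>x. c *\<^sub>R g x)"
    using assms by (intro L2per_linear[of g "\<lambda>v. c *\<^sub>R v"]) (auto simp: H1per_with_gradient_def algebra_simps intro!: linearI)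
  fix \<psi> a assume "test_fun \<psi>"
  then have "(LINT x:Q|lebesgue. \<phi> x * partial a \<psi> x) = - (LINT x:Q|lebesgue. g x $ a * \<psi> x)"
    using assms by (simp add: H1per_with_gradient_def weak_gradient_def)
  then show "(LINT x:Q|lebesgue. c * \<phi> x * partial a \<psi> x) = - (LINT x:Q|lebesgue. (c *\<^sub>R g x) $ a * \<psi> x)"
    by (simp add: mult.assoc)
qed

lemma H1per_add:
  assumes "H1per_with_gradient \<phi> g" "H1per_with_gradient \<phi>' g'"
  shows "H1per_with_gradient (\<lambda>x. \<phi> x + \<phi>' x) (\<lambda>x. g x + g' x)"
  unfolding H1per_with_gradient_def weak_gradient_def
proof (intro conjI allI impI)
  have L: "L2per \<phi>" "L2per \<phi>'" "L2per g" "L2per g'"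
    using assms by (auto simp: H1per_with_gradient_def)
  show "L2per (\<lambda>x. \<phi> x + \<phi>' x)" "L2per (\<lambda>x. g x + g' x)"
    by (intro L2per_add L)+
  fix \<psi> a assume t: "test_fun \<psi>"
  have c: "continuous_on UNIV (partial a \<psi>)" "continuous_on UNIV \<psi>"
    using t by (intro test_fun_continuous test_fun_partial; assumption)+
  have "(LINT x:Q|lebesgue. \<phi> x * partial a \<psi> x) = - (LINT x:Q|lebesgue. g x $ a * \<psi> x)"
    "(LINT x:Q|lebesgue. \<phi>' x * partial a \<psi> x) = - (LINT x:Q|lebesgue. g' x $ a * \<psi> x)"
    using assms t by (auto simp: H1per_with_gradient_def weak_gradient_def)
  then show "(LINT x:Q|lebesgue. (\<phi> x + \<phi>' x) * partial a \<psi> x) = - (LINT x:Q|lebesgue. (g x + g' x) $ a * \<psi> x)"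
    using L2per_test_integrable[OF L(1) c(1)] L2per_test_integrable[OF L(2) c(1)]
      L2per_test_integrable[OF L2per_nth[OF L(3)] c(2), of a] L2per_test_integrable[OF L2per_nth[OF L(4)] c(2), of a]
    by (simp add: distrib_right set_integral_add(2))
qed

lemma grad_field_add:
  assumes "grad_field E0 E" "grad_field F0 F"
  shows "grad_field (E0 + F0) (\<lambda>x. E x + F x)"
  unfolding grad_field_iff
proof
  fix i
  obtain \<phi> \<phi>' where "H1per_with_gradient \<phi> (\<lambda>x. comp i (E x) - comp i E0)"
    "H1per_with_gradient \<phi>' (\<lambda>x. comp i (F x) - comp i F0)"
    using assms unfolding grad_field_iff by blast
  from H1per_add[OF this]
  show "\<exists>\<phi>. H1per_with_gradient \<phi> (\<lambda>x. comp i (E x + F x) - comp i (E0 + F0))"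
    by (auto simp: add_diff_add)
qed

lemma grad_field_diff:
  assumes "grad_field E0 E" "grad_field F0 F"
  shows "grad_field (E0 - F0) (\<lambda>x. E x - F x)"
proof -
  have "grad_field (- F0) (\<lambda>x. - F x)"
    unfolding grad_field_iff
  proof
    fix i
    obtain \<phi> where "H1per_with_gradient \<phi> (\<lambda>x. comp i (F x) - comp i F0)"
      using assms by (auto simp: grad_field_iff)
    from H1per_scaleR[OF this, of "-1"]
    show "\<exists>\<phi>. H1per_with_gradient \<phi> (\<lambda>x. comp i (- F x) - comp i (- F0))" by auto
  qed
  from grad_field_add[OF assms(1) this] show ?thesis by simp
qed

text \<open>Hill's lemma: the mean of the product of a gradient field and a divergence-free field is
  the product of their means. Applied to each of the two components of the tensor field.\<close>

lemma grad_field_orthogonal: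
  assumes E: "grad_field E0 E" and J: "L2per J" "\<And>i. div_free (\<lambda>x. comp i (J x))"
  shows "(LINT x:Q|lebesgue. E x \<bullet> J x) = E0 \<bullet> (LINT x:Q|lebesgue. J x)"
proof -
  have L: "L2per E" by (rule grad_field_L2per[OF E])
  have i: "set_integrable lebesgue Q (\<lambda>x. (comp i (E x) - comp i E0) \<bullet> comp i (J x))" for i
    by (intro L2per_mult_integrable L2per_diff L2per_comp L2per_const L J)
  have z: "(LINT x:Q|lebesgue. (comp i (E x) - comp i E0) \<bullet> comp i (J x)) = 0" for i
  proof -
    obtain \<phi> where "H1per_with_gradient \<phi> (\<lambda>x. comp i (E x) - comp i E0)"
      using E by (auto simp: grad_field_iff)
    from div_curl[OF L2per_comp[OF J(1)] J(2) this] show ?thesis by (simp add: inner_commute)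
  qed
  have iJ: "set_integrable lebesgue Q (\<lambda>x. E0 \<bullet> J x)"
    by (intro L2per_mult_integrable L2per_const J)
  have "(LINT x:Q|lebesgue. E x \<bullet> J x) = (LINT x:Q|lebesgue. E0 \<bullet> J x
      + ((comp 1 (E x) - comp 1 E0) \<bullet> comp 1 (J x) + (comp 2 (E x) - comp 2 E0) \<bullet> comp 2 (J x)))"
    by (simp add: inner_comp inner_diff_left algebra_simps)
  also have "\<dots> = (LINT x:Q|lebesgue. E0 \<bullet> J x)"
    using i iJ z by (simp add: set_integral_add)
  also have "\<dots> = E0 \<bullet> (LINT x:Q|lebesgue. J x)"
    by (rule LINT_Q_linear[OF L2per_set_integrable[OF J(1)]]) (auto intro!: linearI simp: inner_add_right)
  finally show ?thesis .
qed

lemma grad_field_T_op_div_free: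
  assumes E: "grad_field E0 E"
  shows "div_free (\<lambda>x. comp i (T_op *v E x))"
proof -
  have R: "div_free (\<lambda>x. R_perp *v comp j (E x))" for j
  proof -
    obtain \<phi> where *: "H1per_with_gradient \<phi> (\<lambda>x. comp j (E x) - comp j E0)"
      using E by (auto simp: grad_field_iff)
    then have L: "L2per (\<lambda>x. R_perp *v (comp j (E x) - comp j E0))"
      by (intro L2per_linear[OF _ linear_R_perp]) (simp add: H1per_with_gradient_def)
    have "div_free (\<lambda>x. R_perp *v (comp j (E x) - comp j E0) + R_perp *v comp j E0)"
      by (intro div_free_add L L2per_const div_free_R_perp[OF *] div_free_const)
    then show ?thesis by (simp add: matrix_vector_mult_diff_distrib)
  qed
  show ?thesis
    using exhaust_2[of i] R[of 1] div_free_scaleR[OF R[of 2], of "-1"] by auto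
qed

lemma div_free_T_op_grad_field:
  assumes J: "L2per J" "\<And>i. div_free (\<lambda>x. comp i (J x))"
  shows "grad_field (T_op *v (LINT x:Q|lebesgue. J x)) (\<lambda>x. T_op *v J x)"
  unfolding grad_field_iff
proof
  fix i
  let ?m = "LINT x:Q|lebesgue. J x"
  have ex: "\<exists>\<phi>. H1per_with_gradient \<phi> (\<lambda>x. R_perp *v comp j (J x) - R_perp *v comp j ?m)" for j
    using ex_potential[OF L2per_comp[OF J(1)] J(2), of j] by (simp add: LINT_Q_comp[OF J(1)])
  obtain \<phi> where "H1per_with_gradient \<phi> (\<lambda>x. R_perp *v comp 2 (J x) - R_perp *v comp 2 ?m)"
    using ex by blast
  from H1per_scaleR[OF this, of "-1"]
  have "\<exists>\<phi>. H1per_with_gradient \<phi> (\<lambda>x. R_perp *v comp 2 ?m - R_perp *v comp 2 (J x))" by auto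
  with ex[of 1] show "\<exists>\<phi>. H1per_with_gradient \<phi> (\<lambda>x. comp i (T_op *v J x) - comp i (T_op *v ?m))"
    using exhaust_2[of i] by auto
qed

lemma LINT_Q_cong_AE:
  fixes f g :: "real^2 \<Rightarrow> 'b :: euclidean_space"
  assumes "f \<in> borel_measurable lebesgue" "g \<in> borel_measurable lebesgue"
    "AE x\<in>Q in lebesgue. f x = g x"
  shows "(LINT x:Q|lebesgue. f x) = (LINT x:Q|lebesgue. g x)"
  unfolding set_lebesgue_integral_def
proof (rule integral_cong_AE)
  show "AE x in lebesgue. indicator Q x *\<^sub>R f x = indicator Q x *\<^sub>R g x"
    using assms(3) by eventually_elim (auto simp: indicator_def)
qed (use assms in measurable)

lemma div_free_cong_AE:
  assumes J: "L2per J" "L2per K" "AE x\<in>Q in lebesgue. J x = K x" and "div_free K"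
  shows "div_free J"
  unfolding div_free_def
proof (intro allI impI)
  fix \<psi> assume t: "test_fun \<psi>"
  have "continuous_on UNIV (gradv \<psi>)"
    using t by (simp add: test_fun_iff smooth_continuous_gradv)
  then have "gradv \<psi> \<in> borel_measurable lebesgue"
    by (intro measurable_completion) (simp add: borel_measurable_continuous_onI)
  then have [measurable]: "(\<lambda>x. \<chi> a. partial a \<psi> x) \<in> borel_measurable lebesgue"
    unfolding gradv_def[abs_def] .
  have [measurable]: "J \<in> borel_measurable lebesgue" "K \<in> borel_measurable lebesgue"
    using J by (auto simp: L2per_def)
  have "(LINT x:Q|lebesgue. J x \<bullet> (\<chi> a. partial a \<psi> x)) = (LINT x:Q|lebesgue. K x \<bullet> (\<chi> a. partial a \<psi> x))"
  proof (rule LINT_Q_cong_AE)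
    show "AE x\<in>Q in lebesgue. J x \<bullet> (\<chi> a. partial a \<psi> x) = K x \<bullet> (\<chi> a. partial a \<psi> x)"
      using J(3) by eventually_elim auto
  qed measurable
  then show "(LINT x:Q|lebesgue. J x \<bullet> (\<chi> a. partial a \<psi> x)) = 0"
    using assms(4) t by (simp add: div_free_def)
qed

lemma norm_matrix_vector_le:
  fixes A :: "real^'n^'m"
  shows "norm (A *v v) \<le> (real CARD('m) * norm A) * norm v"
proof -
  have "norm (A *v v) \<le> (\<Sum>i\<in>UNIV. \<bar>(A *v v) $ i\<bar>)" by (rule norm_le_l1_cart)
  also have "\<dots> \<le> (\<Sum>i\<in>(UNIV :: 'm set). norm A * norm v)"
  proof (rule sum_mono)
    fix i
    have "\<bar>(A *v v) $ i\<bar> = \<bar>A $ i \<bullet> v\<bar>"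
      by (simp add: matrix_vector_mult_def inner_vec_def)
    also have "\<dots> \<le> norm (A $ i) * norm v" by (rule Cauchy_Schwarz_ineq2)
    also have "\<dots> \<le> norm A * norm v"
      by (intro mult_right_mono Finite_Cartesian_Product.norm_nth_le) simp
    finally show "\<bar>(A *v v) $ i\<bar> \<le> norm A * norm v" .
  qed
  finally show ?thesis by (simp add: mult.assoc)
qed

lemma continuous_matrix_vector:
  "continuous_on UNIV (\<lambda>p :: (real^'n^'m) \<times> (real^'n). fst p *v snd p)"
  unfolding matrix_vector_mult_def
  by (intro continuous_on_vec_lambda continuous_on_sum continuous_intros)

lemma composite_L2per:
  assumes A: "composite A" and E: "L2per E"
  shows "L2per (\<lambda>x. A x *v E x)"
proof -
  obtain K where K: "compact K" "range A \<subseteq> K" using A by (auto simp: composite_def)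
  then obtain B where B: "\<And>x. norm (A x) \<le> B"
    using compact_imp_bounded[OF K(1)] unfolding bounded_iff by blast
  show ?thesis
  proof (rule L2per_bound[OF E])
    show "periodic (\<lambda>x. A x *v E x)"
      using A E by (simp add: composite_def L2per_def periodic_def)
    show "(\<lambda>x. A x *v E x) \<in> borel_measurable lebesgue"
      using A E by (intro borel_measurable_continuous_Pair[where H = "(*v)"] continuous_matrix_vector)
        (auto simp: composite_def L2per_def)
    show "norm (A x *v E x) \<le> (real CARD(2 \<times> 2) * B) * norm (E x)" for x
      by (rule order_trans[OF norm_matrix_vector_le]) (intro mult_right_mono mult_left_mono B; simp)
  qed
qed

lemma composite_Sym_pos: "composite A \<Longrightarrow> A x \<in> Sym_pos"
  by (auto simp: composite_def)

lemma Sym_pos_inner: "A \<in> Sym_pos \<Longrightarrow> u \<bullet> (A *v v) = (A *v u) \<bullet> v"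
  by (metis (mono_tags, lifting) Sym_pos_def dot_lmul_matrix mem_Collect_eq transpose_matrix_vector)

lemma Sym_posD: "A \<in> Sym_pos \<Longrightarrow> v \<noteq> 0 \<Longrightarrow> 0 < v \<bullet> (A *v v)"
  by (simp add: Sym_pos_def qf_less_def)

lemma Sym_pos_nonneg: "A \<in> Sym_pos \<Longrightarrow> 0 \<le> v \<bullet> (A *v v)"
  using Sym_posD[of A v] by (cases "v = 0") auto

lemma cell_field_L2per:
  assumes "composite A" "cell_field A E0 E"
  shows "L2per E" "L2per (\<lambda>x. A x *v E x)"
  using assms grad_field_L2per composite_L2per by (auto simp: cell_field_iff)

lemma cell_field_add:
  assumes A: "composite A" and E: "cell_field A E0 E" and F: "cell_field A F0 F"
  shows "cell_field A (E0 + F0) (\<lambda>x. E x + F x)"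
  unfolding cell_field_iff
proof (intro conjI allI)
  show "grad_field (E0 + F0) (\<lambda>x. E x + F x)"
    using E F by (auto simp: cell_field_iff intro: grad_field_add)
  fix i
  have "div_free (\<lambda>x. comp i (A x *v E x) + comp i (A x *v F x))"
    using E F by (intro div_free_add L2per_comp cell_field_L2per(2)[OF A]) (auto simp: cell_field_iff)
  then show "div_free (\<lambda>x. comp i (A x *v (E x + F x)))"
    by (simp add: linear_add[OF matrix_vector_mul_linear])
qed

lemma LINT_Q_eq_0_AE:
  fixes f :: "real^2 \<Rightarrow> real"
  assumes "set_integrable lebesgue Q f" "\<And>x. 0 \<le> f x" "(LINT x:Q|lebesgue. f x) = 0"
  shows "AE x\<in>Q in lebesgue. f x = 0"
proof -
  have "AE x in lebesgue. indicator Q x *\<^sub>R f x = 0"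
    using assms unfolding set_integrable_def set_lebesgue_integral_def
    by (subst (asm) integral_nonneg_eq_0_iff_AE) auto
  then show ?thesis by eventually_elim (simp add: indicator_def split: if_splits)
qed

text \<open>The difference of two solutions has mean zero, so its energy vanishes by Hill's lemma,
  and positivity gives equality almost everywhere.\<close>

lemma cell_field_unique:
  assumes A: "composite A" and E: "cell_field A E0 E" and F: "cell_field A E0 F"
  shows "AE x\<in>Q in lebesgue. F x = E x"
proof -
  let ?D = "\<lambda>x. F x - E x"
  have g: "grad_field 0 ?D"
    using grad_field_diff[of E0 F E0 E] E F by (simp add: cell_field_iff)
  have L: "L2per ?D" by (rule grad_field_L2per[OF g])
  have AL: "L2per (\<lambda>x. A x *v ?D x)" by (rule composite_L2per[OF A L])
  have dv: "div_free (\<lambda>x. comp i (A x *v ?D x))" for i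
  proof -
    have "div_free (\<lambda>x. comp i (A x *v F x) + (-1) *\<^sub>R comp i (A x *v E x))"
      using E F L2per_comp[OF cell_field_L2per(2)[OF A E]] L2per_comp[OF cell_field_L2per(2)[OF A F]]
      by (intro div_free_add div_free_scaleR L2per_linear[of _ "(*\<^sub>R) (-1)"])
        (auto simp: cell_field_iff intro!: linearI)
    then show ?thesis by (simp add: matrix_vector_mult_diff_distrib)
  qed
  have "(LINT x:Q|lebesgue. ?D x \<bullet> (A x *v ?D x)) = 0"
    using grad_field_orthogonal[OF g AL dv] by simp
  then have "AE x\<in>Q in lebesgue. ?D x \<bullet> (A x *v ?D x) = 0"
    using A by (intro LINT_Q_eq_0_AE L2per_mult_integrable L AL Sym_pos_nonneg composite_Sym_pos)
  then show ?thesis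
  proof eventually_elim
    case (elim x)
    then show ?case using Sym_posD[OF composite_Sym_pos[OF A], of "?D x" x] by force
  qed
qed

section \<open>Effective tensors of composites\<close>

lemma effective_apply:
  assumes A: "composite A" and Ls: "is_effective_tensor A Ls" and E: "cell_field A E0 E"
  shows "Ls *v E0 = (LINT x:Q|lebesgue. A x *v E x)"
proof -
  obtain F where F: "cell_field A E0 F" "Ls *v E0 = (LINT x:Q|lebesgue. A x *v F x)"
    using Ls by (auto simp: is_effective_tensor_def)
  have "AE x\<in>Q in lebesgue. A x *v F x = A x *v E x"
    using cell_field_unique[OF A E F(1)] by eventually_elim simp
  then have "(LINT x:Q|lebesgue. A x *v F x) = (LINT x:Q|lebesgue. A x *v E x)"
    using cell_field_L2per(2)[OF A E] cell_field_L2per(2)[OF A F(1)]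
    by (intro LINT_Q_cong_AE) (auto simp: L2per_def)
  then show ?thesis using F(2) by simp
qed

lemma effective_unique:
  assumes "composite A" "is_effective_tensor A Ls" "is_effective_tensor A Ls'"
  shows "Ls = Ls'"
  unfolding matrix_eq
proof
  fix E0
  obtain E where E: "cell_field A E0 E" using assms(2) by (auto simp: is_effective_tensor_def)
  show "Ls *v E0 = Ls' *v E0"
    using effective_apply[OF assms(1,2) E] effective_apply[OF assms(1,3) E] by simp
qed

text \<open>For a composite, uniqueness of cell fields is automatic; it remains to give one field
  with the right mean flux for each \<open>E0\<close>.\<close>

lemma effectiveI:
  assumes A: "composite A" and "\<And>E0. \<exists>E. cell_field A E0 E \<and> Ls *v E0 = (LINT x:Q|lebesgue. A x *v E x)"
  shows "is_effective_tensor A Ls"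
  unfolding is_effective_tensor_def
proof
  fix E0
  obtain E where E: "cell_field A E0 E" "Ls *v E0 = (LINT x:Q|lebesgue. A x *v E x)"
    using assms(2) by blast
  show "\<exists>E. cell_field A E0 E \<and> (\<forall>E'. cell_field A E0 E' \<longrightarrow> (AE x\<in>Q in lebesgue. E' x = E x)) \<and>
      Ls *v E0 = (LINT x:Q|lebesgue. A x *v E x)"
    by (intro exI[of _ E] conjI allI impI E) (rule cell_field_unique[OF A E(1)])
qed

text \<open>The effective form is the mean of the local bilinear form over cell fields, which gives
  symmetry. If the energy of \<open>E0\<close> vanished, its cell field would be zero almost
  everywhere, although its mean is \<open>E0\<close>.\<close>

lemma effective_Sym_pos:
  assumes A: "composite A" and Ls: "is_effective_tensor A Ls"
  shows "Ls \<in> Sym_pos"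
proof -
  have form: "F0 \<bullet> (Ls *v E0) = (LINT x:Q|lebesgue. F x \<bullet> (A x *v E x))"
    if "cell_field A E0 E" "cell_field A F0 F" for E0 E F0 F
    using grad_field_orthogonal[of F0 F "\<lambda>x. A x *v E x"] that cell_field_L2per(2)[OF A that(1)]
      effective_apply[OF A Ls that(1)]
    by (simp add: cell_field_iff)
  have ex: "\<exists>E. cell_field A E0 E" for E0 using Ls by (auto simp: is_effective_tensor_def)
  have sym: "F0 \<bullet> (Ls *v E0) = E0 \<bullet> (Ls *v F0)" for E0 F0
  proof -
    obtain E where E: "cell_field A E0 E" using ex by blast
    obtain F where F: "cell_field A F0 F" using ex by blast
    have "F x \<bullet> (A x *v E x) = E x \<bullet> (A x *v F x)" for x
      using Sym_pos_inner[OF composite_Sym_pos[OF A], of "F x" x "E x"] by (simp add: inner_commute)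
    then show ?thesis using form[OF E F] form[OF F E] by simp
  qed
  have entry: "axis i 1 \<bullet> (Ls *v axis j 1) = Ls $ i $ j" for i j
    by (simp add: inner_axis' matrix_vector_mult_basis column_def)
  have "transpose Ls = Ls"
    unfolding transpose_eq_iff using sym[of "axis _ 1" "axis _ 1"] by (simp add: entry)
  moreover have "0 < E0 \<bullet> (Ls *v E0)" if "E0 \<noteq> 0" for E0
  proof (rule ccontr)
    assume neg: "\<not> 0 < E0 \<bullet> (Ls *v E0)"
    obtain E where E: "cell_field A E0 E" using ex by blast
    note LE = cell_field_L2per[OF A E]
    have pos: "0 \<le> E x \<bullet> (A x *v E x)" for x
      by (rule Sym_pos_nonneg[OF composite_Sym_pos[OF A]])
    then have "0 \<le> (LINT x:Q|lebesgue. E x \<bullet> (A x *v E x))"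
      unfolding set_lebesgue_integral_def by (intro Bochner_Integration.integral_nonneg) simp
    then have "(LINT x:Q|lebesgue. E x \<bullet> (A x *v E x)) = 0"
      using neg form[OF E E] by simp
    from LINT_Q_eq_0_AE[OF L2per_mult_integrable[OF LE] pos this]
    have "AE x\<in>Q in lebesgue. E x = 0"
    proof eventually_elim
      case (elim x)
      then show ?case using Sym_posD[OF composite_Sym_pos[OF A], of "E x" x] by force
    qed
    then have "(LINT x:Q|lebesgue. E x) = (LINT x:Q|lebesgue. 0)"
      using LE by (intro LINT_Q_cong_AE) (auto simp: L2per_def)
    moreover have "(LINT x:Q|lebesgue. E x) = E0"
      using E by (intro grad_field_mean) (simp add: cell_field_iff)
    ultimately show False using that by (simp add: LINT_Q_vec_const)
  qed
  ultimately show ?thesis by (simp add: Sym_pos_def qf_less_def)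
qed

lemma exact_relation_M9: "exact_relation M9"
  unfolding exact_relation_def
proof (intro conjI allI impI M9_subset, elim conjE)
  fix A Ls assume A: "composite A" and M9: "AE x in lebesgue. A x \<in> M9" and Ls: "is_effective_tensor A Ls"
  show "Ls \<in> M9"
  proof (rule involutive_imp_M9[OF effective_Sym_pos[OF A Ls]])
    fix E0
    obtain E where E: "cell_field A E0 E" using Ls by (auto simp: is_effective_tensor_def)
    note LE = cell_field_L2per[OF A E]
    let ?J = "\<lambda>x. A x *v E x" and ?F = "\<lambda>x. T_op *v (A x *v E x)"
    have J: "(LINT x:Q|lebesgue. ?J x) = Ls *v E0"
      using effective_apply[OF A Ls E] by simp
    have F: "grad_field (T_op *v (Ls *v E0)) ?F"
      using div_free_T_op_grad_field[OF LE(2)] E unfolding J by (simp add: cell_field_iff)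
    have eq: "AE x\<in>Q in lebesgue. A x *v ?F x = T_op *v E x"
      using M9
    proof eventually_elim
      case (elim x)
      then show ?case using kron_T_op_kron by (auto simp: M9_iff)
    qed
    have LA: "L2per (\<lambda>x. A x *v ?F x)" by (rule composite_L2per[OF A L2per_matrix[OF LE(2)]])
    have LT: "L2per (\<lambda>x. T_op *v E x)" by (rule L2per_matrix[OF LE(1)])
    have E': "grad_field E0 E" using E by (simp add: cell_field_iff)
    have "cell_field A (T_op *v (Ls *v E0)) ?F"
      unfolding cell_field_iff
    proof (intro conjI allI F)
      fix i
      have "AE x\<in>Q in lebesgue. comp i (A x *v ?F x) = comp i (T_op *v E x)"
        using eq by eventually_elim simp
      then show "div_free (\<lambda>x. comp i (A x *v ?F x))"
        by (rule div_free_cong_AE[OF L2per_comp[OF LA] L2per_comp[OF LT] _ grad_field_T_op_div_free[OF E']])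
    qed
    from effective_apply[OF A Ls this]
    have "Ls *v (T_op *v (Ls *v E0)) = (LINT x:Q|lebesgue. A x *v ?F x)" .
    also have "\<dots> = (LINT x:Q|lebesgue. T_op *v E x)"
      using eq LA LT by (intro LINT_Q_cong_AE) (auto simp: L2per_def)
    also have "\<dots> = T_op *v E0"
      by (simp add: LINT_Q_matrix[OF LE(1)] grad_field_mean[OF E'])
    finally show "Ls *v (T_op *v (Ls *v E0)) = T_op *v E0" .
  qed
qed

subsection \<open>The effective tensor of the Kronecker composite\<close>

text \<open>
  \<open>M_of\<close> recovers \<open>M\<close> from \<open>frakL L M\<close>. It is continuous on \<open>Sym_pos\<close>, so it transfers measurability
  and compactness of the range from the composite \<open>frakL L M\<close> to \<open>kron (Lam M) (Pmat M)\<close>.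
\<close>

definition diag_block :: "tens \<Rightarrow> mat2" where
  "diag_block A = (\<chi> i j. A $ (1, i) $ (1, j))"

definition M_of :: "tens \<Rightarrow> mat2" where
  "M_of A = (1 / det (diag_block A)) *\<^sub>R
     ((\<chi> i j. if i = 1 then (if j = 1 then A $ (1, 2) $ (1, 2) else - A $ (1, 1) $ (1, 2))
                   else (if j = 1 then - A $ (1, 2) $ (1, 1) else A $ (1, 1) $ (1, 1)))
      ** ((\<chi> i j. A $ (1, i) $ (2, j)) + R_perp))"

lemma diag_block_frakL: "diag_block (frakL L M) = L"
  by (simp add: diag_block_def frakL_def block_def T_op_def kron_def R_perp_def vec_eq_iff)

text \<open>The upper right block of \<open>frakL L M\<close> is \<open>L ** M - R_perp\<close>,
  because that block of \<open>T_op\<close> is \<open>- R_perp\<close>. \<open>M_of\<close> adds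
  \<open>R_perp\<close> back and multiplies by the adjugate of \<open>L\<close> over its
  determinant.\<close>

lemma M_of_frakL:
  assumes "det L \<noteq> 0"
  shows "M_of (frakL L M) = M"
proof -
  have "(\<chi> i j. frakL L M $ (1, i) $ (2, j)) + R_perp = L ** M"
    by (simp add: frakL_def block_def T_op_def kron_def R_perp_def vec_eq_iff forall_2)
  moreover have "(\<chi> i j. if i = 1 then (if j = 1 then frakL L M $ (1, 2) $ (1, 2) else - frakL L M $ (1, 1) $ (1, 2))
      else (if j = 1 then - frakL L M $ (1, 2) $ (1, 1) else frakL L M $ (1, 1) $ (1, 1)))
      = ((\<chi> i j. if i = 1 then (if j = 1 then L $ 2 $ 2 else - L $ 1 $ 2)
      else (if j = 1 then - L $ 2 $ 1 else L $ 1 $ 1)) :: mat2)" (is "_ = ?adj")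
    by (simp add: frakL_def block_def T_op_def kron_def R_perp_def vec_eq_iff forall_2)
  moreover have "?adj ** (L ** M) = det L *\<^sub>R M"
    by (simp add: vec2_simps det_2) (simp add: algebra_simps)
  ultimately show ?thesis
    using assms by (simp add: M_of_def diag_block_frakL)
qed

lemma det_diag_block_pos:
  assumes "A \<in> Sym_pos"
  shows "0 < det (diag_block A)"
proof -
  have "qf_less 0 (diag_block A)"
    unfolding qf_less_def
  proof (intro allI impI)
    fix x :: "real^2" assume "x \<noteq> 0"
    then have "0 < tpair x 0 \<bullet> (A *v tpair x 0)"
      by (intro Sym_posD[OF assms]) (simp add: tvec_eq_iff)
    then show "x \<bullet> (0 *v x) < x \<bullet> (diag_block A *v x)"
      by (simp add: vec2_simps diag_block_def)
  qed
  moreover have "diag_block A $ 1 $ 2 = diag_block A $ 2 $ 1"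
    using assms unfolding Sym_pos_def transpose_eq_iff diag_block_def by simp
  ultimately show ?thesis
    by (simp add: qf_less_0_mat2 det_2 power2_eq_square)
qed

lemma continuous_on_matrix_mult:
  fixes f :: "'a :: topological_space \<Rightarrow> real^'n^'m" and g :: "'a \<Rightarrow> real^'k^'n"
  assumes "continuous_on S f" "continuous_on S g"
  shows "continuous_on S (\<lambda>x. f x ** g x)"
  unfolding matrix_matrix_mult_def
  by (intro continuous_on_vec_lambda continuous_on_sum continuous_intros assms)

lemma continuous_on_transpose:
  fixes f :: "'a :: topological_space \<Rightarrow> real^'n^'m"
  assumes "continuous_on S f"
  shows "continuous_on S (\<lambda>x. transpose (f x))"
  unfolding transpose_def by (intro continuous_on_vec_lambda continuous_intros assms)

lemma continuous_on_entry: "continuous_on S (\<lambda>A :: real^'n^'m. A $ i $ j)"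
  by (intro continuous_intros)

lemma continuous_on_diag_block: "continuous_on S diag_block"
  unfolding diag_block_def by (intro continuous_on_vec_lambda continuous_on_entry)

lemma continuous_on_M_of:
  assumes "S \<subseteq> Sym_pos"
  shows "continuous_on S M_of"
proof -
  have adj: "continuous_on S (\<lambda>A :: tens. (\<chi> i j. if i = 1 then (if j = 1 then A $ (1, 2) $ (1, 2) else - A $ (1, 1) $ (1, 2))
                   else (if j = 1 then - A $ (1, 2) $ (1, 1) else A $ (1, 1) $ (1, 1))) :: mat2)"
  proof (intro continuous_on_vec_lambda)
    fix i j :: 2
    show "continuous_on S (\<lambda>A :: tens. if i = 1 then (if j = 1 then A $ (1, 2) $ (1, 2) else - A $ (1, 1) $ (1, 2))
                   else (if j = 1 then - A $ (1, 2) $ (1, 1) else A $ (1, 1) $ (1, 1)))"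
      by (cases "i = 1"; cases "j = 1") (auto intro!: continuous_intros)
  qed
  have b: "continuous_on S (\<lambda>A :: tens. (\<chi> i j. A $ (1, i) $ (2, j)) + R_perp)"
    by (intro continuous_on_add continuous_on_const continuous_on_vec_lambda continuous_on_entry)
  have d: "continuous_on S (\<lambda>A. det (diag_block A))"
    unfolding det_2 by (intro continuous_intros continuous_on_diag_block)
  show ?thesis
    unfolding M_of_def[abs_def]
    using assms det_diag_block_pos
    by (intro continuous_on_scaleR continuous_on_divide continuous_on_const d continuous_on_matrix_mult adj b) force
qed

lemma continuous_on_frakL:
  assumes L: "continuous_on S l" and M: "continuous_on S m"
  shows "continuous_on S (\<lambda>x. frakL (l x) (m x))"
proof -
  have B: "continuous_on S (\<lambda>x. block (a x) (b x) (c x) (d x))"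
    if "continuous_on S a" "continuous_on S b" "continuous_on S c" "continuous_on S d" for a b c d
    unfolding block_def
  proof (intro continuous_on_vec_lambda)
    fix r s :: "2 \<times> 2"
    show "continuous_on S (\<lambda>x. (if fst r = 1 then (if fst s = 1 then a x else b x)
                   else (if fst s = 1 then c x else d x)) $ snd r $ snd s)"
      using that by (cases "fst r = 1"; cases "fst s = 1") (auto intro!: continuous_intros)
  qed
  show ?thesis
    unfolding frakL_def
    by (intro continuous_on_add continuous_on_const B continuous_on_matrix_mult continuous_on_transpose L M)
qed

lemma continuous_on_kron_Lam:
  assumes m: "continuous_on S m" and ell: "\<And>x. x \<in> S \<Longrightarrow> elliptic (m x)"
  shows "continuous_on S (\<lambda>x. kron (Lam (m x)) (Pmat (m x)))"
proof -
  have d: "continuous_on S (\<lambda>x. det (Lam (m x)))"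
    unfolding det_Lam by (intro continuous_intros m; simp)
  have nz: "\<forall>x\<in>S. det (Lam (m x)) \<noteq> 0" using det_Lam_pos[OF ell] by force
  have e: "continuous_on S (\<lambda>x. m x $ i $ j)" for i j by (intro continuous_intros m)
  have "continuous_on S (\<lambda>x. Lam (m x) $ i $ j)" for i j
    using exhaust_2[of i] exhaust_2[of j]
    by (elim disjE; simp add: Lam_nth trace_def sum_2 det_2; intro continuous_intros m; simp)
  moreover have "continuous_on S (\<lambda>x. Pmat (m x) $ i $ j)" for i j
    using exhaust_2[of i] exhaust_2[of j] nz
    by (elim disjE; simp add: Pmat_nth; intro continuous_intros e d; simp)
  ultimately show ?thesis
    unfolding kron_def by (intro continuous_on_vec_lambda continuous_on_mult)
qed

lemma composite_kron_Lam:
  assumes comp: "composite (\<lambda>x. frakL (L x) (M x))"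
  shows "composite (\<lambda>x. kron (Lam (M x)) (Pmat (M x)))"
    and "elliptic (M x)" and "transpose (L x) = L x" and "qf_less 0 (L x)"
proof -
  let ?F = "\<lambda>x. frakL (L x) (M x)"
  let ?\<Psi> = "\<lambda>A. kron (Lam (M_of A)) (Pmat (M_of A))"
  have sp: "?F x \<in> Sym_pos" for x using composite_Sym_pos[OF comp] .
  note ell = frakL_Sym_posD[OF sp]
  show "elliptic (M x)" "transpose (L x) = L x" "qf_less 0 (L x)" by (rule ell)+
  obtain K where K: "compact K" "K \<subseteq> Sym_pos" "range ?F \<subseteq> K"
    using comp by (auto simp: composite_def)
  \<comment> \<open>\<open>K\<close> may contain tensors that are not of the form
    \<open>frakL\<close>, and for those \<open>M_of\<close> need not be elliptic. The fixed points
    of reconstruction form a closed subset that still contains all values of the composite.\<close>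
  define K' where "K' = {A \<in> K. frakL (diag_block A) (M_of A) - A \<in> {0}}"
  have c: "continuous_on K (\<lambda>A. frakL (diag_block A) (M_of A) - A)"
    by (intro continuous_on_diff continuous_on_id continuous_on_frakL continuous_on_diag_block continuous_on_M_of K)
  have "K' = K \<inter> (\<lambda>A. frakL (diag_block A) (M_of A) - A) -` {0}"
    by (auto simp: K'_def)
  then have clK': "closed K'"
    using continuous_closed_preimage[OF c compact_imp_closed[OF K(1)] closed_singleton[of 0]] by (simp only:)
  have "K \<inter> K' = K'" by (auto simp: K'_def)
  with compact_Int_closed[OF K(1) clK'] have cK': "compact K'" by (simp only:)
  have ell': "elliptic (M_of A)" if "A \<in> K'" for A
  proof -
    have "frakL (diag_block A) (M_of A) \<in> Sym_pos" using that K(2) by (auto simp: K'_def)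
    then show ?thesis by (rule frakL_Sym_posD(3))
  qed
  have det: "det (L x) \<noteq> 0" for x
    using det_diag_block_pos[OF sp, of x] by (simp add: diag_block_frakL)
  have Mx: "M_of (?F x) = M x" for x by (rule M_of_frakL[OF det])
  have FK': "?F x \<in> K'" for x
    using K(3) by (auto simp: K'_def Mx diag_block_frakL)
  have c\<Psi>: "continuous_on K' ?\<Psi>"
    by (intro continuous_on_kron_Lam continuous_on_M_of ell') (use K(2) in \<open>auto simp: K'_def\<close>)
  show "composite (\<lambda>x. kron (Lam (M x)) (Pmat (M x)))"
    unfolding composite_def
  proof (intro conjI exI[of _ "?\<Psi> ` K'"])
    have "M (x + axis i 1) = M x" for x i
      using comp Mx[of x] Mx[of "x + axis i 1"] unfolding composite_def periodic_def by metis
    then show "periodic (\<lambda>x. kron (Lam (M x)) (Pmat (M x)))" by (simp add: periodic_def)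
    \<comment> \<open>\<open>?\<Psi>\<close> is only known to be continuous on \<open>K'\<close>.
      Extended by zero outside this closed set it is Borel, and the extension is never seen along
      the composite.\<close>
    have "(\<lambda>A. if A \<in> K' then ?\<Psi> A else 0) \<in> borel_measurable borel"
      using compact_imp_closed[OF cK'] by (intro borel_measurable_continuous_on_if c\<Psi>) auto
    from measurable_compose[OF _ this, of ?F lebesgue] comp
    have "(\<lambda>x. if ?F x \<in> K' then ?\<Psi> (?F x) else 0) \<in> borel_measurable lebesgue"
      by (simp add: composite_def)
    then show "(\<lambda>x. kron (Lam (M x)) (Pmat (M x))) \<in> borel_measurable lebesgue"
      by (simp add: FK' Mx)
    show "compact (?\<Psi> ` K')" by (rule compact_continuous_image[OF c\<Psi> cK'])
    have "?\<Psi> A \<in> Sym_pos" if "A \<in> K'" for A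
    proof -
      have "?\<Psi> A \<in> M9" unfolding M9_iff using M9_pair_Lam[OF ell'[OF that]] by blast
      then show ?thesis using M9_subset by blast
    qed
    then show "?\<Psi> ` K' \<subseteq> Sym_pos" by blast
    have "kron (Lam (M x)) (Pmat (M x)) = ?\<Psi> (?F x)" for x by (simp add: Mx)
    then show "range (\<lambda>x. kron (Lam (M x)) (Pmat (M x))) \<subseteq> ?\<Psi> ` K'" using FK' by blast
  qed
qed

text \<open>The cell field of \<open>frakL L M\<close> for \<open>E0\<close>, provided by
  \<open>eff\<close>, is itself a cell field of the Kronecker composite, with flux
  \<open>T_op *v E x\<close> almost everywhere.\<close>

lemma cell_field_kernel:
  assumes comp: "composite (\<lambda>x. frakL (L x) (M x))"
    and eff: "is_effective_tensor (\<lambda>x. frakL (L x) (M x)) (frakL Ls Ms)"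
    and E0: "comp 1 E0 + Ms *v comp 2 E0 = 0"
  obtains E where "cell_field (\<lambda>x. kron (Lam (M x)) (Pmat (M x))) E0 E"
    "(LINT x:Q|lebesgue. kron (Lam (M x)) (Pmat (M x)) *v E x) = T_op *v E0"
proof -
  let ?F = "\<lambda>x. frakL (L x) (M x)" and ?A = "\<lambda>x. kron (Lam (M x)) (Pmat (M x))"
  note A = composite_kron_Lam(1)[OF comp] and ell = composite_kron_Lam(2)[OF comp]
    and Lpos = composite_kron_Lam(4)[OF comp]
  have "frakL Ls Ms *v E0 - T_op *v E0 = 0"
    by (simp only: tvec_eq_iff comp_frakL E0) (simp add: tvec_eq_iff)
  then have FE0: "frakL Ls Ms *v E0 = T_op *v E0" by simp
  obtain E where E: "cell_field ?F E0 E" using eff by (auto simp: is_effective_tensor_def)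
  have gE: "grad_field E0 E" and dF: "div_free (\<lambda>x. comp i (?F x *v E x))" for i
    using E by (auto simp: cell_field_iff)
  note LE = cell_field_L2per[OF comp E]
  have LT: "L2per (\<lambda>x. T_op *v E x)" by (rule L2per_matrix[OF LE(1)])
  have dT: "div_free (\<lambda>x. comp i (T_op *v E x))" for i by (rule grad_field_T_op_div_free[OF gE])
  have meanT: "(LINT x:Q|lebesgue. T_op *v E x) = T_op *v E0"
    by (simp add: LINT_Q_matrix[OF LE(1)] grad_field_mean[OF gE])
  let ?u = "\<lambda>x. comp 1 (E x) + M x *v comp 2 (E x)"
  \<comment> \<open>The energy density splits into a flux part and a \<open>T_op\<close> part, both
    divergence-free fluxes, so its mean is computed from \<open>E0\<close> alone by Hill's
    lemma.\<close>
  have S: "E x \<bullet> (?F x *v E x) - E x \<bullet> (T_op *v E x) = ?u x \<bullet> (L x *v ?u x)" for x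
    using frakL_diff_form[of "E x" "L x" "M x"] by (simp add: inner_diff_right)
  have pos: "0 \<le> ?u x \<bullet> (L x *v ?u x)" for x
    using Lpos[of x] unfolding qf_less_def by (cases "?u x = 0") (auto simp: less_imp_le)
  have i: "set_integrable lebesgue Q (\<lambda>x. E x \<bullet> (?F x *v E x))" "set_integrable lebesgue Q (\<lambda>x. E x \<bullet> (T_op *v E x))"
    by (intro L2per_mult_integrable LE LT)+
  have "(LINT x:Q|lebesgue. ?u x \<bullet> (L x *v ?u x)) = E0 \<bullet> (frakL Ls Ms *v E0) - E0 \<bullet> (T_op *v E0)"
    unfolding S[symmetric]
    by (simp add: set_integral_diff(2)[OF i] grad_field_orthogonal[OF gE LE(2) dF]
        grad_field_orthogonal[OF gE LT dT] meanT effective_apply[OF comp eff E])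
  also have "\<dots> = 0" by (simp add: FE0)
  finally have "(LINT x:Q|lebesgue. ?u x \<bullet> (L x *v ?u x)) = 0" .
  moreover have "set_integrable lebesgue Q (\<lambda>x. ?u x \<bullet> (L x *v ?u x))"
    unfolding S[symmetric] by (rule set_integral_diff(1)[OF i])
  ultimately have "AE x\<in>Q in lebesgue. ?u x \<bullet> (L x *v ?u x) = 0"
    using pos by (intro LINT_Q_eq_0_AE)
  then have eq: "AE x\<in>Q in lebesgue. ?A x *v E x = T_op *v E x"
  proof eventually_elim
    case (elim x)
    show ?case
    proof
      assume "x \<in> Q"
      then have "?u x = 0" using elim Lpos[of x] unfolding qf_less_def by fastforce
      then show "?A x *v E x = T_op *v E x" by (rule kron_Lam_kernel[OF ell])
    qed
  qed
  have LA: "L2per (\<lambda>x. ?A x *v E x)" by (rule composite_L2per[OF A LE(1)])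
  show thesis
  proof (rule that)
    show "cell_field ?A E0 E"
      unfolding cell_field_iff
    proof (intro conjI allI gE)
      fix i
      have "AE x\<in>Q in lebesgue. comp i (?A x *v E x) = comp i (T_op *v E x)"
        using eq by eventually_elim simp
      then show "div_free (\<lambda>x. comp i (?A x *v E x))"
        by (rule div_free_cong_AE[OF L2per_comp[OF LA] L2per_comp[OF LT] _ dT])
    qed
    show "(LINT x:Q|lebesgue. ?A x *v E x) = T_op *v E0"
      unfolding meanT[symmetric] using LA LT eq by (intro LINT_Q_cong_AE) (auto simp: L2per_def)
  qed
qed

text \<open>Here the new field is the rotated flux rather than the field itself: \<open>T_op\<close>
  maps divergence-free fields to gradient fields, and \<open>kron_Lam_dual\<close> returns the
  negative flux, again divergence-free.\<close>

lemma cell_field_dual: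
  assumes comp: "composite (\<lambda>x. frakL (L x) (M x))"
    and eff: "is_effective_tensor (\<lambda>x. frakL (L x) (M x)) (frakL Ls Ms)"
    and Ls: "qf_less 0 Ls" and w0: "comp 2 w0 = transpose Ms *v comp 1 w0"
  obtains E where "cell_field (\<lambda>x. kron (Lam (M x)) (Pmat (M x))) (T_op *v w0) E"
    "(LINT x:Q|lebesgue. kron (Lam (M x)) (Pmat (M x)) *v E x) = - w0"
proof -
  let ?F = "\<lambda>x. frakL (L x) (M x)" and ?A = "\<lambda>x. kron (Lam (M x)) (Pmat (M x))"
  note ell = composite_kron_Lam(2)[OF comp]
  have "inj ((*v) Ls)"
  proof (rule injI)
    fix a b assume "Ls *v a = Ls *v b"
    then have "Ls *v (a - b) = 0" by (simp add: matrix_vector_mult_diff_distrib)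
    moreover have "0 < (a - b) \<bullet> (Ls *v (a - b))" if "a - b \<noteq> 0"
      using Ls that by (simp add: qf_less_def)
    ultimately show "a = b" by fastforce
  qed
  then have "surj ((*v) Ls)" by (intro linear_injective_imp_surjective matrix_vector_mul_linear) simp_all
  \<comment> \<open>Any prescribed mean \<open>w0\<close> in the plane is reached by some
    \<open>E0\<close>: with second component zero, the mean of the first component of
    \<open>w\<close> is \<open>Ls *v y\<close>, and \<open>Ls\<close> is onto.\<close>
  then obtain y where y: "Ls *v y = comp 1 w0" by (metis surjD)
  define E0 where "E0 = tpair y 0"
  have FE0: "frakL Ls Ms *v E0 - T_op *v E0 = w0"
    unfolding tvec_eq_iff comp_frakL by (simp add: E0_def y w0 del: transpose_matrix_vector)
  obtain E where E: "cell_field ?F E0 E" using eff by (auto simp: is_effective_tensor_def)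
  have gE: "grad_field E0 E" and dF: "div_free (\<lambda>x. comp i (?F x *v E x))" for i
    using E by (auto simp: cell_field_iff)
  note LE = cell_field_L2per[OF comp E]
  have LT: "L2per (\<lambda>x. T_op *v E x)" by (rule L2per_matrix[OF LE(1)])
  define w where "w = (\<lambda>x. ?F x *v E x - T_op *v E x)"
  have Lw: "L2per w" unfolding w_def by (rule L2per_diff[OF LE(2) LT])
  have dw: "div_free (\<lambda>x. comp i (w x))" for i
  proof -
    have "div_free (\<lambda>x. comp i (?F x *v E x) + (-1) *\<^sub>R comp i (T_op *v E x))"
      by (intro div_free_add dF div_free_scaleR grad_field_T_op_div_free[OF gE] L2per_comp LE(2)
          L2per_linear[of _ "(*\<^sub>R) (-1)"] LT) (auto intro: linearI)
    then show ?thesis by (simp add: w_def)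
  qed
  have mean: "(LINT x:Q|lebesgue. w x) = w0"
    unfolding w_def
    by (simp add: set_integral_diff(2) L2per_set_integrable LE LT LINT_Q_matrix grad_field_mean[OF gE]
        effective_apply[OF comp eff E, symmetric] FE0)
  have Aw: "?A x *v (T_op *v w x) = - w x" for x
  proof (rule kron_Lam_dual[OF ell])
    show "comp 2 (w x) = transpose (M x) *v comp 1 (w x)" unfolding w_def comp_frakL by (rule refl)
  qed
  show thesis
  proof (rule that[of "\<lambda>x. T_op *v w x"])
    show "cell_field ?A (T_op *v w0) (\<lambda>x. T_op *v w x)"
      unfolding cell_field_iff Aw
      using div_free_T_op_grad_field[OF Lw dw] div_free_scaleR[OF dw, of "-1"] by (simp add: mean)
    have "(LINT x:Q|lebesgue. - w x) = - w0"
      using LINT_Q_linear[OF L2per_set_integrable[OF Lw], of uminus] by (simp add: linearI mean)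
    then show "(LINT x:Q|lebesgue. ?A x *v (T_op *v w x)) = - w0" by (simp add: Aw)
  qed
qed

text \<open>Every mean \<open>v\<close> splits along the two planes of \<open>Ms\<close>. The sum of
  the corresponding fields has mean \<open>v\<close>, and the pointwise identities, now for
  \<open>Ms\<close>, evaluate its mean flux.\<close>

lemma effective_kron_Lam:
  assumes comp: "composite (\<lambda>x. frakL (L x) (M x))"
    and eff: "is_effective_tensor (\<lambda>x. frakL (L x) (M x)) (frakL Ls Ms)"
    and Ls: "qf_less 0 Ls" and Ms: "elliptic Ms"
  shows "is_effective_tensor (\<lambda>x. kron (Lam (M x)) (Pmat (M x))) (kron (Lam Ms) (Pmat Ms))"
proof (rule effectiveI)
  let ?A = "\<lambda>x. kron (Lam (M x)) (Pmat (M x))"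
  show A: "composite ?A" by (rule composite_kron_Lam(1)[OF comp])
  fix v
  obtain x j where v: "v = tpair (- (Ms *v x)) x + T_op *v tpair j (transpose Ms *v j)"
    using elliptic_decomposition[OF Ms] by blast
  let ?E0 = "tpair (- (Ms *v x)) x" and ?w0 = "tpair j (transpose Ms *v j)"
  have E0: "comp 1 ?E0 + Ms *v comp 2 ?E0 = 0" and w0: "comp 2 ?w0 = transpose Ms *v comp 1 ?w0"
    by simp_all
  obtain E where E: "cell_field ?A ?E0 E" "(LINT x:Q|lebesgue. ?A x *v E x) = T_op *v ?E0"
    by (rule cell_field_kernel[OF comp eff E0])
  obtain F where F: "cell_field ?A (T_op *v ?w0) F" "(LINT x:Q|lebesgue. ?A x *v F x) = - ?w0"
    by (rule cell_field_dual[OF comp eff Ls w0])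
  have "(LINT x:Q|lebesgue. ?A x *v (E x + F x)) = T_op *v ?E0 + - ?w0"
    unfolding linear_add[OF matrix_vector_mul_linear] E(2)[symmetric] F(2)[symmetric]
    by (intro set_integral_add(2) L2per_set_integrable cell_field_L2per(2)[OF A E(1)] cell_field_L2per(2)[OF A F(1)])
  also have "\<dots> = kron (Lam Ms) (Pmat Ms) *v v"
    unfolding v linear_add[OF matrix_vector_mul_linear] kron_Lam_kernel[OF Ms E0] kron_Lam_dual[OF Ms w0]
    by (rule refl)
  finally show "\<exists>E. cell_field ?A v E \<and> kron (Lam Ms) (Pmat Ms) *v v = (LINT x:Q|lebesgue. ?A x *v E x)"
    using cell_field_add[OF A E(1) F(1)] unfolding v[symmetric] by (intro exI conjI) auto
qed

theorem mainTheorem5: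
  fixes L M :: "real^2 \<Rightarrow> mat2" and Ls Ms :: mat2
  assumes "composite (\<lambda>x. frakL (L x) (M x))"
    and "\<forall>x. frakL (L x) (M x) \<in> M21"
    and "is_effective_tensor (\<lambda>x. frakL (L x) (M x)) (frakL Ls Ms)"
    and "frakL Ls Ms \<in> M21"
  shows
    "(\<forall>(L' :: real^2 \<Rightarrow> mat2) Ls' Ms'.
        composite (\<lambda>x. frakL (L' x) (M x)) \<and> (\<forall>x. frakL (L' x) (M x) \<in> M21) \<and>
        is_effective_tensor (\<lambda>x. frakL (L' x) (M x)) (frakL Ls' Ms') \<and> frakL Ls' Ms' \<in> M21
        \<longrightarrow> Ms' = Ms) \<and>
     exact_relation M9 \<and>
     (\<forall>A\<in>M9. \<exists>!(\<Lambda>, P). M9_pair \<Lambda> P \<and> A = kron \<Lambda> P \<and> \<Lambda> $ 1 $ 1 = 1) \<and>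
     composite (\<lambda>x. kron (Lam (M x)) (Pmat (M x))) \<and>
     (\<forall>x. kron (Lam (M x)) (Pmat (M x)) \<in> M9) \<and>
     is_effective_tensor (\<lambda>x. kron (Lam (M x)) (Pmat (M x))) (kron (Lam Ms) (Pmat Ms)) \<and>
     (\<exists>\<Lambda>s Ps. is_effective_tensor (\<lambda>x. kron (Lam (M x)) (Pmat (M x))) (kron \<Lambda>s Ps) \<and>
        \<Lambda>s $ 1 $ 1 = 1 \<and> det \<Lambda>s * det Ps = 1) \<and>
     (\<forall>\<Lambda>s Ps. is_effective_tensor (\<lambda>x. kron (Lam (M x)) (Pmat (M x))) (kron \<Lambda>s Ps) \<and>
        \<Lambda>s $ 1 $ 1 = 1 \<and> det \<Lambda>s * det Ps = 1 \<longrightarrow>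
        Ms = (\<Lambda>s $ 1 $ 2) *\<^sub>R mat 1 + det \<Lambda>s *\<^sub>R (R_perp ** Ps))"
proof (intro conjI)
  let ?A = "\<lambda>x. kron (Lam (M x)) (Pmat (M x))"
  have A: "composite ?A" by (rule composite_kron_Lam(1)[OF assms(1)])
  have Ms: "elliptic Ms" by (rule M21D(3)[OF assms(4)])
  have eff: "is_effective_tensor ?A (kron (Lam Ms) (Pmat Ms))"
    by (rule effective_kron_Lam[OF assms(1,3) M21D(2)[OF assms(4)] Ms])
  have Pmat_nz: "Pmat N \<noteq> 0" if "elliptic N" for N
    using det_Pmat[OF that] by (auto simp: det_2)
  \<comment> \<open>Effective tensors are unique, and a Kronecker product normalised by its upper
    left entry determines its factors; so every admissible pair is
    \<open>(Lam Ms, Pmat Ms)\<close>.\<close>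
  have recover: "Ms = (\<Lambda>s $ 1 $ 2) *\<^sub>R mat 1 + det \<Lambda>s *\<^sub>R (R_perp ** Ps)"
    if "is_effective_tensor ?A (kron \<Lambda>s Ps)" "\<Lambda>s $ 1 $ 1 = 1" for \<Lambda>s Ps
  proof -
    have "kron (Lam Ms) (Pmat Ms) = kron \<Lambda>s Ps"
      by (rule effective_unique[OF A eff that(1)])
    from kron_eqD[OF this Lam_nth(1) that(2) Pmat_nz[OF Ms]]
    show ?thesis using elliptic_eq_Lam_Pmat[OF Ms] by simp
  qed
  show "composite ?A" by (rule A)
  show "exact_relation M9" by (rule exact_relation_M9)
  show "\<forall>A\<in>M9. \<exists>!(\<Lambda>, P). M9_pair \<Lambda> P \<and> A = kron \<Lambda> P \<and> \<Lambda> $ 1 $ 1 = 1"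
    using M9_unique_pair by blast
  show "\<forall>x. ?A x \<in> M9"
    using M9_pair_Lam[OF composite_kron_Lam(2)[OF assms(1)]] by (auto simp: M9_iff)
  show "is_effective_tensor ?A (kron (Lam Ms) (Pmat Ms))" by (rule eff)
  show "\<exists>\<Lambda>s Ps. is_effective_tensor ?A (kron \<Lambda>s Ps) \<and> \<Lambda>s $ 1 $ 1 = 1 \<and> det \<Lambda>s * det Ps = 1"
    using eff Lam_nth(1) det_Pmat[OF Ms] by blast
  show "\<forall>\<Lambda>s Ps. is_effective_tensor ?A (kron \<Lambda>s Ps) \<and> \<Lambda>s $ 1 $ 1 = 1 \<and> det \<Lambda>s * det Ps = 1 \<longrightarrow>
      Ms = (\<Lambda>s $ 1 $ 2) *\<^sub>R mat 1 + det \<Lambda>s *\<^sub>R (R_perp ** Ps)"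
    using recover by blast
  show "\<forall>(L' :: real^2 \<Rightarrow> mat2) Ls' Ms'.
        composite (\<lambda>x. frakL (L' x) (M x)) \<and> (\<forall>x. frakL (L' x) (M x) \<in> M21) \<and>
        is_effective_tensor (\<lambda>x. frakL (L' x) (M x)) (frakL Ls' Ms') \<and> frakL Ls' Ms' \<in> M21
        \<longrightarrow> Ms' = Ms"
  proof (intro allI impI, elim conjE)
    fix L' :: "real^2 \<Rightarrow> mat2" and Ls' Ms'
    assume comp: "composite (\<lambda>x. frakL (L' x) (M x))"
      and eff': "is_effective_tensor (\<lambda>x. frakL (L' x) (M x)) (frakL Ls' Ms')"
      and M21: "frakL Ls' Ms' \<in> M21"
    \<comment> \<open>The composite \<open>?A\<close> is built from \<open>M\<close> only, hence is
      the same for \<open>L'\<close>; \<open>Ms\<close> and \<open>Ms'\<close> are read off from one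
      and the same effective tensor.\<close>
    have "is_effective_tensor ?A (kron (Lam Ms') (Pmat Ms'))"
      by (rule effective_kron_Lam[OF comp eff' M21D(2,3)[OF M21]])
    from recover[OF this Lam_nth(1)] show "Ms' = Ms"
      using elliptic_eq_Lam_Pmat[OF M21D(3)[OF M21]] by simp
  qed
qed

end
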